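(* Let $x_0, x_1, \ldots, x_{n-1} \in \{0,1\}^{m}$ be $n$ binary vectors such that $x_0$ and $x_1$ is the unique pair achieving the minimum pairwise Hamming distance $d_{\min}$. Suppose the values of $d_{\min}$ and of the second minimum pairwise distance $d_2$ are given as input. Let $\delta := d_{\min}/m$ and $\delta' := d_2/m$. Then there is a randomized algorithm running in time $O\big(n\log^{2}n\cdot 2^{(1-\kappa_{Z}(\delta')-\delta-(1-\delta)H_{2}(\frac{\delta' - \delta}{2(1-\delta)}))m} \cdot \mathrm{poly}(m)\big)$ which finds the closest pair $x_0$ and $x_1$ with probability at least $1-1/n^2$. Moreover, the running time can be further improved to $O\big(n\log^{2}n\cdot 2^{(H_2(\delta')-\delta-(1-\delta)H_{2}(\frac{\delta'-\delta}{2(1-\delta)}))m} \cdot \mathrm{poly}(m)\big)$ if the algorithm is given black-box access to a decoding algorithm of a binary $(m, K, d)$-code which meets the Gilbert–Varshamov bound.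
   Context: The Hamming distance between $x,y\in\{0,1\}^m$ is the number of coordinates where they differ. All logarithms are base 2. $H_2(p) = -p\log p-(1-p)\log(1-p)$ is the binary entropy function and $H_2^{-1}$ its inverse on $[0,1/2]$. $\kappa_{Z}(\delta) = \max_{0<r<1-H_2(\delta)} r\left(1-\frac{\delta}{H_2^{-1}(1-r)}\right)$ is the rate given by the Zyablov bound. A binary $(m,K,d)$-code is a set of $K$ vectors in $\{0,1\}^m$ with pairwise Hamming distance at least $d$; it meets the Gilbert–Varshamov bound if $\frac{1}{m}\log K \ge 1-H_2(d/m)$ (up to lower-order terms). *)

theory Defs
  imports "HOL-Probability.Probability" "HOL-Library.Log_Nat"
begin

section \<open>Entropy and the Zyablov rate\<close>

definition H2 :: "real \<Rightarrow> real" where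
  "H2 p = - p * log 2 p - (1 - p) * log 2 (1 - p)"

definition H2_inv :: "real \<Rightarrow> real" where
  "H2_inv = the_inv_into {0..1/2} H2"

text \<open>The function being maximised is positive on the open interval and tends to 0 at both of its
  ends, so for \<open>0 < \<delta> < 1/2\<close> the supremum is attained and is the maximum.
  For \<open>\<delta> = 1/2\<close> the interval is empty and the rate is not defined.\<close>

definition zyablov_rate :: "real \<Rightarrow> real" where
  "zyablov_rate \<delta> = (SUP r\<in>{0<..<1 - H2 \<delta>}. r * (1 - \<delta> / H2_inv (1 - r)))"


section \<open>Binary vectors, codes and decoders\<close>

definition cube :: "nat \<Rightarrow> bool list set" where
  "cube m = {x. length x = m}"

definition hamming :: "bool list \<Rightarrow> bool list \<Rightarrow> nat" where
  "hamming x y = card {i. i < length x \<and> x ! i \<noteq> y ! i}"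

definition binary_code :: "nat \<Rightarrow> nat \<Rightarrow> nat \<Rightarrow> bool list set \<Rightarrow> bool" where
  "binary_code m K d C \<longleftrightarrow>
     C \<subseteq> cube m \<and> card C = K \<and> (\<forall>x\<in>C. \<forall>y\<in>C. x \<noteq> y \<longrightarrow> d \<le> hamming x y)"

text \<open>The lower-order term is a null sequence \<open>\<epsilon>\<close>. The condition \<open>K > 0\<close> is needed
  because of the convention \<open>log 2 0 = 0\<close>.\<close>

definition meets_GV :: "(nat \<Rightarrow> real) \<Rightarrow> nat \<Rightarrow> nat \<Rightarrow> nat \<Rightarrow> bool" where
  "meets_GV \<epsilon> m K d \<longleftrightarrow>
     K > 0 \<and> 1 / real m * log 2 (real K) \<ge> 1 - H2 (real d / real m) - \<epsilon> m"

text \<open>Decoding up to half of the minimum distance. On words that are not that close to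
  the code the answer is an arbitrary word of the same length.\<close>

definition decodes :: "nat \<Rightarrow> nat \<Rightarrow> bool list set \<Rightarrow> (bool list \<Rightarrow> bool list) \<Rightarrow> bool" where
  "decodes m d C D \<longleftrightarrow>
     (\<forall>y\<in>cube m. D y \<in> cube m \<and> (\<forall>c\<in>C. 2 * hamming y c < d \<longrightarrow> D y = c))"


section \<open>Closest pair instances\<close>

definition index_pairs :: "nat \<Rightarrow> (nat \<times> nat) set" where
  "index_pairs n = {(i, j). i < j \<and> j < n}"

definition pair_dist :: "bool list list \<Rightarrow> nat \<times> nat \<Rightarrow> nat" where
  "pair_dist xs p = hamming (xs ! fst p) (xs ! snd p)"

definition d_min :: "bool list list \<Rightarrow> nat" where
  "d_min xs = Min (pair_dist xs ` index_pairs (length xs))"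

definition d_second :: "bool list list \<Rightarrow> nat" where
  "d_second xs = Min (pair_dist xs ` index_pairs (length xs) - {d_min xs})"

text \<open>The closest pair sits at arbitrary indices \<open>p\<close>, since its position is what the algorithm
  has to find. At least three vectors are needed for a second minimum distance to exist.\<close>

definition closest_pair_instance :: "nat \<Rightarrow> nat \<Rightarrow> bool list list \<Rightarrow> nat \<times> nat \<Rightarrow> bool" where
  "closest_pair_instance n m xs p \<longleftrightarrow>
     3 \<le> n \<and> length xs = n \<and> set xs \<subseteq> cube m \<and> p \<in> index_pairs n \<and>
     (\<forall>q\<in>index_pairs n. pair_dist xs q = d_min xs \<longleftrightarrow> q = p)"


section \<open>Randomized oracle RAM programs with logarithmic cost\<close>

type_synonym vname = string

record state =
  reg :: "vname \<Rightarrow> nat"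
  mem :: "nat \<Rightarrow> nat"

datatype expr =
    N nat
  | V vname
  | Load expr
  | Add expr expr
  | Sub expr expr

datatype com =
    Skip
  | Assign vname expr
  | Store expr expr       \<comment> \<open>address, value\<close>
  | Flip vname            \<comment> \<open>fair coin\<close>
  | Query expr expr expr  \<comment> \<open>word length, source address, target address\<close>
  | Seq com com
  | If expr com com       \<comment> \<open>nonzero is true\<close>
  | While expr com

primrec oracle_free :: "com \<Rightarrow> bool" where
  "oracle_free Skip = True"
| "oracle_free (Assign x e) = True"
| "oracle_free (Store a e) = True"
| "oracle_free (Flip x) = True"
| "oracle_free (Query l a b) = False"
| "oracle_free (Seq c1 c2) = (oracle_free c1 \<and> oracle_free c2)"
| "oracle_free (If e c1 c2) = (oracle_free c1 \<and> oracle_free c2)"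
| "oracle_free (While e c) = oracle_free c"

text \<open>\<open>Sub\<close> is truncated subtraction on natural numbers.\<close>

primrec eval_expr :: "expr \<Rightarrow> state \<Rightarrow> nat" where
  "eval_expr (N k) s = k"
| "eval_expr (V x) s = reg s x"
| "eval_expr (Load e) s = mem s (eval_expr e s)"
| "eval_expr (Add e1 e2) s = eval_expr e1 s + eval_expr e2 s"
| "eval_expr (Sub e1 e2) s = eval_expr e1 s - eval_expr e2 s"

text \<open>Every evaluation step is charged the number of binary digits of the value it produces
  (\<open>floorlog 2\<close>), plus one. Addresses are values of subexpressions, so they are charged as well.\<close>

primrec cost_expr :: "expr \<Rightarrow> state \<Rightarrow> nat" where
  "cost_expr (N k) s = 1 + floorlog 2 k"
| "cost_expr (V x) s = 1 + floorlog 2 (reg s x)"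
| "cost_expr (Load e) s = cost_expr e s + 1 + floorlog 2 (mem s (eval_expr e s))"
| "cost_expr (Add e1 e2) s =
     cost_expr e1 s + cost_expr e2 s + 1 + floorlog 2 (eval_expr e1 s + eval_expr e2 s)"
| "cost_expr (Sub e1 e2) s =
     cost_expr e1 s + cost_expr e2 s + 1 + floorlog 2 (eval_expr e1 s - eval_expr e2 s)"

definition read_word :: "nat \<Rightarrow> nat \<Rightarrow> (nat \<Rightarrow> nat) \<Rightarrow> bool list" where
  "read_word l a M = map (\<lambda>j. M (a + j) \<noteq> 0) [0..<l]"

definition write_word :: "bool list \<Rightarrow> nat \<Rightarrow> (nat \<Rightarrow> nat) \<Rightarrow> nat \<Rightarrow> nat" where
  "write_word w b M i =
     (if b \<le> i \<and> i < b + length w then of_bool (w ! (i - b)) else M i)"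

text \<open>Small-step semantics: the next command, the next state and the cost of the step.
  An oracle query costs its input and output length on top of its address computations.\<close>

primrec step :: "(bool list \<Rightarrow> bool list) \<Rightarrow> com \<Rightarrow> state \<Rightarrow> (com \<times> state \<times> nat) pmf" where
  "step D Skip s = return_pmf (Skip, s, 0)"
| "step D (Assign x e) s =
     return_pmf (Skip, s\<lparr>reg := (reg s)(x := eval_expr e s)\<rparr>, 1 + cost_expr e s)"
| "step D (Store a e) s =
     return_pmf (Skip, s\<lparr>mem := (mem s)(eval_expr a s := eval_expr e s)\<rparr>,
                 1 + cost_expr a s + cost_expr e s)"
| "step D (Flip x) s =
     map_pmf (\<lambda>b. (Skip, s\<lparr>reg := (reg s)(x := of_bool b)\<rparr>, 1)) (bernoulli_pmf (1 / 2))"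
| "step D (Query l a b) s =
     (let w = D (read_word (eval_expr l s) (eval_expr a s) (mem s)) in
      return_pmf (Skip, s\<lparr>mem := write_word w (eval_expr b s) (mem s)\<rparr>,
                  1 + cost_expr l s + cost_expr a s + cost_expr b s + eval_expr l s + length w))"
| "step D (Seq c1 c2) s =
     (if c1 = Skip then return_pmf (c2, s, 1)
      else map_pmf (\<lambda>(c1', s', t). (Seq c1' c2, s', t)) (step D c1 s))"
| "step D (If e c1 c2) s =
     return_pmf (if eval_expr e s \<noteq> 0 then c1 else c2, s, 1 + cost_expr e s)"
| "step D (While e c) s = return_pmf (If e (Seq c (While e c)) Skip, s, 1)"

primrec run :: "(bool list \<Rightarrow> bool list) \<Rightarrow> nat \<Rightarrow> com \<Rightarrow> state \<Rightarrow> (com \<times> state \<times> nat) pmf" where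
  "run D 0 c s = return_pmf (c, s, 0)"
| "run D (Suc k) c s =
     bind_pmf (step D c s)
       (\<lambda>(c', s', t). map_pmf (\<lambda>(c'', s'', t'). (c'', s'', t + t')) (run D k c' s'))"

text \<open>The parameters are passed in registers. The \<open>i\<close>-th vector occupies the memory
  cells from \<open>i * m\<close> to \<open>i * m + m - 1\<close>. Everything else is initially 0.\<close>

definition input_state :: "nat \<Rightarrow> nat \<Rightarrow> bool list list \<Rightarrow> state" where
  "input_state n m xs =
     \<lparr>reg = (\<lambda>_. 0)(''n'' := n, ''m'' := m, ''dmin'' := d_min xs, ''d2'' := d_second xs),
      mem = (\<lambda>i. if i < n * m then of_bool (xs ! (i div m) ! (i mod m)) else 0)\<rparr>"

text \<open>The time bound \<open>T\<close> is a worst-case bound over all outcomes of the coin flips. Since \<open>Skip\<close> is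
  absorbing at cost 0, the predicate does not depend on which sufficiently large number of steps
  \<open>k\<close> is used. The output is the pair of registers \<open>a\<close>, \<open>b\<close>.\<close>

definition finds_pair_within ::
  "(bool list \<Rightarrow> bool list) \<Rightarrow> com \<Rightarrow> nat \<Rightarrow> nat \<Rightarrow> bool list list \<Rightarrow> nat \<times> nat \<Rightarrow> real \<Rightarrow> real \<Rightarrow> bool"
where
  "finds_pair_within D P n m xs p T q \<longleftrightarrow>
     (\<exists>k. (\<forall>(c, s, t)\<in>set_pmf (run D k P (input_state n m xs)). c = Skip \<and> real t \<le> T) \<and>
          measure_pmf.prob (run D k P (input_state n m xs))
            {(c, s, t). (reg s ''a'', reg s ''b'') = p} \<ge> q)"

end

theory Submission
  imports Defs
begin

text \<open>The algorithm is deterministic and does not need the oracle. Let \<open>\<delta> = d/m\<close> and \<open>\<delta>' = d2/m\<close>. Keep only a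
  cyclic window of \<open>k \<approx> m (1 - 2\<delta>')/(1 - \<delta>)\<^sup>2\<close> coordinates and put every vector into the bucket of every
  \<open>z \<in> {0,1}^k\<close> within distance \<open>\<delta>k/2\<close> of its window. For some position of the window the closest pair
  has at most \<open>\<delta>k\<close> differences in it and therefore shares a bucket. On the other hand, the words of a
  bucket are concentrated around \<open>z\<close> in the window, and \<open>k\<close> is chosen such that their average distance
  is less than \<open>d2\<close>; a Plotkin-type double counting shows that a bucket contains at most \<open>m\<^sup>2 + 1\<close> words,
  so all pairs inside buckets can be compared. The number of buckets per vector is \<open>2^(k H2(\<delta>/2))\<close> up to
  a polynomial factor, and
  \<open>(1 - 2\<delta>')/(1 - \<delta>)\<^sup>2 H2(\<delta>/2) + \<delta> + (1 - \<delta>) H2((\<delta>' - \<delta>)/(2(1 - \<delta>))) \<le> H2(\<delta>')\<close>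
  for \<open>\<delta>' \<le> 1/2\<close>. The Zyablov rate is at most \<open>1 - H2(\<delta>')\<close>, so this proves the first bound as well. A code
  close to the Gilbert--Varshamov bound is only used to exclude \<open>\<delta>' > 2/3\<close> for large \<open>m\<close>; for
  \<open>1/2 \<le> \<delta>' \<le> 2/3\<close> the window length is bounded.\<close>

section \<open>The exponent inequality\<close>

text \<open>The denominator (1 - \<delta>)^2 comes from a count for independent words. Words that
  deviate from z in a fraction \<delta>/2 of the window differ pairwise in a fraction \<delta> (1 -
  \<delta>/2) of it, and in half of the other coordinates. The resulting distance m/2 - k (1 -
  \<delta>)^2 / 2 is below d2 once k (1 - \<delta>)^2 > m - 2 d2. The words of a bucket are
  arbitrary; the double counting shows that they cannot do much better on average than independent
  ones. Averaging over the m cyclic positions of the window replaces a random choice of coordinates,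
  so no coin is flipped. In the exponent inequality both sides tend to 0 with \<delta>', where H2
  has infinite slope. Constant parameters therefore serve only for \<delta>' \<ge> 1/8, and smaller
  values need parameters proportional to \<delta>'. Costs are logarithmic, so addresses must stay
  below 2^O(m). This holds because all words but one are distinct, which bounds n by 2^(m + 1). Keys
  serve directly as addresses, and the memory that is initially 0 is the empty table.\<close>

lemma ln_gibbs:
  fixes x q :: real
  assumes "0 \<le> x" "0 < q"
  shows "x * ln q - x * ln x \<le> q - x"
proof (cases "x = 0")
  case False
  then have "x > 0" using assms by simp
  then have "x * (ln q - ln x) = x * ln (q / x)" using assms by (simp add: ln_div)
  also have "\<dots> \<le> x * (q / x - 1)"
    using \<open>x > 0\<close> assms by (intro mult_left_mono ln_le_minus_one) auto
  also have "\<dots> = q - x" using \<open>x > 0\<close> by (simp add: field_simps)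
  finally show ?thesis by (simp add: algebra_simps)
qed (use assms in simp)

text \<open>Gibbs' inequality: \<open>ln_gibbs\<close> is ln t \<le> t - 1 at t = q/x, and its
  errors q - x cancel over the two outcomes. For fixed q the bound is affine in x, with equality at
  x = q; this is how entropies are linearised below.\<close>

lemma H2_le_cross:
  assumes "0 \<le> x" "x \<le> 1" "0 < q" "q < 1"
  shows "H2 x \<le> x * - log 2 q + (1 - x) * - log 2 (1 - q)"
proof -
  have "x * ln q - x * ln x + ((1 - x) * ln (1 - q) - (1 - x) * ln (1 - x)) \<le> (q - x) + ((1 - q) - (1 - x))"
    using assms by (intro add_mono ln_gibbs) auto
  then have "- x * ln x - (1 - x) * ln (1 - x) \<le> - x * ln q - (1 - x) * ln (1 - q)"
    by simp
  then have "(- x * ln x - (1 - x) * ln (1 - x)) / ln 2 \<le> (- x * ln q - (1 - x) * ln (1 - q)) / ln 2"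
    by (intro divide_right_mono) auto
  then show ?thesis by (simp add: H2_def log_def diff_divide_distrib)
qed

lemma H2_le_1: "0 \<le> x \<Longrightarrow> x \<le> 1 \<Longrightarrow> H2 x \<le> 1"
  using H2_le_cross[of x "1/2"] by (simp add: log_divide)

lemma H2_nonneg: "0 \<le> x \<Longrightarrow> x \<le> 1 \<Longrightarrow> 0 \<le> H2 x"
proof -
  assume x: "0 \<le> x" "x \<le> 1"
  have *: "y * log 2 y \<le> 0" if "0 \<le> y" "y \<le> 1" for y :: real
    by (cases "y = 0") (use that in \<open>auto intro!: mult_nonneg_nonpos\<close>)
  show ?thesis using *[of x] *[of "1 - x"] x by (simp add: H2_def)
qed

text \<open>Concavity: a mixture's entropy is the mixture of two cross entropies, each at least an
  entropy.\<close>
lemma H2_concave: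
  assumes "0 \<le> x" "x \<le> 1" "0 \<le> y" "y \<le> 1" "0 \<le> t" "t \<le> 1"
  shows "(1 - t) * H2 x + t * H2 y \<le> H2 ((1 - t) * x + t * y)"
proof -
  define z where "z = (1 - t) * x + t * y"
  have z: "0 \<le> z" "z \<le> 1"
    using assms convex_bound_le[of x 1 y "1 - t" t] by (auto simp: z_def)
  show ?thesis
  proof (cases "z = 0 \<or> z = 1")
    case False
    have "(1 - t) * H2 x + t * H2 y \<le> (1 - t) * (x * - log 2 z + (1 - x) * - log 2 (1 - z))
            + t * (y * - log 2 z + (1 - y) * - log 2 (1 - z))"
      using assms z False by (intro add_mono mult_left_mono H2_le_cross) auto
    also have "\<dots> = z * - log 2 z + (1 - z) * - log 2 (1 - z)"
      unfolding z_def by (simp add: algebra_simps)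
    also have "\<dots> = H2 z" by (simp add: H2_def)
    finally show ?thesis by (simp only: z_def)
  next
    case True
    have 0: "H2 0 = 0" "H2 1 = 0" by (auto simp: H2_def)
    have "(1 - t = 0 \<or> x = z) \<and> (t = 0 \<or> y = z)"
    proof (cases "z = 0")
      case True
      then have "(1 - t) * x = 0" "t * y = 0"
        using assms unfolding z_def by (auto simp: add_nonneg_eq_0_iff)
      then show ?thesis using True by auto
    next
      case False
      then have "(1 - t) * (1 - x) + t * (1 - y) = 0"
        using \<open>z = 0 \<or> z = 1\<close> unfolding z_def by (simp add: algebra_simps)
      then have "(1 - t) * (1 - x) = 0" "t * (1 - y) = 0"
        using assms by (auto simp: add_nonneg_eq_0_iff)
      then show ?thesis using False True by auto
    qed
    then show ?thesis using True 0 unfolding z_def[symmetric] by auto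
  qed
qed

text \<open>A concave function lies above its chords, so a comparison with an affine function on an
  interval needs only the two end points.\<close>

lemma linear_le_H2:
  assumes "0 \<le> lo" "lo \<le> b" "b \<le> hi" "hi \<le> 1" "lo < hi"
    and "c + d * lo \<le> H2 lo" "c + d * hi \<le> H2 hi"
  shows "c + d * b \<le> H2 b"
proof -
  define t where "t = (b - lo) / (hi - lo)"
  have t: "0 \<le> t" "t \<le> 1" using assms by (auto simp: t_def)
  have b: "b = (1 - t) * lo + t * hi"
  proof -
    have "t * (hi - lo) = b - lo" using assms by (simp add: t_def)
    then show ?thesis by (simp add: algebra_simps)
  qed
  have "c + d * b = (1 - t) * (c + d * lo) + t * (c + d * hi)"
    unfolding b by (simp add: algebra_simps)
  also have "\<dots> \<le> (1 - t) * H2 lo + t * H2 hi"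
    using assms t by (intro add_mono mult_left_mono) auto
  also have "\<dots> \<le> H2 b" unfolding b using assms t by (intro H2_concave) auto
  finally show ?thesis .
qed

text \<open>The exponent of the volume of the intersection of two balls of relative radius \<open>b/2\<close>
  whose centres are at relative distance \<open>a\<close>.\<close>
definition lens_exp :: "real \<Rightarrow> real \<Rightarrow> real" where
  "lens_exp a b = a + (1 - a) * H2 ((b - a) / (2 * (1 - a)))"

text \<open>The factor 1 - a cancels the denominator inside H2, so for fixed q the bound is affine
  in a and in b.\<close>

lemma lens_exp_le_cross:
  assumes "0 \<le> a" "a \<le> b" "b \<le> 1" "a < 1" "0 < q" "q < 1"
  shows "lens_exp a b \<le> a + (b - a) / 2 * - log 2 q + (1 - (a + b) / 2) * - log 2 (1 - q)"
proof -
  define u where "u = (b - a) / (2 * (1 - a))"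
  have u: "0 \<le> u" "u \<le> 1" using assms by (auto simp: u_def)
  have e: "(1 - a) * u = (b - a) / 2"
  proof -
    have "c * (d / (2 * c)) = d / 2" if "c \<noteq> 0" for c d :: real using that by simp
    from this[of "1 - a" "b - a"] show ?thesis using assms unfolding u_def by simp
  qed
  have "(1 - a) * H2 u \<le> (1 - a) * (u * - log 2 q + (1 - u) * - log 2 (1 - q))"
    using assms u by (intro mult_left_mono H2_le_cross) auto
  also have "\<dots> = ((1 - a) * u) * - log 2 q + ((1 - a) - (1 - a) * u) * - log 2 (1 - q)"
    by (simp add: algebra_simps)
  also have "\<dots> = (b - a) / 2 * - log 2 q + (1 - (a + b) / 2) * - log 2 (1 - q)"
    unfolding e by (simp add: field_simps)
  finally show ?thesis by (simp add: lens_exp_def u_def)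
qed

text \<open>The summand a is a * H2(1/2). Concavity applies to the points u and 1/2 with weights 1 -
  a and a, whose mean is b/2. Geometrically, the lens is no larger than one of its balls.\<close>

lemma lens_exp_le_H2_half:
  assumes "0 \<le> a" "a \<le> b" "b \<le> 1" "a < 1"
  shows "lens_exp a b \<le> H2 (b / 2)"
proof -
  define u where "u = (b - a) / (2 * (1 - a))"
  have u: "0 \<le> u" "u \<le> 1" using assms by (auto simp: u_def)
  have e: "(1 - a) * u = (b - a) / 2"
  proof -
    have "c * (d / (2 * c)) = d / 2" if "c \<noteq> 0" for c d :: real using that by simp
    from this[of "1 - a" "b - a"] show ?thesis using assms unfolding u_def by simp
  qed
  have "H2 (1 / 2) = 1" by (simp add: H2_def log_divide)
  moreover have "(1 - a) * H2 u + a * H2 (1 / 2) \<le> H2 ((1 - a) * u + a * (1 / 2))"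
    using assms u by (intro H2_concave) auto
  moreover have "(1 - a) * u + a * (1 / 2) = b / 2" unfolding e by (simp add: field_simps)
  ultimately show ?thesis
    by (simp only: lens_exp_def u_def[symmetric] mult_1_right add.commute)
qed

text \<open>The right-hand side is the chord over [0, b] of the left-hand side, a convex function of
  a. Instead of derivatives, the substitution x = 1/(1 - a) gives the chord bound for x^2. The
  product of this bound with c + d a stays below the chord of the product by the amount d s (1 - s)
  b (y^2 - 1).\<close>

lemma chord_inverse_square:
  fixes a b c d :: real
  assumes "0 \<le> a" "a \<le> b" "b < 1" "0 < b" "0 \<le> c" "0 \<le> d"
  shows "(c + d * a) / (1 - a)\<^sup>2 \<le> c + a / b * ((c + d * b) / (1 - b)\<^sup>2 - c)"
proof -
  define x where "x = 1 / (1 - a)"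
  define y where "y = 1 / (1 - b)"
  have x: "1 \<le> x" using assms by (simp add: x_def)
  have xy: "x \<le> y" using assms by (simp add: x_def y_def frac_le)
  have a: "a = 1 - 1 / x" and b: "b = 1 - 1 / y" using assms by (simp_all add: x_def y_def)
  define s where "s = a / b"
  have s: "0 \<le> s" "s \<le> 1" using assms by (auto simp: s_def)
  have ax: "a * x = x - 1" "b * y = y - 1" unfolding a b using x xy by (auto simp: algebra_simps)
  have sb: "s * b = a" using assms by (simp add: s_def)
  have "x - 1 \<le> s * (y - 1)"
  proof -
    have "s * (y - 1) = a * y" using ax sb by (metis mult.assoc)
    also have "\<dots> \<ge> a * x" using xy assms by (intro mult_left_mono) auto
    finally show ?thesis using ax by simp
  qed
  moreover have "(x - 1) * (x + 1) \<le> (s * (y - 1)) * (y + 1)"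
    using calculation x xy s by (intro mult_mono) auto
  ultimately have sq: "x\<^sup>2 \<le> 1 + s * (y\<^sup>2 - 1)" by (simp add: algebra_simps power2_eq_square)
  have "(c + d * a) / (1 - a)\<^sup>2 = (c + d * a) * x\<^sup>2" by (simp add: x_def power_one_over)
  also have "\<dots> \<le> (c + d * a) * (1 + s * (y\<^sup>2 - 1))"
    using assms sq by (intro mult_left_mono) auto
  also have "\<dots> \<le> c + s * ((c + d * b) * y\<^sup>2 - c)"
  proof -
    have "0 \<le> d * s * (1 - s) * b * (y\<^sup>2 - 1)"
      using assms s x xy by (intro mult_nonneg_nonneg) auto
    moreover have "c + s * ((c + d * b) * y\<^sup>2 - c) - (c + d * (s * b)) * (1 + s * (y\<^sup>2 - 1))
        = d * s * (1 - s) * b * (y\<^sup>2 - 1)" by algebra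
    ultimately show ?thesis using sb by simp
  qed
  finally show ?thesis by (simp add: s_def y_def power_one_over)
qed

text \<open>After bounding both entropies by cross entropies, the left-hand side is convex in \<open>a\<close>, so only
  \<open>a = 0\<close> and \<open>a = b\<close> have to be checked.\<close>
lemma exponent_ineq_from_ends:
  fixes a b q r :: real
  defines "A \<equiv> - log 2 (1 - r)" and "B \<equiv> (log 2 (1 - r) - log 2 r) / 2"
  assumes ab: "0 \<le> a" "a \<le> b" "0 < b" "b \<le> 1/2" and q: "0 < q" "q < 1" and r: "0 < r" "r \<le> 1/2"
    and c0: "b / 2 * - log 2 q + (1 - b / 2) * - log 2 (1 - q) + (1 - 2 * b) * A \<le> H2 b"
    and c1: "b + (1 - b) * - log 2 (1 - q) + (1 - 2 * b) / (1 - b)\<^sup>2 * (A + B * b) \<le> H2 b"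
  shows "(1 - 2 * b) / (1 - a)\<^sup>2 * H2 (a / 2) + lens_exp a b \<le> H2 b"
proof -
  have A: "0 \<le> A" using r by (simp add: A_def)
  have B: "0 \<le> B" using r by (simp add: B_def)
  define s where "s = a / b"
  have s: "0 \<le> s" "s \<le> 1" and sb: "a = s * b" using ab by (auto simp: s_def)
  have "H2 (a / 2) \<le> a / 2 * - log 2 r + (1 - a / 2) * - log 2 (1 - r)"
    using ab r by (intro H2_le_cross) auto
  also have "\<dots> = A + B * a" by (simp add: A_def B_def field_simps)
  finally have "(1 - 2 * b) / (1 - a)\<^sup>2 * H2 (a / 2) \<le> (1 - 2 * b) / (1 - a)\<^sup>2 * (A + B * a)"
    using ab by (intro mult_left_mono) auto
  also have "\<dots> = (1 - 2 * b) * ((A + B * a) / (1 - a)\<^sup>2)" by simp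
  also have "\<dots> \<le> (1 - 2 * b) * (A + s * ((A + B * b) / (1 - b)\<^sup>2 - A))"
    unfolding s_def using ab A B by (intro mult_left_mono chord_inverse_square) auto
  also have "\<dots> = (1 - s) * ((1 - 2 * b) * A) + s * ((1 - 2 * b) / (1 - b)\<^sup>2 * (A + B * b))"
    by (simp add: algebra_simps)
  finally have 1: "(1 - 2 * b) / (1 - a)\<^sup>2 * H2 (a / 2) \<le> \<dots>" .
  have "lens_exp a b \<le> a + (b - a) / 2 * - log 2 q + (1 - (a + b) / 2) * - log 2 (1 - q)"
    using ab q by (intro lens_exp_le_cross) auto
  also have "\<dots> = (1 - s) * (b / 2 * - log 2 q + (1 - b / 2) * - log 2 (1 - q))
      + s * (b + (1 - b) * - log 2 (1 - q))"
    unfolding sb by (simp add: field_simps)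
  finally have "(1 - 2 * b) / (1 - a)\<^sup>2 * H2 (a / 2) + lens_exp a b \<le>
     (1 - s) * (b / 2 * - log 2 q + (1 - b / 2) * - log 2 (1 - q) + (1 - 2 * b) * A) +
     s * (b + (1 - b) * - log 2 (1 - q) + (1 - 2 * b) / (1 - b)\<^sup>2 * (A + B * b))"
    using 1 by (simp add: algebra_simps)
  also have "\<dots> \<le> (1 - s) * H2 b + s * H2 b"
    using s c0 c1 by (intro add_mono mult_left_mono) auto
  finally show ?thesis by (simp add: algebra_simps)
qed

text \<open>The function is concave with derivative - 2c/(1 - c)^3 at c. In p = 1 - c and t = b - c,
  the gap to the tangent without denominators is t^2 times a factor that decreases in t and equals p
  > 0 at t = p.\<close>

lemma rate_le_tangent:
  fixes b c :: real
  assumes "b < 1" "0 < c" "c < 1"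
  shows "(1 - 2 * b) / (1 - b)\<^sup>2 \<le> (1 - 2 * c) / (1 - c)\<^sup>2 - 2 * c / (1 - c) ^ 3 * (b - c)"
proof -
  define p where "p = 1 - c"
  define t where "t = b - c"
  have p: "0 < p" "p < 1" "t < p" using assms by (auto simp: p_def t_def)
  have "2 * (1 - p) * t \<le> 2 * (1 - p) * p" using p by (intro mult_left_mono) auto
  then have "0 \<le> p * (3 - 2 * p) - 2 * (1 - p) * t" using p by (simp add: algebra_simps)
  then have 0: "0 \<le> t\<^sup>2 * (p * (3 - 2 * p) - 2 * (1 - p) * t)" by simp
  have "((2 * p - 1) * p - 2 * (1 - p) * t) * (p - t)\<^sup>2 - (2 * (p - t) - 1) * p ^ 3
     = t\<^sup>2 * (p * (3 - 2 * p) - 2 * (1 - p) * t)" by algebra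
  with 0 have "(2 * (p - t) - 1) * p ^ 3 \<le> ((2 * p - 1) * p - 2 * (1 - p) * t) * (p - t)\<^sup>2" by simp
  then have "(2 * (p - t) - 1) / (p - t)\<^sup>2 \<le> ((2 * p - 1) * p - 2 * (1 - p) * t) / p ^ 3"
    using p by (simp add: divide_le_eq pos_le_divide_eq mult.commute)
  also have "\<dots> = (2 * p - 1) / p\<^sup>2 - 2 * (1 - p) / p ^ 3 * t"
    using p by (simp add: field_simps power3_eq_cube power2_eq_square)
  finally show ?thesis by (simp add: p_def t_def algebra_simps)
qed

text \<open>On an interval of values of \<open>b\<close>, with constant \<open>q\<close> and \<open>r\<close> and the concave function
  \<open>(1 - 2b)/(1 - b)\<^sup>2\<close> replaced by its tangent at \<open>c\<close>, both conditions compare an affine function with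
  the concave function \<open>H2\<close>.\<close>
lemma exponent_ineq_on_interval:
  fixes a b lo hi c q r k l A B Mq :: real
  assumes A: "A = - log 2 (1 - r)" and B: "B = (log 2 (1 - r) - log 2 r) / 2"
    and Mq: "Mq = - log 2 (1 - q)" and Nq: "Nq = - log 2 q"
    and k: "k = (1 - 2 * c) / (1 - c)\<^sup>2" and l: "l = 2 * c / (1 - c) ^ 3"
    and ab: "0 \<le> a" "a \<le> b" "0 < lo" "lo \<le> b" "b \<le> hi" "hi \<le> 1/2" "lo < hi"
    and c: "0 < c" "c < 1" and q: "0 < q" "q < 1" and r: "0 < r" "r \<le> 1/2"
    and e1: "Mq + A + (Nq / 2 - Mq / 2 - 2 * A) * lo \<le> H2 lo"
    and e2: "Mq + A + (Nq / 2 - Mq / 2 - 2 * A) * hi \<le> H2 hi"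
    and e3: "Mq + k * (A + B * c) - (k * B - l * (A + B * c)) * c
              + (1 - Mq + (k * B - l * (A + B * c))) * lo \<le> H2 lo"
    and e4: "Mq + k * (A + B * c) - (k * B - l * (A + B * c)) * c
              + (1 - Mq + (k * B - l * (A + B * c))) * hi \<le> H2 hi"
  shows "(1 - 2 * b) / (1 - a)\<^sup>2 * H2 (a / 2) + lens_exp a b \<le> H2 b"
proof (rule exponent_ineq_from_ends[of a b q r])
  have AB: "0 \<le> A" "0 \<le> B" using r by (auto simp: A B)
  have "Mq + A + (Nq / 2 - Mq / 2 - 2 * A) * b \<le> H2 b"
    by (rule linear_le_H2[of lo _ hi]) (use ab e1 e2 e3 e4 in auto)
  then show "b / 2 * - log 2 q + (1 - b / 2) * - log 2 (1 - q) + (1 - 2 * b) * - log 2 (1 - r) \<le> H2 b"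
    by (simp add: A Mq Nq field_simps)
  have l0: "0 \<le> l" using c by (simp add: l)
  have "(1 - 2 * b) / (1 - b)\<^sup>2 * (A + B * b) \<le> (k - l * (b - c)) * (A + B * b)"
    unfolding k l using ab c AB rate_le_tangent[of b c] by (intro mult_right_mono) auto
  \<comment> \<open>The product of the tangent with A + B b is quadratic in b. Expanded around c its
    leading coefficient is - l B, so dropping the square leaves an affine upper bound.\<close>
  also have "\<dots> = k * (A + B * c) + (k * B - l * (A + B * c)) * (b - c) - l * B * (b - c)\<^sup>2"
    by (simp add: algebra_simps power2_eq_square)
  also have "\<dots> \<le> k * (A + B * c) + (k * B - l * (A + B * c)) * (b - c)"
    using l0 AB by simp
  finally have "b + (1 - b) * Mq + (1 - 2 * b) / (1 - b)\<^sup>2 * (A + B * b) \<le>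
     Mq + k * (A + B * c) - (k * B - l * (A + B * c)) * c + (1 - Mq + (k * B - l * (A + B * c))) * b"
    by (simp add: algebra_simps)
  also have "\<dots> \<le> H2 b"
    by (rule linear_le_H2[of lo _ hi]) (use ab e1 e2 e3 e4 in auto)
  finally show "b + (1 - b) * - log 2 (1 - q)
    + (1 - 2 * b) / (1 - b)\<^sup>2 * (- log 2 (1 - r) + (log 2 (1 - r) - log 2 r) / 2 * b) \<le> H2 b"
    by (simp add: A B Mq)
qed (use ab q r in auto)

section \<open>Rational bounds for logarithms, and the four ranges of b from 1/8 to 1/2\<close>

lemma log_le_rational:
  assumes "0 < x" "(x::real) ^ n \<le> 2 ^ m" "0 < n"
  shows "log 2 x \<le> real m / real n"
proof -
  have "real n * log 2 x = log 2 (x ^ n)" using assms by (simp add: log_nat_power)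
  also have "\<dots> \<le> log 2 (2 ^ m)" using assms by (subst log_le_cancel_iff) auto
  finally show ?thesis using assms by (simp add: log_nat_power field_simps)
qed

lemma rational_le_log:
  assumes "0 < x" "2 ^ m \<le> (x::real) ^ n" "0 < n"
  shows "real m / real n \<le> log 2 x"
proof -
  have "log 2 (2 ^ m) \<le> log 2 (x ^ n)" using assms by (subst log_le_cancel_iff) auto
  also have "\<dots> = real n * log 2 x" using assms by (simp add: log_nat_power)
  finally show ?thesis using assms by (simp add: log_nat_power field_simps)
qed

text \<open>The fractions for 3, 5 and 7 are convergents or intermediate fractions of the continued
  fractions of the logarithms. They are sharp for the size of the integer powers that have to be
  compared.\<close>

lemma log2_3_bounds: "84 / 53 \<le> log 2 (3 :: real)" "log 2 (3 :: real) \<le> 65 / 41"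
  using rational_le_log[of 3 84 53] log_le_rational[of 3 41 65] by simp_all

lemma log2_5_bounds: "65 / 28 \<le> log 2 (5 :: real)" "log 2 (5 :: real) \<le> 72 / 31"
  using rational_le_log[of 5 65 28] log_le_rational[of 5 31 72] by simp_all

lemma log2_smooth:
  "log 2 (2 ^ i * 3 ^ j * 5 ^ k) = real i + real j * log 2 3 + real k * log 2 5"
  by (simp add: log_mult log_nat_power)

text \<open>In the four ranges q, 1 - q, r and 1 - r are quotients of integers without prime factors
  above 5, and 7 enters only through H2(1/8). All conditions thus become linear in the logarithms of
  3, 5 and 7.\<close>

lemma log2_numerals:
  "log 2 (4::real) = 2" "log 2 (6::real) = 1 + log 2 3" "log 2 (8::real) = 3"
  "log 2 (9::real) = 2 * log 2 3" "log 2 (10::real) = 1 + log 2 5"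
  "log 2 (15::real) = log 2 3 + log 2 5" "log 2 (16::real) = 4"
  "log 2 (24::real) = 3 + log 2 3" "log 2 (25::real) = 2 * log 2 5"
  "log 2 (27::real) = 3 * log 2 3" "log 2 (32::real) = 5"
  "log 2 (125::real) = 3 * log 2 5" "log 2 (128::real) = 7"
  using log2_smooth[of 2 0 0] log2_smooth[of 1 1 0] log2_smooth[of 3 0 0] log2_smooth[of 0 2 0]
    log2_smooth[of 1 0 1] log2_smooth[of 0 1 1] log2_smooth[of 4 0 0] log2_smooth[of 3 1 0]
    log2_smooth[of 0 0 2] log2_smooth[of 0 3 0] log2_smooth[of 5 0 0] log2_smooth[of 0 0 3]
    log2_smooth[of 7 0 0]
  by simp_all

lemma H2_values:
  "H2 (1/8) = 3 - 7/8 * log 2 7" "H2 (1/4) = 2 - 3/4 * log 2 3" "H2 (1/3) = log 2 3 - 2/3"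
  "H2 (2/5) = log 2 5 - 2/5 - 3/5 * log 2 3" "H2 (1/2) = 1"
  unfolding H2_def by (simp_all add: log_divide log2_numerals field_simps)

lemma log2_7_bounds: "14 / 5 \<le> log 2 (7 :: real)" "log 2 (7 :: real) \<le> 73 / 26"
  using rational_le_log[of 7 14 5] log_le_rational[of 7 26 73] by simp_all

text \<open>The values of \<open>q\<close>, \<open>r\<close> and \<open>c\<close> in the following four ranges come from a numerical search.\<close>
lemma exponent_ineq_range1:
  assumes "0 \<le> a" "a \<le> b" "1/8 \<le> b" "b \<le> 1/4"
  shows "(1 - 2 * b) / (1 - a)\<^sup>2 * H2 (a / 2) + lens_exp a b \<le> H2 b"
  using assms log2_3_bounds log2_5_bounds log2_7_bounds
  by (intro exponent_ineq_on_interval[OF refl refl refl refl refl refl, where lo="1/8" and hi="1/4" and q="3/128" and r="1/10" and c="1/6"])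
     (auto simp: log_divide log2_numerals H2_values power3_eq_cube power2_eq_square field_simps)

lemma exponent_ineq_range2:
  assumes "0 \<le> a" "a \<le> b" "1/4 \<le> b" "b \<le> 1/3"
  shows "(1 - 2 * b) / (1 - a)\<^sup>2 * H2 (a / 2) + lens_exp a b \<le> H2 b"
  using assms log2_3_bounds log2_5_bounds log2_7_bounds
  by (intro exponent_ineq_on_interval[OF refl refl refl refl refl refl, where lo="1/4" and hi="1/3" and q="1/25" and r="5/32" and c="1/4"])
     (auto simp: log_divide log2_numerals H2_values power3_eq_cube power2_eq_square field_simps)

lemma exponent_ineq_range3:
  assumes "0 \<le> a" "a \<le> b" "1/3 \<le> b" "b \<le> 2/5"
  shows "(1 - 2 * b) / (1 - a)\<^sup>2 * H2 (a / 2) + lens_exp a b \<le> H2 b"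
  using assms log2_3_bounds log2_5_bounds log2_7_bounds
  by (intro exponent_ineq_on_interval[OF refl refl refl refl refl refl, where lo="1/3" and hi="2/5" and q="1/16" and r="1/6" and c="1/3"])
     (auto simp: log_divide log2_numerals H2_values power3_eq_cube power2_eq_square field_simps)

lemma exponent_ineq_range4:
  assumes "0 \<le> a" "a \<le> b" "2/5 \<le> b" "b \<le> 1/2"
  shows "(1 - 2 * b) / (1 - a)\<^sup>2 * H2 (a / 2) + lens_exp a b \<le> H2 b"
  using assms log2_3_bounds log2_5_bounds log2_7_bounds
  by (intro exponent_ineq_on_interval[OF refl refl refl refl refl refl, where lo="2/5" and hi="1/2" and q="1/9" and r="1/6" and c="2/5"])
     (auto simp: log_divide log2_numerals H2_values power3_eq_cube power2_eq_square field_simps)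

section \<open>The exponent inequality for b up to 1/8\<close>

lemma minus_log_one_minus_le:
  assumes "0 \<le> x" "x < (1::real)"
  shows "- log 2 (1 - x) \<le> 3 / 2 * (x / (1 - x))"
proof -
  have "- ln (1 - x) = ln (1 / (1 - x))" using assms by (simp add: ln_div)
  also have "\<dots> \<le> 1 / (1 - x) - 1" using assms by (intro ln_le_minus_one) auto
  also have "\<dots> = x / (1 - x)" using assms by (simp add: field_simps)
  finally have "- ln (1 - x) * (1 / ln 2) \<le> x / (1 - x) * (1 / ln 2)"
    by (intro mult_right_mono) auto
  then have "- log 2 (1 - x) \<le> x / (1 - x) * (1 / ln 2)" by (simp add: log_def)
  also have "\<dots> \<le> x / (1 - x) * (3 / 2)"
    using assms ln2_ge_two_thirds by (intro mult_left_mono) (auto simp: field_simps)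
  finally show ?thesis by (metis mult.commute)
qed

lemma le_minus_log_one_minus:
  assumes "0 \<le> x" "x < (1::real)"
  shows "36 / 25 * x \<le> - log 2 (1 - x)"
proof -
  have "x \<le> - ln (1 - x)" using ln_le_minus_one[of "1 - x"] assms by simp
  then have "x * (36 / 25) \<le> - ln (1 - x) * (1 / ln 2)"
    using assms ln2_le_25_over_36 by (intro mult_mono) (auto simp: field_simps)
  then show ?thesis by (simp add: log_def)
qed

text \<open>With constant q and r the first end condition fails as b tends to 0, where its left-hand
  side tends to the positive number - log (1 - q) - log (1 - r). Hence q = b/8 and r = b/2. With L =
  - log b, both left-hand sides are then at most b L/2 + 5/2 b. The right-hand side is at least b L
  + 63/50 b, and L \<ge> 3 turns half of b L into 3/2 b.\<close>

lemma exponent_ineq_small: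
  assumes a: "0 \<le> a" "a \<le> b" and b: "0 < b" "b \<le> 1/8"
  shows "(1 - 2 * b) / (1 - a)\<^sup>2 * H2 (a / 2) + lens_exp a b \<le> H2 b"
proof -
  define L where "L = - log 2 b"
  have "log 2 b \<le> log 2 (1/8)" using b by (subst log_le_cancel_iff) auto
  then have L: "3 \<le> L" by (simp add: L_def log_divide log2_numerals)
  have l8: "log 2 (b / 8) = - L - 3" "log 2 (b / 2) = - L - 1"
    using b by (simp_all add: L_def log_divide log2_numerals)
  have "- log 2 (1 - b / 8) \<le> 3 / 2 * (b / 8 / (1 - b / 8))"
    using b by (intro minus_log_one_minus_le) auto
  also have "\<dots> \<le> b / 5" using b by (simp add: field_simps)
  finally have q: "- log 2 (1 - b / 8) \<le> b / 5" .
  have "- log 2 (1 - b / 2) \<le> 3 / 2 * (b / 2 / (1 - b / 2))"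
    using b by (intro minus_log_one_minus_le) auto
  also have "\<dots> \<le> 4 / 5 * b" using b by (simp add: field_simps)
  finally have r: "- log 2 (1 - b / 2) \<le> 4 / 5 * b" .
  have nonneg: "0 \<le> - log 2 (1 - b / 8)" "0 \<le> - log 2 (1 - b / 2)" using b by auto
  have "7 / 8 * (36 / 25 * b) \<le> (1 - b) * - log 2 (1 - b)"
    using b le_minus_log_one_minus[of b] by (intro mult_mono) auto
  then have H: "b * L + 63 / 50 * b \<le> H2 b" by (simp add: H2_def L_def)
  have bL: "3 / 2 * b \<le> b * L / 2" using b L by (simp add: field_simps)
  have q': "c * - log 2 (1 - b / 8) \<le> b / 5" if "0 \<le> c" "c \<le> 1" for c
    using mult_mono[of c 1 "- log 2 (1 - b / 8)" "b / 5"] that q nonneg by simp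
  have r': "c * - log 2 (1 - b / 2) \<le> 4 / 5 * b" if "0 \<le> c" "c \<le> 1" for c
    using mult_mono[of c 1 "- log 2 (1 - b / 2)" "4 / 5 * b"] that r nonneg by simp
  show ?thesis
  proof (rule exponent_ineq_from_ends[of a b "b / 8" "b / 2"])
    have "b / 2 * - log 2 (b / 8) = b * L / 2 + 3 / 2 * b" by (simp add: l8 algebra_simps)
    moreover have "(1 - b / 2) * - log 2 (1 - b / 8) \<le> b / 5" using b by (intro q') auto
    moreover have "(1 - 2 * b) * - log 2 (1 - b / 2) \<le> 4 / 5 * b" using b by (intro r') auto
    ultimately show "b / 2 * - log 2 (b / 8) + (1 - b / 2) * - log 2 (1 - b / 8)
        + (1 - 2 * b) * - log 2 (1 - b / 2) \<le> H2 b"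
      using H bL b by linarith
  next
    have "(1 - 2 * b) / (1 - b)\<^sup>2 \<le> 1"
      using b by (simp add: divide_le_eq power2_eq_square algebra_simps)
    moreover have "0 \<le> (1 - 2 * b) / (1 - b)\<^sup>2" using b by simp
    moreover have e: "- log 2 (1 - b / 2) + (log 2 (1 - b / 2) - log 2 (b / 2)) / 2 * b
        = b * L / 2 + b / 2 + (1 - b / 2) * - log 2 (1 - b / 2)"
      by (simp add: l8 algebra_simps add_divide_distrib diff_divide_distrib)
    moreover have "0 \<le> b * L / 2 + b / 2 + (1 - b / 2) * - log 2 (1 - b / 2)"
      using b L nonneg by (intro add_nonneg_nonneg mult_nonneg_nonneg) auto
    ultimately have "(1 - 2 * b) / (1 - b)\<^sup>2
        * (- log 2 (1 - b / 2) + (log 2 (1 - b / 2) - log 2 (b / 2)) / 2 * b)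
        \<le> b * L / 2 + b / 2 + (1 - b / 2) * - log 2 (1 - b / 2)"
      by (metis mult_left_le_one_le)
    moreover have "(1 - b / 2) * - log 2 (1 - b / 2) \<le> 4 / 5 * b" using b by (intro r') auto
    moreover have "(1 - b) * - log 2 (1 - b / 8) \<le> b / 5" using b by (intro q') auto
    ultimately show "b + (1 - b) * - log 2 (1 - b / 8) + (1 - 2 * b) / (1 - b)\<^sup>2
        * (- log 2 (1 - b / 2) + (log 2 (1 - b / 2) - log 2 (b / 2)) / 2 * b) \<le> H2 b"
      using H bL b by linarith
  qed (use a b in auto)
qed

lemma exponent_ineq:
  assumes "0 \<le> a" "a \<le> b" "0 < b" "b \<le> 1/2"
  shows "(1 - 2 * b) / (1 - a)\<^sup>2 * H2 (a / 2) + lens_exp a b \<le> H2 b"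
proof -
  consider "b \<le> 1/8" | "1/8 \<le> b" "b \<le> 1/4" | "1/4 \<le> b" "b \<le> 1/3" | "1/3 \<le> b" "b \<le> 2/5" | "2/5 \<le> b"
    by linarith
  then show ?thesis
    using assms exponent_ineq_small exponent_ineq_range1 exponent_ineq_range2 exponent_ineq_range3 exponent_ineq_range4
    by cases auto
qed


section \<open>Cost logic for deterministic programs\<close>

inductive reaches :: "(bool list \<Rightarrow> bool list) \<Rightarrow> com \<Rightarrow> state \<Rightarrow> nat \<Rightarrow> com \<Rightarrow> state \<Rightarrow> bool"
  for D where
  here: "reaches D c s 0 c s"
| there: "step D c s = return_pmf (c1, s1, t1) \<Longrightarrow> reaches D c1 s1 t2 c2 s2 \<Longrightarrow>
    reaches D c s (t1 + t2) c2 s2"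

lemma reaches_trans:
  "reaches D c s t c1 s1 \<Longrightarrow> reaches D c1 s1 t' c2 s2 \<Longrightarrow> reaches D c s (t + t') c2 s2"
proof (induction rule: reaches.induct)
  case (there c s c1 s1 t1 t2 c2 s2)
  then show ?case using reaches.there[OF there.hyps(1), of "t2 + t'"] by (simp add: add.assoc)
qed simp

lemma reaches_Suc: "step D c s = return_pmf (c1, s1, t) \<Longrightarrow> reaches D c s t c1 s1"
  using reaches.there[OF _ reaches.here, of D c s c1 s1 t] by simp

text \<open>Along point-mass steps the distribution of runs stays a point mass, so one trace settles
  both the worst-case time and the success probability.\<close>

lemma reaches_run: "reaches D c s t c' s' \<Longrightarrow> \<exists>k. run D k c s = return_pmf (c', s', t)"
proof (induction rule: reaches.induct)
  case (here c s)
  show ?case by (rule exI[of _ 0]) simp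
next
  case (there c s c1 s1 t1 t2 c2 s2)
  then obtain k where "run D k c1 s1 = return_pmf (c2, s2, t2)" by blast
  then show ?case using there.hyps by (intro exI[of _ "Suc k"]) (simp add: bind_return_pmf)
qed

lemma reaches_Seq:
  assumes "reaches D c s t c' s'"
  shows "reaches D (Seq c d) s t (Seq c' d) s'"
  using assms
proof (induction rule: reaches.induct)
  case (there c s c1 s1 t1 t2 c2 s2)
  show ?case
  proof (cases "c = Skip")
    \<comment> \<open>The step of \<open>Skip\<close> to itself is left out of the trace of the
      sequence, since \<open>Seq Skip d\<close> would move on to \<open>d\<close>. It has cost 0, so
      the total is unchanged.\<close>
    case True
    then have "(c1, s1, t1) = (Skip, s, 0)" using there.hyps(1) by simp
    then show ?thesis using there.IH True by simp
  next
    case False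
    then have "step D (Seq c d) s = return_pmf (Seq c1 d, s1, t1)" using there.hyps(1) by simp
    then show ?thesis using there.IH by (rule reaches.there)
  qed
qed (rule reaches.here)

section \<open>The cost of expressions when all stored values are bounded\<close>

definition bounded_state :: "nat \<Rightarrow> state \<Rightarrow> bool" where
  "bounded_state X s \<longleftrightarrow> (\<forall>x. reg s x < X) \<and> (\<forall>i. mem s i < X)"

text \<open>The bound 8 matches the assumption 8 \<le> X used below, by which constants obey the
  same bound as stored values.\<close>

primrec small_expr :: "expr \<Rightarrow> bool" where
  "small_expr (N k) = (k \<le> 8)"
| "small_expr (V x) = True"
| "small_expr (Load e) = small_expr e"
| "small_expr (Add e1 e2) = (small_expr e1 \<and> small_expr e2)"
| "small_expr (Sub e1 e2) = (small_expr e1 \<and> small_expr e2)"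

primrec expr_size :: "expr \<Rightarrow> nat" where
  "expr_size (N k) = 1"
| "expr_size (V x) = 1"
| "expr_size (Load e) = expr_size e + 1"
| "expr_size (Add e1 e2) = expr_size e1 + expr_size e2 + 1"
| "expr_size (Sub e1 e2) = expr_size e1 + expr_size e2 + 1"

text \<open>One unit of cost pays for any step whose expressions have at most 32 nodes in total, as long
  as all registers and memory cells stay below \<open>X\<close>.\<close>
definition unit_cost :: "nat \<Rightarrow> nat" where
  "unit_cost X = 1 + 32 * (1 + floorlog 2 (32 * X))"

lemma eval_expr_le:
  assumes "bounded_state X s" "8 \<le> X" "small_expr e"
  shows "eval_expr e s \<le> expr_size e * X"
  using assms
proof (induction e)
  case (Load e)
  then have "mem s (eval_expr e s) < X" by (simp add: bounded_state_def)
  also have "X \<le> (expr_size e + 1) * X" by simp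
  finally show ?case by simp
next
  case (Add e1 e2)
  then have "eval_expr e1 s + eval_expr e2 s \<le> expr_size e1 * X + expr_size e2 * X"
    by (intro add_mono) auto
  then show ?case by (simp add: algebra_simps)
next
  case (Sub e1 e2)
  then have "eval_expr e1 s \<le> expr_size e1 * X" by auto
  then show ?case by (simp add: algebra_simps)
qed (auto simp: bounded_state_def less_imp_le)

lemma cost_expr_le:
  assumes "bounded_state X s" "8 \<le> X" "small_expr e" "expr_size e \<le> 32"
  shows "cost_expr e s \<le> expr_size e * (1 + floorlog 2 (32 * X))"
  using assms(3,4)
proof (induction e)
  case (N k)
  then have "k \<le> 32 * X" using assms by simp
  then show ?case using floorlog_mono[of k "32 * X" 2] by simp
next
  case (V x)
  have "reg s x < X" using assms(1) by (simp add: bounded_state_def)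
  then have "reg s x \<le> 32 * X" by simp
  then show ?case using floorlog_mono[of "reg s x" "32 * X" 2] by simp
next
  case (Load e)
  have "mem s (eval_expr e s) < X" using assms(1) by (simp add: bounded_state_def)
  then have "mem s (eval_expr e s) \<le> 32 * X" by simp
  then show ?case using Load floorlog_mono[of "mem s (eval_expr e s)" "32 * X" 2] by simp
next
  case (Add e1 e2)
  have "eval_expr (Add e1 e2) s \<le> expr_size (Add e1 e2) * X"
    using assms Add.prems by (intro eval_expr_le) auto
  also have "\<dots> \<le> 32 * X" using Add.prems by (intro mult_right_mono) auto
  finally show ?case using Add floorlog_mono[of "eval_expr (Add e1 e2) s" "32 * X" 2]
    by (simp add: algebra_simps)
next
  case (Sub e1 e2)
  have "eval_expr (Sub e1 e2) s \<le> expr_size (Sub e1 e2) * X"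
    using assms Sub.prems by (intro eval_expr_le) auto
  also have "\<dots> \<le> 32 * X" using Sub.prems by (intro mult_right_mono) auto
  finally show ?case using Sub floorlog_mono[of "eval_expr (Sub e1 e2) s" "32 * X" 2]
    by (simp add: algebra_simps)
qed

section \<open>Weakest preconditions that count steps\<close>

locale ram =
  fixes D :: "bool list \<Rightarrow> bool list" and X :: nat
  assumes X8: "8 \<le> X"
begin

text \<open>The postcondition receives the cost in units of \<open>unit_cost X\<close>. The logic
  thus counts steps only, and the logarithmic price of a step enters once at the end. Boundedness is
  part of the definition because every step needs it again.\<close>

definition ends_in :: "com \<Rightarrow> state \<Rightarrow> (state \<Rightarrow> nat \<Rightarrow> bool) \<Rightarrow> bool" where
  "ends_in c s Q \<longleftrightarrow>
     (\<exists>s' t u. reaches D c s t Skip s' \<and> t \<le> u * unit_cost X \<and> bounded_state X s' \<and> Q s' u)"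

lemma ends_in_mono:
  "ends_in c s Q \<Longrightarrow> (\<And>s' u. bounded_state X s' \<Longrightarrow> Q s' u \<Longrightarrow> R s' u) \<Longrightarrow> ends_in c s R"
  unfolding ends_in_def by blast

lemma step_cost:
  assumes "bounded_state X s" "small_expr e" "expr_size e \<le> 32"
  shows "1 + cost_expr e s \<le> unit_cost X"
proof -
  have "cost_expr e s \<le> expr_size e * (1 + floorlog 2 (32 * X))"
    using assms X8 by (intro cost_expr_le)
  also have "\<dots> \<le> 32 * (1 + floorlog 2 (32 * X))" using assms by (intro mult_right_mono) auto
  finally show ?thesis by (simp add: unit_cost_def)
qed

lemma step_cost2:
  assumes "bounded_state X s" "small_expr e" "small_expr a" "expr_size a + expr_size e \<le> 32"
  shows "1 + cost_expr a s + cost_expr e s \<le> unit_cost X"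
proof -
  have "cost_expr a s + cost_expr e s
      \<le> expr_size a * (1 + floorlog 2 (32 * X)) + expr_size e * (1 + floorlog 2 (32 * X))"
    using assms X8 by (intro add_mono cost_expr_le) auto
  also have "\<dots> = (expr_size a + expr_size e) * (1 + floorlog 2 (32 * X))"
    by (simp add: algebra_simps)
  also have "\<dots> \<le> 32 * (1 + floorlog 2 (32 * X))" using assms by (intro mult_right_mono) auto
  finally show ?thesis by (simp add: unit_cost_def)
qed

lemma unit_cost_pos: "1 \<le> unit_cost X" by (simp add: unit_cost_def)

lemma ends_in_Skip: "bounded_state X s \<Longrightarrow> Q s 0 \<Longrightarrow> ends_in Skip s Q"
  unfolding ends_in_def by (intro exI[of _ s] exI[of _ 0]) (simp add: reaches.here)

lemma ends_in_Assign:
  assumes "bounded_state X s" "small_expr e \<and> expr_size e \<le> 32" "eval_expr e s < X"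
    and "\<And>s'. s' = s\<lparr>reg := (reg s)(x := eval_expr e s)\<rparr> \<Longrightarrow> bounded_state X s' \<Longrightarrow> Q s' 1"
  shows "ends_in (Assign x e) s Q"
proof -
  let ?s = "s\<lparr>reg := (reg s)(x := eval_expr e s)\<rparr>"
  have "reaches D (Assign x e) s (1 + cost_expr e s) Skip ?s"
    by (rule reaches_Suc) simp
  moreover have "1 + cost_expr e s \<le> 1 * unit_cost X" using step_cost[of s e] assms by simp
  moreover have "bounded_state X ?s" using assms by (auto simp: bounded_state_def)
  ultimately show ?thesis unfolding ends_in_def using assms(4) by blast
qed

lemma ends_in_Store:
  assumes "bounded_state X s"
    "small_expr e \<and> small_expr a \<and> expr_size a + expr_size e \<le> 32"
    "eval_expr e s < X"
    and "\<And>s'. s' = s\<lparr>mem := (mem s)(eval_expr a s := eval_expr e s)\<rparr> \<Longrightarrow> bounded_state X s' \<Longrightarrow> Q s' 1"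
  shows "ends_in (Store a e) s Q"
proof -
  let ?s = "s\<lparr>mem := (mem s)(eval_expr a s := eval_expr e s)\<rparr>"
  have "reaches D (Store a e) s (1 + cost_expr a s + cost_expr e s) Skip ?s"
    by (rule reaches_Suc) simp
  moreover have "1 + cost_expr a s + cost_expr e s \<le> 1 * unit_cost X"
    using step_cost2[of s e a] assms by simp
  moreover have "bounded_state X ?s" using assms by (auto simp: bounded_state_def)
  ultimately show ?thesis unfolding ends_in_def using assms(4) by blast
qed

lemma ends_in_Seq:
  assumes "ends_in c s (\<lambda>s' u. ends_in d s' (\<lambda>s'' v. Q s'' (u + v + 1)))"
  shows "ends_in (Seq c d) s Q"
proof -
  from assms obtain s1 t1 u s2 t2 v where
    1: "reaches D c s t1 Skip s1" "t1 \<le> u * unit_cost X" and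
    2: "reaches D d s1 t2 Skip s2" "t2 \<le> v * unit_cost X" "bounded_state X s2" "Q s2 (u + v + 1)"
    unfolding ends_in_def by blast
  have "reaches D (Seq Skip d) s1 1 d s1" by (rule reaches_Suc) simp
  from reaches_trans[OF reaches_Seq[OF 1(1)] reaches_trans[OF this 2(1)]]
  have "reaches D (Seq c d) s (t1 + (1 + t2)) Skip s2" .
  moreover have "t1 + (1 + t2) \<le> (u + v + 1) * unit_cost X"
    using 1 2 unit_cost_pos by (simp add: algebra_simps)
  ultimately show ?thesis using 2 unfolding ends_in_def by blast
qed

lemma ends_in_If:
  assumes "bounded_state X s" "small_expr e \<and> expr_size e \<le> 32"
    and "eval_expr e s \<noteq> 0 \<Longrightarrow> ends_in c1 s (\<lambda>s' u. Q s' (u + 1))"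
    and "eval_expr e s = 0 \<Longrightarrow> ends_in c2 s (\<lambda>s' u. Q s' (u + 1))"
  shows "ends_in (If e c1 c2) s Q"
proof -
  let ?c = "if eval_expr e s \<noteq> 0 then c1 else c2"
  have "ends_in ?c s (\<lambda>s' u. Q s' (u + 1))" using assms by auto
  then obtain s' t u where 1: "reaches D ?c s t Skip s'" "t \<le> u * unit_cost X" "bounded_state X s'"
    "Q s' (u + 1)"
    unfolding ends_in_def by blast
  have "reaches D (If e c1 c2) s (1 + cost_expr e s) ?c s" by (rule reaches_Suc) simp
  from reaches_trans[OF this 1(1)]
  have "reaches D (If e c1 c2) s (1 + cost_expr e s + t) Skip s'" .
  moreover have "1 + cost_expr e s + t \<le> (u + 1) * unit_cost X"
    using 1 step_cost[of s e] assms by (simp add: algebra_simps)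
  ultimately show ?thesis using 1 unfolding ends_in_def by blast
qed

text \<open>The number n of rounds is fixed in advance, so the index of the invariant also proves
  termination. A round costs u plus three units, for the unrolling, the test and the removal of the
  \<open>Skip\<close> left by the body; the last unrolling and test give the 2.\<close>

lemma ends_in_While:
  assumes e: "small_expr e \<and> expr_size e \<le> 32"
    and init: "bounded_state X s" "I 0 s"
    and cont: "\<And>j s. j < n \<Longrightarrow> I j s \<Longrightarrow> eval_expr e s \<noteq> 0"
    and stop: "\<And>s. I n s \<Longrightarrow> eval_expr e s = 0"
    and body: "\<And>j s. j < n \<Longrightarrow> bounded_state X s \<Longrightarrow> I j s \<Longrightarrow> ends_in c s (\<lambda>s' v. I (Suc j) s' \<and> v \<le> u)"
    and post: "\<And>s v. bounded_state X s \<Longrightarrow> I n s \<Longrightarrow> v \<le> n * (u + 3) + 2 \<Longrightarrow> Q s v"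
  shows "ends_in (While e c) s Q"
proof -
  let ?U = "unit_cost X"
  have unroll: "reaches D (While e c) s 1 (If e (Seq c (While e c)) Skip) s" for s
    by (rule reaches_Suc) simp
  have e': "1 + cost_expr e s \<le> ?U" if "bounded_state X s" for s
    using step_cost[of s e] that e by blast
  have iter: "\<exists>s' t. reaches D (While e c) s t Skip s' \<and> t \<le> ((n - j) * (u + 3) + 2) * ?U
      \<and> bounded_state X s' \<and> I n s'" if "j \<le> n" "bounded_state X s" "I j s" for j s
    using that
  proof (induction "n - j" arbitrary: j s)
    case 0
    then have "eval_expr e s = 0" using stop by auto
    then have "reaches D (If e (Seq c (While e c)) Skip) s (1 + cost_expr e s) Skip s"
      by (intro reaches_Suc) simp
    from reaches_trans[OF unroll this]
    have "reaches D (While e c) s (1 + (1 + cost_expr e s)) Skip s" .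
    moreover have "1 + (1 + cost_expr e s) \<le> 2 * ?U"
      using e'[OF 0(3)] unit_cost_pos by linarith
    ultimately show ?case using 0 by (intro exI conjI) auto
  next
    case (Suc d)
    then have j: "j < n" by auto
    then have "eval_expr e s \<noteq> 0" using cont Suc by auto
    then have r1: "reaches D (If e (Seq c (While e c)) Skip) s (1 + cost_expr e s) (Seq c (While e c)) s"
      by (intro reaches_Suc) simp
    from body[OF j Suc(4,5)] obtain s1 t1 v where 1: "reaches D c s t1 Skip s1" "t1 \<le> v * ?U" "v \<le> u"
      "bounded_state X s1" "I (Suc j) s1" unfolding ends_in_def by blast
    then have t1: "t1 \<le> u * ?U" by (meson le_trans mult_le_mono1)
    have r2: "reaches D (Seq Skip (While e c)) s1 1 (While e c) s1" by (rule reaches_Suc) simp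
    obtain s2 t2 where 2: "reaches D (While e c) s1 t2 Skip s2"
      "t2 \<le> ((n - Suc j) * (u + 3) + 2) * ?U" "bounded_state X s2" "I n s2"
    proof -
      have "d = n - Suc j" "Suc j \<le> n" using Suc.hyps(2) j by auto
      from Suc.hyps(1)[OF this 1(4,5)] that show thesis by blast
    qed
    have "reaches D (While e c) s (1 + (1 + cost_expr e s + (t1 + (1 + t2)))) Skip s2"
      by (rule reaches_trans[OF unroll reaches_trans[OF r1 reaches_trans[OF reaches_Seq[OF 1(1)]
            reaches_trans[OF r2 2(1)]]]])
    moreover have "1 + (1 + cost_expr e s + (t1 + (1 + t2))) \<le> ((n - j) * (u + 3) + 2) * ?U"
    proof -
      obtain i where i: "n - j = Suc i" "n - Suc j = i" using j by (metis Suc_diff_Suc)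
      have "((n - j) * (u + 3) + 2) * ?U = u * ?U + 3 * ?U + ((n - Suc j) * (u + 3) + 2) * ?U"
        unfolding i by (simp add: algebra_simps)
      then show ?thesis using 2 t1 e'[OF Suc(4)] unit_cost_pos by linarith
    qed
    ultimately show ?case using 2 by blast
  qed
  from iter[of 0 s] init obtain s' t where "reaches D (While e c) s t Skip s'"
    "t \<le> (n * (u + 3) + 2) * ?U" "bounded_state X s'" "I n s'" by auto
  then show ?thesis unfolding ends_in_def using post by blast
qed

lemmas vcg = ends_in_Seq ends_in_Assign ends_in_Store ends_in_If ends_in_Skip

end


section \<open>Hamming balls, windows and buckets\<close>

lemma hamming_eq_sum: "hamming x y = (\<Sum>i<length x. of_bool (x ! i \<noteq> y ! i))"
  by (simp add: hamming_def Int_def)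

lemma hamming_Nil [simp]: "hamming [] y = 0"
  by (simp add: hamming_eq_sum)

lemma hamming_Cons [simp]:
  "hamming (a # x) (b # y) = of_bool (a \<noteq> b) + hamming x y"
  unfolding hamming_eq_sum by (simp add: sum.lessThan_Suc_shift del: sum.lessThan_Suc)

lemma hamming_snoc [simp]:
  "length x = length y \<Longrightarrow> hamming (x @ [a]) (y @ [b]) = hamming x y + of_bool (a \<noteq> b)"
  unfolding hamming_eq_sum by (simp add: nth_append)

lemma hamming_commute: "length x = length y \<Longrightarrow> hamming x y = hamming y x"
  by (simp add: hamming_eq_sum eq_commute)

lemma hamming_le_length: "hamming x y \<le> length x"
  unfolding hamming_def using card_mono[of "{..<length x}" "{i. i < length x \<and> x ! i \<noteq> y ! i}"] by auto

text \<open>Where x and y differ, z follows y while the budget r1 lasts and x afterwards. This gives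
  two words at distance at most 2r a common word in their balls of radius r.\<close>

lemma hamming_midpoint:
  assumes "length x = length y" "hamming x y \<le> r1 + r2"
  shows "\<exists>z. length z = length x \<and> hamming x z \<le> r1 \<and> hamming y z \<le> r2"
  using assms
proof (induction x y arbitrary: r1 r2 rule: list_induct2)
  case (Cons a x b y)
  show ?case
  proof (cases "a = b")
    case True
    then obtain z where "length z = length x" "hamming x z \<le> r1" "hamming y z \<le> r2"
      using Cons.IH[of r1 r2] Cons.prems by auto
    with True show ?thesis by (intro exI[of _ "a # z"]) auto
  next
    case False
    show ?thesis
    proof (cases r1)
      case 0
      then obtain r where r: "r2 = Suc r" using Cons.prems False by (cases r2) auto
      then obtain z where "length z = length x" "hamming x z \<le> r1" "hamming y z \<le> r"
        using Cons.IH[of r1 r] Cons.prems False by auto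
      with r show ?thesis by (intro exI[of _ "a # z"]) auto
    next
      case (Suc r)
      then obtain z where "length z = length x" "hamming x z \<le> r" "hamming y z \<le> r2"
        using Cons.IH[of r r2] Cons.prems False by auto
      with Suc show ?thesis by (intro exI[of _ "b # z"]) auto
    qed
  qed
qed simp


section \<open>Words as numbers, and lists of Hamming balls\<close>

definition key :: "nat \<Rightarrow> bool list \<Rightarrow> nat" where
  "key q z = foldl (\<lambda>q b. 2 * q + of_bool b) q z"

lemma key_Nil [simp]: "key q [] = q"
  and key_snoc [simp]: "key q (z @ [b]) = 2 * key q z + of_bool b"
  by (simp_all add: key_def)

text \<open>The bits of z are appended to the binary expansion of q. Keys of equal length with
  different q thus lie in disjoint blocks, which later separates the positions of the
  window.\<close>

lemma key_bounds: "q * 2 ^ length z \<le> key q z \<and> key q z < (q + 1) * 2 ^ length z"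
proof (induction z rule: rev_induct)
  case (snoc b z)
  then have "key q z + 1 \<le> (q + 1) * 2 ^ length z" by simp
  then have "2 * key q z + 2 \<le> 2 * ((q + 1) * 2 ^ length z)" by simp
  with snoc show ?case by (cases b) auto
qed simp

lemma key_inj: "length z = length z' \<Longrightarrow> key q z = key q z' \<Longrightarrow> z = z'"
proof (induction z arbitrary: z' rule: rev_induct)
  case (snoc b z)
  obtain y c where z': "z' = y @ [c]" using snoc.prems by (cases z' rule: rev_cases) auto
  have eq: "2 * key q z + of_bool b = 2 * key q y + (of_bool c :: nat)" using snoc.prems z' by simp
  then have "(2 * key q z + of_bool b) mod 2 = (2 * key q y + (of_bool c :: nat)) mod 2" by simp
  then have "b = c" by (cases b; cases c) auto
  with eq have "key q z = key q y" by simp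
  with snoc.IH[of y] snoc.prems z' \<open>b = c\<close> show ?case by simp
qed simp

lemma key_inj_base: "length z = length z' \<Longrightarrow> key q z = key q' z' \<Longrightarrow> q = q'"
proof -
  assume "length z = length z'" "key q z = key q' z'"
  then have "q * 2 ^ length z < (q' + 1) * 2 ^ length z" "q' * 2 ^ length z < (q + 1) * 2 ^ length z"
    using key_bounds[of q z] key_bounds[of q' z'] by auto
  then have "q < q' + 1" "q' < q + 1" by (simp_all only: mult_less_cancel2)
  then show "q = q'" by simp
qed

text \<open>The keys of all words within distance \<open>r\<close> of a given word, each with its distance, when the
  given word is read bit by bit.\<close>
definition extend_ball :: "nat \<Rightarrow> bool \<Rightarrow> (nat \<times> nat) list \<Rightarrow> (nat \<times> nat) list" where
  "extend_ball r b xs = map (\<lambda>(q, w). (2 * q + of_bool b, w)) xs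
     @ map (\<lambda>(q, w). (2 * q + (1 - of_bool b), w + 1)) (filter (\<lambda>(q, w). w < r) xs)"

definition ball_list :: "nat \<Rightarrow> nat \<Rightarrow> bool list \<Rightarrow> (nat \<times> nat) list" where
  "ball_list r q bs = foldl (\<lambda>xs b. extend_ball r b xs) [(q, 0)] bs"

lemma ball_list_Nil [simp]: "ball_list r q [] = [(q, 0)]"
  and ball_list_snoc [simp]: "ball_list r q (bs @ [b]) = extend_ball r b (ball_list r q bs)"
  by (simp_all add: ball_list_def)

lemma in_ball_list:
  "(k, w) \<in> set (ball_list r q bs) \<longleftrightarrow>
     (\<exists>z. length z = length bs \<and> k = key q z \<and> w = hamming bs z \<and> w \<le> r)"
proof (induction bs arbitrary: k w rule: rev_induct)
  case (snoc b bs)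
  show ?case (is "?L \<longleftrightarrow> ?R")
  proof
    assume ?L
    then consider k' where "(k', w) \<in> set (ball_list r q bs)" "k = 2 * k' + of_bool b"
      | k' w' where "(k', w') \<in> set (ball_list r q bs)" "w' < r" "w = w' + 1" "k = 2 * k' + (1 - of_bool b)"
      by (auto simp: extend_ball_def)
    then show ?R
    proof cases
      case 1
      then obtain z where "length z = length bs" "k' = key q z" "w = hamming bs z" "w \<le> r"
        using snoc by blast
      with 1 show ?thesis by (intro exI[of _ "z @ [b]"]) simp
    next
      case 2
      then obtain z where "length z = length bs" "k' = key q z" "w' = hamming bs z"
        using snoc by blast
      with 2 show ?thesis by (intro exI[of _ "z @ [\<not> b]"]) (cases b; simp)
    qed
  next
    assume ?R
    then obtain y where y: "length y = length (bs @ [b])" "k = key q y" "w = hamming (bs @ [b]) y" "w \<le> r"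
      by blast
    then obtain z c where z: "y = z @ [c]" by (cases y rule: rev_cases) auto
    show ?L
    proof (cases "c = b")
      case True
      then have "(key q z, w) \<in> set (ball_list r q bs)" using y z snoc by auto
      then show ?thesis using y z True by (force simp: extend_ball_def)
    next
      case False
      then have "(key q z, hamming bs z) \<in> set (ball_list r q bs)" "hamming bs z < r"
        using y z snoc by auto
      moreover have "k = 2 * key q z + (1 - of_bool b)" using y z False by (cases b; cases c) auto
      ultimately show ?thesis using y z False by (force simp: extend_ball_def)
    qed
  qed
qed auto

text \<open>Doubling is injective, and the last bit separates the entries that keep the bit from
  those that flip it. Because of this a vector enters a bucket only once per position of the
  window.\<close>

lemma distinct_ball_list: "distinct (map fst (ball_list r q bs))"
proof (induction bs rule: rev_induct)
  case (snoc b bs)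
  let ?xs = "ball_list r q bs"
  have 1: "distinct (map fst (map (\<lambda>(k, w). (2 * k + c, f w)) ys))"
    if "distinct (map fst ys)" for c :: nat and f :: "nat \<Rightarrow> nat" and ys :: "(nat \<times> nat) list"
  proof -
    have "map fst (map (\<lambda>(k, w). (2 * k + c, f w)) ys) = map (\<lambda>k. 2 * k + c) (map fst ys)"
      by (auto simp: case_prod_beta)
    moreover have "inj (\<lambda>k. 2 * k + c)" by (auto intro: injI)
    ultimately show ?thesis using that by (simp add: distinct_map comp_def inj_on_def)
  qed
  have 2: "distinct (map fst (filter P ?xs))" for P
    using snoc by (rule distinct_map_filter)
  have "set (map fst (map (\<lambda>(k, w). (2 * k + of_bool b, w)) ?xs)) \<inter>
      set (map fst (map (\<lambda>(k, w). (2 * k + (1 - of_bool b), w + 1)) ys)) = {}" for ys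
  proof -
    have "2 * k + of_bool b \<noteq> 2 * k' + (1 - of_bool b)" for k k' :: nat by (cases b; simp; presburger)
    then show ?thesis by (auto simp: case_prod_beta)
  qed
  moreover have "distinct (map fst (map (\<lambda>(k, w). (2 * k + of_bool b, w)) ?xs))"
    by (rule 1[OF snoc, where f = "\<lambda>w. w"])
  moreover have "distinct (map fst (map (\<lambda>(k, w). (2 * k + (1 - of_bool b), w + 1))
      (filter (\<lambda>(q, w). w < r) ?xs)))"
    by (rule 1[OF 2])
  ultimately show ?case
    unfolding ball_list_snoc extend_ball_def map_append distinct_append by blast
qed simp

text \<open>Chernoff's trick: weight every word of distance \<open>w\<close> with \<open>x ^ w\<close>.\<close>
lemma length_ball_list:
  fixes x :: real
  assumes "0 < x" "x \<le> 1"
  shows "length (ball_list r q bs) * x ^ r \<le> (1 + x) ^ length bs"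
proof -
  have "(\<Sum>(k, w)\<leftarrow>ball_list r q bs. x ^ w) \<le> (1 + x) ^ length bs"
  proof (induction bs rule: rev_induct)
    case (snoc b bs)
    have f: "(\<Sum>(k, w)\<leftarrow>filter P ys. x ^ w) \<le> (\<Sum>(k, w)\<leftarrow>ys. x ^ w)" for P and ys :: "(nat \<times> nat) list"
    proof (induction ys)
      case (Cons y ys)
      have "0 \<le> x ^ snd y" using assms by simp
      with Cons show ?case by (auto simp: case_prod_beta)
    qed simp
    have "(\<Sum>(k, w)\<leftarrow>extend_ball r b (ball_list r q bs). x ^ w)
        = (\<Sum>(k, w)\<leftarrow>ball_list r q bs. x ^ w) + x * (\<Sum>(k, w)\<leftarrow>filter (\<lambda>(k, w). w < r) (ball_list r q bs). x ^ w)"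
      by (simp add: extend_ball_def comp_def case_prod_unfold sum_list_const_mult)
    also have "\<dots> \<le> (1 + x) * (\<Sum>(k, w)\<leftarrow>ball_list r q bs. x ^ w)"
      using f[of "\<lambda>(k, w). w < r" "ball_list r q bs"] assms by (simp add: distrib_right)
    also have "\<dots> \<le> (1 + x) * (1 + x) ^ length bs"
      using snoc assms by (intro mult_left_mono) auto
    finally show ?case by simp
  qed simp
  moreover have "length ys * x ^ r \<le> (\<Sum>(k, w)\<leftarrow>ys. x ^ w)"
    if "\<And>k w. (k, w) \<in> set ys \<Longrightarrow> w \<le> r" for ys :: "(nat \<times> nat) list"
    using that
  proof (induction ys)
    case (Cons y ys)
    obtain k w where y: "y = (k, w)" by (cases y)
    have "x ^ r \<le> x ^ w" using Cons.prems[of k w] assms y by (intro power_decreasing) auto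
    moreover have "length ys * x ^ r \<le> (\<Sum>(k, w)\<leftarrow>ys. x ^ w)" using Cons by auto
    ultimately show ?case by (simp add: y distrib_right)
  qed simp
  then have "length (ball_list r q bs) * x ^ r \<le> (\<Sum>(k, w)\<leftarrow>ball_list r q bs. x ^ w)"
    using in_ball_list by blast
  ultimately show ?thesis by linarith
qed

lemma length_ball_list_le: "length (ball_list r q bs) \<le> 2 ^ length bs"
proof -
  have "real (length (ball_list r q bs)) \<le> real (2 ^ length bs)"
    using length_ball_list[of 1 r q bs] by simp
  then show ?thesis by (simp only: of_nat_le_iff)
qed


section \<open>Cyclic windows and the bound on bucket sizes\<close>

definition window :: "nat \<Rightarrow> nat \<Rightarrow> bool list \<Rightarrow> bool list" where
  "window s k x = map (\<lambda>j. x ! ((s + j) mod length x)) [0..<k]"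

lemma length_window [simp]: "length (window s k x) = k"
  by (simp add: window_def)

lemma nth_window [simp]: "j < k \<Longrightarrow> window s k x ! j = x ! ((s + j) mod length x)"
  by (simp add: window_def)

lemma window_Suc: "window s (Suc k) x = window s k x @ [x ! ((s + k) mod length x)]"
  by (simp add: window_def)

lemma sum_shift_mod:
  fixes f :: "nat \<Rightarrow> 'a :: comm_monoid_add"
  shows "(\<Sum>c<m. f ((s + c) mod m)) = (\<Sum>c<m. f c)"
proof (rule sum.reindex_bij_betw)
  have inj: "inj_on (\<lambda>c. (s + c) mod m) {..<m}"
  proof (rule inj_onI)
    fix a b assume ab: "a \<in> {..<m}" "b \<in> {..<m}" "(s + a) mod m = (s + b) mod m"
    define t where "t = s mod m"
    have "t < m" using ab by (auto simp: t_def)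
    moreover have "(t + a) mod m = (t + b) mod m" using ab by (simp add: t_def mod_add_left_eq)
    moreover have "(t + c) mod m = (if t + c < m then t + c else t + c - m)" if "c < m" for c
      using that \<open>t < m\<close> by (simp add: le_mod_geq)
    ultimately show "a = b" using ab by (auto split: if_splits)
  qed
  moreover have "(\<lambda>c. (s + c) mod m) ` {..<m} = {..<m}"
    using inj by (intro endo_inj_surj) auto
  ultimately show "bij_betw (\<lambda>c. (s + c) mod m) {..<m} {..<m}" by (simp add: bij_betw_def)
qed

text \<open>Averaging: for each offset j < k the m shifts see every coordinate once, so the
  distances inside the windows add up to k times the distance of x and y.\<close>

lemma exists_good_shift:
  assumes "length x = m" "length y = m" "0 < m"
  shows "\<exists>s<m. hamming (window s k x) (window s k y) * m \<le> hamming x y * k"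
proof (rule ccontr)
  assume "\<not> ?thesis"
  then have "\<And>s. s < m \<Longrightarrow> hamming x y * k < hamming (window s k x) (window s k y) * m"
    by (meson not_le)
  then have "(\<Sum>s<m. hamming x y * k) < (\<Sum>s<m. hamming (window s k x) (window s k y) * m)"
    using assms by (intro sum_strict_mono) auto
  also have "\<dots> = m * (\<Sum>s<m. hamming (window s k x) (window s k y))"
    by (simp add: sum_distrib_left mult.commute)
  also have "(\<Sum>s<m. hamming (window s k x) (window s k y))
      = (\<Sum>s<m. \<Sum>j<k. of_bool (x ! ((s + j) mod m) \<noteq> y ! ((s + j) mod m)))"
    using assms by (simp add: hamming_eq_sum del: sum_of_bool_eq)
  also have "\<dots> = (\<Sum>j<k. \<Sum>s<m. of_bool (x ! ((j + s) mod m) \<noteq> y ! ((j + s) mod m)))"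
    by (subst sum.swap) (simp add: add.commute del: sum_of_bool_eq)
  also have "\<dots> = (\<Sum>j<k. hamming x y)"
    using assms sum_shift_mod[of "\<lambda>c. of_bool (x ! c \<noteq> y ! c) :: nat"]
    by (simp add: hamming_eq_sum del: sum_of_bool_eq)
  finally show False by (simp add: mult.commute mult.left_commute)
qed

text \<open>A Plotkin-type bound: inside the window the words of \<open>I\<close> are concentrated around \<open>z\<close>, outside of
  it nothing is known about them. There the concave function \<open>a \<mapsto> a (L - a)\<close> of a column sum \<open>a\<close> is
  linearised at \<open>a = L/2\<close>, inside at \<open>a = \<theta> L\<close>.\<close>
lemma bucket_plotkin:
  fixes xs :: "nat \<Rightarrow> bool list" and \<theta> :: real
  assumes I: "finite I" "\<And>i. i \<in> I \<Longrightarrow> length (xs i) = m"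
    and far: "\<And>i j. i \<in> I \<Longrightarrow> j \<in> I \<Longrightarrow> i \<noteq> j \<Longrightarrow> d \<le> hamming (xs i) (xs j)"
    and k: "k \<le> m" "length z = k"
    and near: "\<And>i. i \<in> I \<Longrightarrow> hamming (window s k (xs i)) z \<le> r"
    and \<theta>: "\<theta> \<le> 1 / 2"
  defines "L \<equiv> real (card I)"
  shows "d * (L\<^sup>2 - L) \<le> L\<^sup>2 * ((real m - real k) / 2 + 2 * real r * (1 - 2 * \<theta>) + 2 * real k * \<theta>\<^sup>2)"
proof -
  \<comment> \<open>The columns are numbered from the start of the window, and inside it every bit
    is xored with z. This changes no pairwise distance and makes \<open>y i c\<close> the indicator
    of a deviation from z.\<close>
  define y where "y i c = (of_bool (xs i ! ((s + c) mod m) \<noteq> (c < k \<and> z ! c)) :: real)" for i c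
  define a where "a c = (\<Sum>i\<in>I. y i c)" for c
  have dist: "real (hamming (xs i) (xs j)) = (\<Sum>c<m. y i c + y j c - 2 * (y i c * y j c))"
    if "i \<in> I" "j \<in> I" for i j
  proof -
    have "real (hamming (xs i) (xs j)) = (\<Sum>c<m. of_bool (xs i ! c \<noteq> xs j ! c))"
      using I that by (simp add: hamming_eq_sum)
    also have "\<dots> = (\<Sum>c<m. of_bool (xs i ! ((s + c) mod m) \<noteq> xs j ! ((s + c) mod m)))"
      by (rule sum_shift_mod[symmetric])
    also have "\<dots> = (\<Sum>c<m. y i c + y j c - 2 * (y i c * y j c))"
      by (intro sum.cong refl) (auto simp: y_def)
    finally show ?thesis .
  qed
  have "d * (L\<^sup>2 - L) = (\<Sum>i\<in>I. \<Sum>j\<in>I. if i = j then 0 else real d)"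
  proof -
    have "(\<Sum>j\<in>I. if i = j then 0 else real d) = d * L - d" if "i \<in> I" for i
    proof -
      have "(\<Sum>j\<in>I. if i = j then 0 else real d) = (\<Sum>j\<in>I. real d - (if i = j then real d else 0))"
        by (intro sum.cong) auto
      also have "\<dots> = d * L - d" using that I by (simp add: sum_subtractf L_def)
      finally show ?thesis .
    qed
    then have "(\<Sum>i\<in>I. \<Sum>j\<in>I. if i = j then 0 else real d) = (\<Sum>i\<in>I. d * L - d)"
      by (intro sum.cong) auto
    then show ?thesis by (simp add: L_def power2_eq_square algebra_simps)
  qed
  also have "\<dots> \<le> (\<Sum>i\<in>I. \<Sum>j\<in>I. real (hamming (xs i) (xs j)))"
    using far by (intro sum_mono) auto
  also have "\<dots> = (\<Sum>i\<in>I. \<Sum>j\<in>I. \<Sum>c<m. y i c + y j c - 2 * (y i c * y j c))"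
    using dist by (intro sum.cong refl) auto
  also have "\<dots> = (\<Sum>i\<in>I. \<Sum>c<m. \<Sum>j\<in>I. y i c + y j c - 2 * (y i c * y j c))"
    by (intro sum.cong refl sum.swap)
  also have "\<dots> = (\<Sum>c<m. \<Sum>i\<in>I. \<Sum>j\<in>I. y i c + y j c - 2 * (y i c * y j c))"
    by (rule sum.swap)
  \<comment> \<open>A column with a ones separates 2 a (L - a) ordered pairs.\<close>
  also have "\<dots> = (\<Sum>c<m. 2 * L * a c - 2 * (a c)\<^sup>2)"
  proof (intro sum.cong refl)
    fix c
    have "(\<Sum>j\<in>I. y i c + y j c - 2 * (y i c * y j c)) = L * y i c + a c - 2 * y i c * a c" for i
      by (simp add: a_def L_def sum_subtractf sum.distrib sum_distrib_left mult.assoc)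
    then have "(\<Sum>i\<in>I. \<Sum>j\<in>I. y i c + y j c - 2 * (y i c * y j c))
        = (\<Sum>i\<in>I. L * y i c + a c - 2 * a c * y i c)"
      by (simp add: mult.commute mult.left_commute)
    also have "\<dots> = L * a c + L * a c - 2 * a c * a c"
      by (simp add: L_def sum_subtractf sum.distrib flip: sum_distrib_left a_def)
    finally show "(\<Sum>i\<in>I. \<Sum>j\<in>I. y i c + y j c - 2 * (y i c * y j c)) = 2 * L * a c - 2 * (a c)\<^sup>2"
      by (simp add: power2_eq_square)
  qed
  also have "\<dots> = (\<Sum>c<k. 2 * L * a c - 2 * (a c)\<^sup>2) + (\<Sum>c\<in>{k..<m}. 2 * L * a c - 2 * (a c)\<^sup>2)"
    using k by (simp add: lessThan_atLeast0 sum.atLeastLessThan_concat)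
  also have "\<dots> \<le> (\<Sum>c<k. 2 * L * (1 - 2 * \<theta>) * a c + 2 * L\<^sup>2 * \<theta>\<^sup>2) + (\<Sum>c\<in>{k..<m}. L\<^sup>2 / 2)"
  proof (intro add_mono sum_mono)
    fix c
    have "0 \<le> (a c - \<theta> * L)\<^sup>2" "0 \<le> (a c - L / 2)\<^sup>2" by simp_all
    then show "2 * L * a c - 2 * (a c)\<^sup>2 \<le> 2 * L * (1 - 2 * \<theta>) * a c + 2 * L\<^sup>2 * \<theta>\<^sup>2"
      "2 * L * a c - 2 * (a c)\<^sup>2 \<le> L\<^sup>2 / 2"
      by (simp_all add: power2_eq_square algebra_simps)
  qed
  also have "(\<Sum>c<k. 2 * L * (1 - 2 * \<theta>) * a c + 2 * L\<^sup>2 * \<theta>\<^sup>2)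
      = 2 * L * (1 - 2 * \<theta>) * (\<Sum>c<k. a c) + k * (2 * L\<^sup>2 * \<theta>\<^sup>2)"
    by (simp only: sum.distrib sum_constant card_lessThan sum_distrib_left)
  also have "\<dots> + (\<Sum>c\<in>{k..<m}. L\<^sup>2 / 2)
      = 2 * L * (1 - 2 * \<theta>) * (\<Sum>c<k. a c) + L\<^sup>2 * ((real m - real k) / 2 + 2 * real k * \<theta>\<^sup>2)"
    using k by (simp add: of_nat_diff algebra_simps diff_divide_distrib)
  also have "(\<Sum>c<k. a c) = (\<Sum>i\<in>I. \<Sum>c<k. y i c)" unfolding a_def by (rule sum.swap)
  also have "\<dots> = (\<Sum>i\<in>I. real (hamming (window s k (xs i)) z))"
    using I by (intro sum.cong refl) (simp add: hamming_eq_sum y_def)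
  \<comment> \<open>By \<theta> \<le> 1/2 the slope of the tangent is not negative, so the
    deviations in the window may be replaced by their bound r per word.\<close>
  also have "2 * L * (1 - 2 * \<theta>) * \<dots> \<le> 2 * L * (1 - 2 * \<theta>) * (\<Sum>i\<in>I. real r)"
    using near \<theta> by (intro mult_left_mono sum_mono) (auto simp: L_def)
  finally show ?thesis by (simp add: L_def power2_eq_square algebra_simps)
qed


section \<open>The program\<close>

abbreviation Then (infixr ";;" 60) where "c ;; d \<equiv> Seq c d"

text \<open>The number of rounds is the value of y, so the program always passes m, k or m - d there
  and never n.\<close>

definition mult_into :: "vname \<Rightarrow> vname \<Rightarrow> vname \<Rightarrow> com" where
  "mult_into x y z = Assign x (N 0) ;; Assign ''c'' (V y) ;;
     While (V ''c'') (Assign x (Add (V x) (V z)) ;; Assign ''c'' (Sub (V ''c'') (N 1)))"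

text \<open>Truncated subtraction brings q to 0 even if p does not divide it, so the count rounds
  up.\<close>

definition div_into :: "vname \<Rightarrow> vname \<Rightarrow> vname \<Rightarrow> com" where
  "div_into x q p = Assign x (N 0) ;;
     While (V q) (Assign q (Sub (V q) (V p)) ;; Assign x (Add (V x) (N 1)))"

definition double_times :: "vname \<Rightarrow> vname \<Rightarrow> com" where
  "double_times x y = Assign ''c'' (V y) ;;
     While (V ''c'') (Assign x (Add (V x) (V x)) ;; Assign ''c'' (Sub (V ''c'') (N 1)))"

definition ceil_div :: "nat \<Rightarrow> nat \<Rightarrow> nat" where
  "ceil_div a b = (a + b - 1) div b"

text \<open>The Galois connection for division with rounding up. Applied to the quotient minus one
  it also bounds the rounding error.\<close>

lemma ceil_div_le_iff: "0 < b \<Longrightarrow> ceil_div a b \<le> j \<longleftrightarrow> a \<le> j * b"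
proof -
  assume b: "0 < b"
  have "ceil_div a b \<le> j \<longleftrightarrow> (a + b - 1) div b < Suc j" by (auto simp: ceil_div_def)
  also have "\<dots> \<longleftrightarrow> a + b - 1 < Suc j * b" using b by (rule div_less_iff_less_mult)
  also have "\<dots> \<longleftrightarrow> a \<le> j * b" using b by auto
  finally show ?thesis .
qed

context ram
begin

lemma ends_in_mult_into:
  assumes s: "bounded_state X s" and "x \<noteq> y" "x \<noteq> z" "x \<noteq> ''c''" "y \<noteq> ''c''" "z \<noteq> ''c''"
    and lt: "reg s y * reg s z < X"
    and Q: "\<And>s' u. s' = s\<lparr>reg := (reg s)(x := reg s y * reg s z, ''c'' := 0)\<rparr> \<Longrightarrow> bounded_state X s' \<Longrightarrow>
      u \<le> 6 * reg s y + 6 \<Longrightarrow> Q s' u"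
  shows "ends_in (mult_into x y z) s Q"
proof -
  have b: "reg s v < X" for v using s by (simp add: bounded_state_def)
  define I where "I j s' \<longleftrightarrow> s' = s\<lparr>reg := (reg s)(x := j * reg s z, ''c'' := reg s y - j)\<rparr>" for j s'
  have X0: "0 < X" using X8 by simp
  show ?thesis
    unfolding mult_into_def
  proof (intro vcg s, simp_all del: One_nat_def add: X0 b assms(2-6)[symmetric] assms(2-6), goal_cases)
    case 1
    show ?case
    proof (rule ends_in_While[where I = I and n = "reg s y" and u = 3])
      fix j s' assume j: "j < reg s y" and s': "bounded_state X s'" "I j s'"
      have "Suc j * reg s z \<le> reg s y * reg s z" using j by (intro mult_right_mono) auto
      then have "j * reg s z + reg s z < X" using lt by simp
      then show "ends_in (Assign x (Add (V x) (V z)) ;; Assign ''c'' (Sub (V ''c'') (N 1))) s'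
              (\<lambda>s' v. I (Suc j) s' \<and> v \<le> 3)"
        using s' assms b[of y] by (intro vcg) (auto simp: I_def fun_eq_iff)
    qed (use 1 assms in \<open>auto simp: I_def fun_eq_iff intro!: Q\<close>)
  qed
qed

lemma ends_in_double_times:
  assumes s: "bounded_state X s" and xy: "x \<noteq> y" "x \<noteq> ''c''" "y \<noteq> ''c''"
    and lt: "reg s x * 2 ^ reg s y < X"
    and Q: "\<And>s' u. s' = s\<lparr>reg := (reg s)(x := reg s x * 2 ^ reg s y, ''c'' := 0)\<rparr> \<Longrightarrow> bounded_state X s' \<Longrightarrow>
      u \<le> 6 * reg s y + 4 \<Longrightarrow> Q s' u"
  shows "ends_in (double_times x y) s Q"
proof -
  have b: "reg s v < X" for v using s by (simp add: bounded_state_def)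
  define I where "I j s' \<longleftrightarrow> s' = s\<lparr>reg := (reg s)(x := reg s x * 2 ^ j, ''c'' := reg s y - j)\<rparr>" for j s'
  show ?thesis
    unfolding double_times_def
  proof (intro vcg s, simp_all del: One_nat_def add: b xy[symmetric] xy, goal_cases)
    case 1
    show ?case
    proof (rule ends_in_While[where I = I and n = "reg s y" and u = 3])
      fix j s' assume j: "j < reg s y" and s': "bounded_state X s'" "I j s'"
      have "reg s x * 2 ^ j + reg s x * 2 ^ j = reg s x * 2 ^ Suc j" by simp
      also have "\<dots> \<le> reg s x * 2 ^ reg s y"
        using j by (intro mult_left_mono power_increasing) auto
      finally have "reg s x * 2 ^ j + reg s x * 2 ^ j < X" using lt by linarith
      then show "ends_in (Assign x (Add (V x) (V x)) ;; Assign ''c'' (Sub (V ''c'') (N 1))) s'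
              (\<lambda>s' v. I (Suc j) s' \<and> v \<le> 3)"
        using s' xy b[of y] by (intro vcg) (auto simp: I_def fun_eq_iff)
    qed (use 1 xy in \<open>auto simp: I_def fun_eq_iff intro!: Q\<close>)
  qed
qed

lemma ends_in_div_into:
  assumes s: "bounded_state X s" and xy: "x \<noteq> q" "x \<noteq> p" "q \<noteq> p"
    and p: "0 < reg s p"
    and Q: "\<And>s' u. s' = s\<lparr>reg := (reg s)(x := ceil_div (reg s q) (reg s p), q := 0)\<rparr> \<Longrightarrow> bounded_state X s' \<Longrightarrow>
      u \<le> 6 * ceil_div (reg s q) (reg s p) + 4 \<Longrightarrow> Q s' u"
  shows "ends_in (div_into x q p) s Q"
proof -
  have b: "reg s v < X" for v using s by (simp add: bounded_state_def)
  let ?n = "ceil_div (reg s q) (reg s p)"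
  define I where "I j s' \<longleftrightarrow> s' = s\<lparr>reg := (reg s)(x := j, q := reg s q - j * reg s p)\<rparr>" for j s'
  have X0: "0 < X" using X8 by simp
  have n: "?n \<le> reg s q" using p by (simp add: ceil_div_le_iff)
  show ?thesis
    unfolding div_into_def
  proof (intro vcg s, simp_all del: One_nat_def add: X0 b xy[symmetric] xy, goal_cases)
    case 1
    show ?case
    proof (rule ends_in_While[where I = I and n = ?n and u = 3])
      fix j s' assume "j < ?n" and s': "I j s'"
      then have "j * reg s p < reg s q" using ceil_div_le_iff[OF p, of "reg s q" j] by linarith
      then show "eval_expr (V q) s' \<noteq> 0" using s' xy by (simp add: I_def)
    next
      fix j s' assume j: "j < ?n" and s': "bounded_state X s'" "I j s'"
      have "Suc j < X" using j n b[of q] by linarith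
      moreover have "reg s q - j * reg s p - reg s p < X" using b[of q] by linarith
      ultimately show "ends_in (Assign q (Sub (V q) (V p)) ;; Assign x (Add (V x) (N 1))) s'
              (\<lambda>s' v. I (Suc j) s' \<and> v \<le> 3)"
        using s' xy b by (intro vcg) (auto simp: I_def fun_eq_iff)
    next
      fix s' assume "I ?n s'"
      moreover have "reg s q \<le> ?n * reg s p" using ceil_div_le_iff[OF p, of "reg s q" ?n] by simp
      ultimately show "eval_expr (V q) s' = 0" using xy by (simp add: I_def)
    qed (use 1 xy ceil_div_le_iff[OF p, of "reg s q" ?n] in \<open>auto simp: I_def fun_eq_iff intro!: Q\<close>)
  qed
qed

end


section \<open>The search through the buckets\<close>

definition distance_loop :: com where
  "distance_loop = While (Sub (V ''m'') (V ''q''))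
     (Assign ''e'' (Add (V ''e'')
        (Add (Sub (Load (Add (V ''ip'') (V ''q''))) (Load (Add (V ''jp'') (V ''q''))))
             (Sub (Load (Add (V ''jp'') (V ''q''))) (Load (Add (V ''ip'') (V ''q'')))))) ;;
      Assign ''q'' (Add (V ''q'') (N 1)))"

text \<open>Bucket entries are indices plus one because 0 marks the end of a bucket. A vanishing
  truncated difference means distance at most \<open>dmin\<close>, which only the closest pair
  attains. The earlier vector j has the smaller index and therefore goes to the first output
  register.\<close>

definition compare_pair :: com where
  "compare_pair =
     Assign ''j'' (Sub (Load (V ''ad'')) (N 1)) ;;
     mult_into ''jp'' ''m'' ''j'' ;;
     Assign ''e'' (N 0) ;;
     Assign ''q'' (N 0) ;;
     distance_loop ;;
     If (Sub (V ''e'') (V ''dmin'')) Skip (Assign ''a'' (V ''j'') ;; Assign ''b'' (V ''i''))"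

definition insert_key :: com where
  "insert_key =
     Assign ''ad'' (Load (V ''x'')) ;;
     While (Load (V ''ad'')) (compare_pair ;; Assign ''ad'' (Add (V ''ad'') (V ''h''))) ;;
     Store (V ''ad'') (Add (V ''i'') (N 1))"

definition insert_keys :: com where
  "insert_keys =
     Assign ''x'' (V ''M'') ;;
     While (Sub (V ''f'') (V ''x'')) (insert_key ;; Assign ''x'' (Add (V ''x'') (N 2)))"

text \<open>The flipped copy is appended first, since the entry itself is then overwritten. Copies
  land beyond the old end f of the list and are not extended again in the same pass.\<close>

definition extend_entry :: com where
  "extend_entry =
     If (Sub (V ''r'') (Load (Add (V ''x'') (N 1))))
       (Store (V ''g'') (Add (Add (Load (V ''x'')) (Load (V ''x'')))
                             (Sub (N 1) (Load (Add (V ''ip'') (V ''y''))))) ;;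
        Store (Add (V ''g'') (N 1)) (Add (Load (Add (V ''x'') (N 1))) (N 1)) ;;
        Assign ''g'' (Add (V ''g'') (N 2)))
       Skip ;;
     Store (V ''x'') (Add (Add (Load (V ''x'')) (Load (V ''x''))) (Load (Add (V ''ip'') (V ''y'')))) ;;
     Assign ''x'' (Add (V ''x'') (N 2))"

definition extend_list :: com where
  "extend_list =
     Assign ''x'' (V ''M'') ;;
     Assign ''g'' (V ''f'') ;;
     While (Sub (V ''f'') (V ''x'')) extend_entry ;;
     Assign ''f'' (V ''g'')"

text \<open>The initial value M + 2 + s makes the final key an address: it lies in the block of 2^k
  cells that starts at (M + 2 + s) 2^k. This is beyond the input and the list, which ends by M + 2 *
  2^k \<le> W.\<close>

definition build_list :: com where
  "build_list =
     Store (V ''M'') (Add (Add (V ''M'') (V ''s'')) (N 2)) ;;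
     Store (Add (V ''M'') (N 1)) (N 0) ;;
     Assign ''f'' (Add (V ''M'') (N 2)) ;;
     Assign ''l'' (N 0) ;;
     Assign ''y'' (V ''s'') ;;
     While (Sub (V ''k'') (V ''l''))
       (extend_list ;;
        Assign ''y'' (Add (V ''y'') (N 1)) ;;
        If (Sub (V ''m'') (V ''y'')) Skip (Assign ''y'' (N 0)) ;;
        Assign ''l'' (Add (V ''l'') (N 1)))"

definition process_point :: com where
  "process_point =
     build_list ;; insert_keys ;;
     Assign ''i'' (Add (V ''i'') (N 1)) ;;
     Assign ''ip'' (Add (V ''ip'') (V ''m''))"

definition process_shift :: com where
  "process_shift =
     Assign ''i'' (N 0) ;;
     Assign ''ip'' (N 0) ;;
     While (Sub (V ''n'') (V ''i'')) process_point ;;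
     Assign ''s'' (Add (V ''s'') (N 1))"

definition search :: com where
  "search = Assign ''s'' (N 0) ;; While (Sub (V ''m'') (V ''s'')) process_shift"

definition frame :: "vname set \<Rightarrow> state \<Rightarrow> state \<Rightarrow> bool" where
  "frame A s s' \<longleftrightarrow> (\<forall>x. x \<notin> A \<longrightarrow> reg s' x = reg s x)"

definition has_found :: "nat \<times> nat \<Rightarrow> state \<Rightarrow> bool" where
  "has_found p s \<longleftrightarrow> (reg s ''a'', reg s ''b'') = p"

text \<open>Memory layout: the input in \<open>[0, M)\<close>, the list of keys in \<open>[M, M + 2 * 2 ^ k)\<close>, and the bucket of
  the key \<open>K \<in> [W, W + h)\<close> in the cells \<open>K + l * h\<close>, filled without gaps and terminated by a zero.\<close>
locale closest_pair_search = ram +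
  fixes n m :: nat and xs :: "bool list list" and p :: "nat \<times> nat" and k r L M W h :: nat
  assumes inst: "closest_pair_instance n m xs p"
    and M: "M = n * m" and W: "W = (M + 2) * 2 ^ k" and h: "h = m * 2 ^ k"
    and k_le: "k \<le> m"
    and X_gt: "W + (L + 1) * h + n + m < X"
begin

definition core :: "state \<Rightarrow> bool" where
  "core s \<longleftrightarrow> reg s ''n'' = n \<and> reg s ''m'' = m \<and> reg s ''dmin'' = d_min xs \<and> reg s ''k'' = k
     \<and> reg s ''r'' = r \<and> reg s ''M'' = M \<and> reg s ''h'' = h"

definition input_ok :: "(nat \<Rightarrow> nat) \<Rightarrow> bool" where
  "input_ok \<mu> \<longleftrightarrow> (\<forall>i<n. \<forall>c<m. \<mu> (i * m + c) = of_bool (xs ! i ! c))"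

lemma length_xs: "i < n \<Longrightarrow> length (xs ! i) = m"
proof -
  assume "i < n"
  then have "xs ! i \<in> set xs" "set xs \<subseteq> cube m"
    using inst by (auto simp: closest_pair_instance_def)
  then show ?thesis by (auto simp: cube_def)
qed

lemma n3: "3 \<le> n" using inst by (simp add: closest_pair_instance_def)

lemma M_le_W: "M \<le> W"
  using mult_le_mono[of M "M + 2" 1 "2 ^ k"] by (simp add: W)

lemma closest_iff:
  assumes "j < i" "i < n"
  shows "hamming (xs ! i) (xs ! j) \<le> d_min xs \<longleftrightarrow> (j, i) = p"
proof -
  have ji: "(j, i) \<in> index_pairs n" using assms by (simp add: index_pairs_def)
  have "index_pairs n \<subseteq> {..<n} \<times> {..<n}" by (auto simp: index_pairs_def)
  then have "finite (index_pairs n)" by (rule finite_subset) simp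
  then have "d_min xs \<le> pair_dist xs (j, i)"
    using inst ji unfolding d_min_def by (intro Min_le) (auto simp: closest_pair_instance_def)
  moreover have "pair_dist xs (j, i) = d_min xs \<longleftrightarrow> (j, i) = p"
    using inst ji by (auto simp: closest_pair_instance_def)
  moreover have "pair_dist xs (j, i) = hamming (xs ! i) (xs ! j)"
    using assms length_xs by (simp add: pair_dist_def hamming_commute)
  ultimately show ?thesis by linarith
qed

lemma ends_in_distance_loop:
  assumes s: "bounded_state X s" "core s" "input_ok (mem s)"
    and i: "reg s ''ip'' = i * m" "i < n" and j: "reg s ''jp'' = j * m" "j < n"
    and 0: "reg s ''e'' = 0" "reg s ''q'' = 0"
    and Q: "\<And>s' u. s' = s\<lparr>reg := (reg s)(''e'' := hamming (xs ! i) (xs ! j), ''q'' := m)\<rparr> \<Longrightarrow>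
      bounded_state X s' \<Longrightarrow> u \<le> 6 * m + 2 \<Longrightarrow> Q s' u"
  shows "ends_in distance_loop s Q"
proof -
  define E where "E t = (\<Sum>c<t. of_bool (xs ! i ! c \<noteq> xs ! j ! c) :: nat)" for t
  define I where "I t s' \<longleftrightarrow> s' = s\<lparr>reg := (reg s)(''e'' := E t, ''q'' := t)\<rparr>" for t s'
  have E_le: "E t \<le> t" for t
    by (induction t) (auto simp: E_def)
  have Em: "E m = hamming (xs ! i) (xs ! j)"
    using i by (simp add: E_def hamming_eq_sum length_xs)
  have E0: "E 0 = 0" by (simp add: E_def)
  show ?thesis
    unfolding distance_loop_def
  proof (rule ends_in_While[where I = I and n = m and u = 3])
    fix t s' assume t: "t < m" and s': "bounded_state X s'" "I t s'"
    have mi: "mem s (i * m + t) = of_bool (xs ! i ! t)" "mem s (j * m + t) = of_bool (xs ! j ! t)"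
      using s t i j by (auto simp: input_ok_def)
    \<comment> \<open>At most one of the two truncated differences is nonzero. Their sum is the
      absolute difference, which for bits indicates a disagreement.\<close>
    have "E (Suc t) = E t + of_bool (xs ! i ! t \<noteq> xs ! j ! t)" by (simp add: E_def)
    then have E: "E t + (of_bool (xs ! i ! t) - of_bool (xs ! j ! t)
        + (of_bool (xs ! j ! t) - of_bool (xs ! i ! t))) = E (Suc t)"
      by auto
    have "E (Suc t) < X" "Suc t < X" using E_le[of "Suc t"] t X_gt by linarith+
    then show "ends_in (Assign ''e'' (Add (V ''e'')
        (Add (Sub (Load (Add (V ''ip'') (V ''q''))) (Load (Add (V ''jp'') (V ''q''))))
             (Sub (Load (Add (V ''jp'') (V ''q''))) (Load (Add (V ''ip'') (V ''q'')))))) ;;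
      Assign ''q'' (Add (V ''q'') (N 1))) s' (\<lambda>s' v. I (Suc t) s' \<and> v \<le> 3)"
      using s' i j mi E by (intro vcg) (auto simp: I_def fun_eq_iff)
  qed (use s 0 in \<open>auto simp: I_def core_def fun_eq_iff Em E0 intro!: Q\<close>)
qed

lemma ends_in_compare_pair:
  assumes s: "bounded_state X s" "core s" "input_ok (mem s)"
    and i: "reg s ''i'' = i" "reg s ''ip'' = i * m" "i < n" and j: "mem s (reg s ''ad'') = Suc j" "j < i"
    and Q: "\<And>s' u. bounded_state X s' \<Longrightarrow> mem s' = mem s \<Longrightarrow>
      frame {''j'', ''jp'', ''c'', ''e'', ''q'', ''a'', ''b''} s s' \<Longrightarrow>
      (has_found p s \<Longrightarrow> has_found p s') \<Longrightarrow> ((j, i) = p \<Longrightarrow> has_found p s') \<Longrightarrow> u \<le> 12 * m + 25 \<Longrightarrow> Q s' u"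
  shows "ends_in compare_pair s Q"
proof -
  have b: "reg s v < X" "mem s a < X" for v a using s by (simp_all add: bounded_state_def)
  have "j * m \<le> n * m" using i j by (intro mult_right_mono) auto
  moreover have "n * m \<le> W" using M_le_W M by simp
  ultimately have "j * m < X" using X_gt by linarith
  then have jm: "m * j < X" by (simp add: mult.commute)
  have jn: "j < n" using i j by simp
  have X0: "0 < X" using X8 by simp
  have regs: "reg s ''m'' = m" "reg s ''dmin'' = d_min xs" using s by (auto simp: core_def)
  have jX: "j < X" "i < X" using b(1)[of "''i''"] i j by auto
  note cl = closest_iff[OF j(2) i(3)]
  show ?thesis
    unfolding compare_pair_def
    apply (rule ends_in_Seq, rule ends_in_Assign)
       apply (simp_all add: s jX j del: One_nat_def)
    apply (rule ends_in_Seq, rule ends_in_mult_into)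
            apply (simp_all add: regs jm del: One_nat_def)
    apply (rule ends_in_Seq, rule ends_in_Assign)
       apply (simp_all add: X0 del: One_nat_def)
    apply (rule ends_in_Seq, rule ends_in_Assign)
       apply (simp_all add: X0 del: One_nat_def)
    apply (rule ends_in_Seq, rule ends_in_distance_loop[where i = i and j = j])
    using s i jn
             apply (simp_all add: core_def mult.commute del: One_nat_def)
    apply (rule ends_in_If)
       apply (simp_all add: del: One_nat_def)
     apply (rule ends_in_Skip)
      apply simp
     apply (rule Q)
          apply (simp_all add: frame_def has_found_def cl[symmetric])
    apply (rule ends_in_Seq, rule ends_in_Assign)
       apply (simp_all add: jX)
    apply (rule ends_in_Assign)
       apply (simp_all add: jX)
    apply (rule Q)
         apply (simp_all add: frame_def has_found_def cl[symmetric])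
    done
qed


lemma ends_in_insert_key:
  assumes s: "bounded_state X s" "core s" "input_ok (mem s)"
    and i: "reg s ''i'' = i" "reg s ''ip'' = i * m" "i < n"
    and K: "mem s (reg s ''x'') = K" "K < W + h"
    and ys: "\<And>l. mem s (K + l * h) = (if l < length ys then Suc (ys ! l) else 0)"
      "set ys \<subseteq> {..<i}" "length ys \<le> L"
    and Q: "\<And>s' u. bounded_state X s' \<Longrightarrow> mem s' = (mem s)(K + length ys * h := Suc i) \<Longrightarrow>
      frame {''j'', ''jp'', ''c'', ''e'', ''q'', ''a'', ''b'', ''ad''} s s' \<Longrightarrow>
      (has_found p s \<Longrightarrow> has_found p s') \<Longrightarrow> (fst p \<in> set ys \<Longrightarrow> snd p = i \<Longrightarrow> has_found p s') \<Longrightarrow>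
      u \<le> L * (12 * m + 31) + 6 \<Longrightarrow> Q s' u"
  shows "ends_in insert_key s Q"
proof -
  have b: "mem s a < X" for a using s by (simp_all add: bounded_state_def)
  define I where "I t s' \<longleftrightarrow> mem s' = mem s \<and> reg s' ''ad'' = K + t * h \<and>
      frame {''j'', ''jp'', ''c'', ''e'', ''q'', ''a'', ''b'', ''ad''} s s' \<and>
      (has_found p s \<longrightarrow> has_found p s') \<and> (\<forall>l<t. (ys ! l, i) = p \<longrightarrow> has_found p s')" for t s'
  \<comment> \<open>The value t = L is included: it is the address of the terminating zero of a full
    bucket.\<close>
  have ad_less: "K + t * h < X" if "t \<le> L" for t
  proof -
    have "t * h \<le> L * h" using that by (intro mult_right_mono) auto
    moreover have "(L + 1) * h = L * h + h" by simp
    ultimately show ?thesis using K X_gt by linarith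
  qed
  have iX: "Suc i < X" using i X_gt by linarith
  show ?thesis
    unfolding insert_key_def
  proof (intro ends_in_Seq ends_in_Assign, goal_cases)
    case (4 s1)
    show ?case
    proof (rule ends_in_While[where I = I and n = "length ys" and u = "12 * m + 28"])
      fix t s' assume "t < length ys" "I t s'"
      then show "eval_expr (Load (V ''ad'')) s' \<noteq> 0" using ys(1)[of t] by (simp add: I_def)
    next
      fix t s' assume t: "t < length ys" and s': "bounded_state X s'" "I t s'"
      have j: "mem s' (reg s' ''ad'') = Suc (ys ! t)" "ys ! t < i"
        using ys(1)[of t] ys(2) t s' nth_mem[OF t] by (auto simp: I_def simp del: nth_mem)
      have "core s'" "input_ok (mem s')" "reg s' ''i'' = i" "reg s' ''ip'' = i * m"
        using s s' i by (auto simp: I_def core_def frame_def)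
      then show "ends_in (compare_pair ;; Assign ''ad'' (Add (V ''ad'') (V ''h''))) s'
          (\<lambda>s' v. I (Suc t) s' \<and> v \<le> 12 * m + 28)"
      proof (intro ends_in_Seq, intro ends_in_compare_pair[OF s'(1) _ _ _ _ i(3) j])
        fix s1 u assume s1: "bounded_state X s1" "mem s1 = mem s'"
          "frame {''j'', ''jp'', ''c'', ''e'', ''q'', ''a'', ''b''} s' s1"
          "has_found p s' \<Longrightarrow> has_found p s1" "(ys ! t, i) = p \<Longrightarrow> has_found p s1" "u \<le> 12 * m + 25"
        have regs: "reg s1 ''ad'' = K + t * h" "reg s1 ''h'' = h"
          using s1(3) s' s by (simp_all add: frame_def I_def core_def)
        have "reg s1 ''ad'' + reg s1 ''h'' < X"
          using ad_less[of "Suc t"] t ys(3) regs by (simp add: algebra_simps)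
        then show "ends_in (Assign ''ad'' (Add (V ''ad'') (V ''h''))) s1
            (\<lambda>s'' v. I (Suc t) s'' \<and> u + v + 1 \<le> 12 * m + 28)"
          using s1 s' regs
          by (intro ends_in_Assign) (auto simp: I_def frame_def less_Suc_eq has_found_def)
      qed
    next
      fix s' v assume s': "bounded_state X s'" "I (length ys) s'"
        and v: "v \<le> length ys * (12 * m + 28 + 3) + 2"
      have i': "reg s' ''i'' = i" using s' i by (simp add: I_def frame_def)
      have "length ys * (12 * m + 28 + 3) \<le> L * (12 * m + 31)"
        using ys(3) by (intro mult_mono) auto
      with v have v: "v \<le> L * (12 * m + 31) + 2" by linarith
      have f: "fst p \<in> set ys \<Longrightarrow> snd p = i \<Longrightarrow> has_found p s'"
        using s'(2) by (auto simp: I_def in_set_conv_nth)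
      show "ends_in (Store (V ''ad'') (Add (V ''i'') (N 1))) s' (\<lambda>s'' va. Q s'' (1 + (v + va + 1) + 1))"
      proof (rule ends_in_Store)
        fix s''
        assume "s'' = s'\<lparr>mem := (mem s')(eval_expr (V ''ad'') s' := eval_expr (Add (V ''i'') (N 1)) s')\<rparr>"
          "bounded_state X s''"
        then show "Q s'' (1 + (v + 1 + 1) + 1)"
          using s' i' f v by (intro Q) (auto simp: I_def frame_def has_found_def)
      qed (use s' i' iX in auto)
    qed (use 4 ys(1)[of "length ys"] K in \<open>auto simp: I_def frame_def has_found_def\<close>)
  qed (use s b in auto)
qed

definition table :: "(nat \<Rightarrow> nat list) \<Rightarrow> (nat \<Rightarrow> nat) \<Rightarrow> bool" where
  "table T \<mu> \<longleftrightarrow> (\<forall>K. W \<le> K \<and> K < W + h \<longrightarrow>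
     (\<forall>l. \<mu> (K + l * h) = (if l < length (T K) then Suc (T K ! l) else 0)))"

text \<open>Bucket heads fill an interval of length h and buckets advance in strides of h, so the
  residue modulo h of the offset from W identifies the bucket.\<close>

lemma slot_unique:
  assumes "W \<le> K" "K < W + h" "W \<le> K'" "K' < W + h" "K + l * h = K' + l' * h"
  shows "K = K' \<and> l = l'"
proof -
  define a where "a = K - W"
  define b where "b = K' - W"
  have ab: "a < h" "b < h" "a + l * h = b + l' * h" using assms by (auto simp: a_def b_def)
  have "(a + l * h) mod h = a" "(b + l' * h) mod h = b" using ab(1,2) by simp_all
  with ab(3) have "a = b" by metis
  moreover from this ab have "l * h = l' * h" by linarith
  ultimately show ?thesis using ab assms by (auto simp: a_def b_def)
qed

lemma table_insert:
  assumes T: "table T \<mu>" and K: "W \<le> K" "K < W + h"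
  shows "table (T(K := T K @ [i])) (\<mu>(K + length (T K) * h := Suc i))"
  unfolding table_def
proof (intro allI impI)
  fix K' l assume K': "W \<le> K' \<and> K' < W + h"
  then have "K' + l * h = K + length (T K) * h \<longleftrightarrow> K' = K \<and> l = length (T K)"
    using slot_unique[of K' K l "length (T K)"] K by auto
  then show "(\<mu>(K + length (T K) * h := Suc i)) (K' + l * h)
      = (if l < length ((T(K := T K @ [i])) K') then Suc ((T(K := T K @ [i])) K' ! l) else 0)"
    using T K' by (auto simp: table_def nth_append less_Suc_eq)
qed

lemma ends_in_insert_keys:
  assumes s: "bounded_state X s" "core s" "input_ok (mem s)"
    and i: "reg s ''i'' = i" "reg s ''ip'' = i * m" "i < n"
    and ks: "\<And>t. t < length ks \<Longrightarrow> mem s (M + 2 * t) = ks ! t" "reg s ''f'' = M + 2 * length ks"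
      "M + 2 * length ks \<le> W" "distinct ks"
    and K: "\<And>K. K \<in> set ks \<Longrightarrow> W \<le> K \<and> K < W + h \<and> set (T K) \<subseteq> {..<i} \<and> length (T K) \<le> L"
    and T: "table T (mem s)"
    and Q: "\<And>s' u. bounded_state X s' \<Longrightarrow> \<forall>a<W. mem s' a = mem s a \<Longrightarrow>
      table (\<lambda>K. if K \<in> set ks then T K @ [i] else T K) (mem s') \<Longrightarrow>
      frame {''j'', ''jp'', ''c'', ''e'', ''q'', ''a'', ''b'', ''ad'', ''x''} s s' \<Longrightarrow>
      (has_found p s \<Longrightarrow> has_found p s') \<Longrightarrow>
      (\<And>K. K \<in> set ks \<Longrightarrow> fst p \<in> set (T K) \<Longrightarrow> snd p = i \<Longrightarrow> has_found p s') \<Longrightarrow>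
      u \<le> length ks * (L * (12 * m + 31) + 11) + 4 \<Longrightarrow> Q s' u"
  shows "ends_in insert_keys s Q"
proof -
  define T' where "T' t K = (if K \<in> set (take t ks) then T K @ [i] else T K)" for t K
  define I where "I t s' \<longleftrightarrow> (\<forall>a<W. mem s' a = mem s a) \<and> reg s' ''x'' = M + 2 * t \<and>
      table (T' t) (mem s') \<and>
      frame {''j'', ''jp'', ''c'', ''e'', ''q'', ''a'', ''b'', ''ad'', ''x''} s s' \<and>
      (has_found p s \<longrightarrow> has_found p s') \<and>
      (\<forall>K \<in> set (take t ks). fst p \<in> set (T K) \<and> snd p = i \<longrightarrow> has_found p s')" for t s'
  have M_less: "M < X" using M_le_W X_gt by linarith
  have input: "input_ok (mem s')" if "\<forall>a<W. mem s' a = mem s a" for s'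
    unfolding input_ok_def
  proof (intro allI impI)
    fix j c assume jc: "j < n" "c < m"
    then have "j * m + c < Suc j * m" by simp
    also have "Suc j * m \<le> n * m" using jc by (intro mult_right_mono) auto
    finally have "j * m + c < W" using M_le_W M by simp
    then show "mem s' (j * m + c) = of_bool (xs ! j ! c)"
      using that s(3) jc by (simp add: input_ok_def)
  qed
  show ?thesis
    unfolding insert_keys_def
  proof (intro ends_in_Seq ends_in_Assign, goal_cases)
    case (4 s1)
    show ?case
    proof (rule ends_in_While[where I = I and n = "length ks" and u = "L * (12 * m + 31) + 8"])
      fix t s' assume t: "t < length ks" and s': "bounded_state X s'" "I t s'"
      have cur: "mem s' (reg s' ''x'') = ks ! t" using ks t s' by (auto simp: I_def)
      have kt: "ks ! t \<in> set ks" using t by simp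
      \<comment> \<open>Since the keys are distinct, this bucket has not yet received i in the
        current pass.\<close>
      have T't: "T' t (ks ! t) = T (ks ! t)"
        using t ks(4) by (auto simp: T'_def in_set_conv_nth nth_eq_iff_index_eq)
      have T'Suc: "T' (Suc t) = (T' t)(ks ! t := T' t (ks ! t) @ [i])"
        using t T't by (auto simp: T'_def take_Suc_conv_app_nth fun_eq_iff)
      have tab: "table (T' t) (mem s')" using s' by (simp add: I_def)
      have chain: "mem s' (ks ! t + l * h) = (if l < length (T (ks ! t)) then Suc (T (ks ! t) ! l) else 0)" for l
        using tab K[OF kt] T't unfolding table_def by auto
      have "core s'" "input_ok (mem s')" "reg s' ''i'' = i" "reg s' ''ip'' = i * m"
        using s s' i input by (auto simp: I_def core_def frame_def)
      then show "ends_in (insert_key ;; Assign ''x'' (Add (V ''x'') (N 2))) s'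
          (\<lambda>s' v. I (Suc t) s' \<and> v \<le> L * (12 * m + 31) + 8)"
      proof (intro ends_in_Seq, intro ends_in_insert_key[OF s'(1) _ _ _ _ i(3) cur _ chain])
        fix s1 u assume s1: "bounded_state X s1"
          "mem s1 = (mem s')(ks ! t + length (T (ks ! t)) * h := Suc i)"
          "frame {''j'', ''jp'', ''c'', ''e'', ''q'', ''a'', ''b'', ''ad''} s' s1"
          "has_found p s' \<Longrightarrow> has_found p s1"
          "fst p \<in> set (T (ks ! t)) \<Longrightarrow> snd p = i \<Longrightarrow> has_found p s1"
          "u \<le> L * (12 * m + 31) + 6"
        have regs: "reg s1 ''x'' = M + 2 * t" using s1(3) s' by (simp add: frame_def I_def)
        have "M + 2 * t + 2 \<le> W" using t ks(3) by linarith
        then have x: "reg s1 ''x'' + 2 < X" using regs X_gt n3 by linarith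
        have "\<forall>a<W. mem s1 a = mem s a" using s1(2) s' K[OF kt] by (auto simp: I_def)
        moreover have "table (T' (Suc t)) (mem s1)"
          unfolding T'Suc s1(2) using table_insert[OF tab, of "ks ! t" i] K[OF kt] T't by simp
        moreover have "\<forall>K \<in> set (take (Suc t) ks). fst p \<in> set (T K) \<and> snd p = i \<longrightarrow> has_found p s1"
          using s1(4,5) s' t by (auto simp: I_def take_Suc_conv_app_nth)
        moreover have "frame {''j'', ''jp'', ''c'', ''e'', ''q'', ''a'', ''b'', ''ad'', ''x''} s s1"
          using s1(3) s' by (simp add: I_def frame_def)
        ultimately show "ends_in (Assign ''x'' (Add (V ''x'') (N 2))) s1
            (\<lambda>s'' v. I (Suc t) s'' \<and> u + v + 1 \<le> L * (12 * m + 31) + 8)"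
          using s1 s' regs x
          by (intro ends_in_Assign) (auto simp: I_def frame_def has_found_def)
      qed (use K[OF kt] in auto)
    next
      fix s' v assume s': "bounded_state X s'" "I (length ks) s'"
        and v: "v \<le> length ks * (L * (12 * m + 31) + 8 + 3) + 2"
      have "length ks * (L * (12 * m + 31) + 8 + 3) = length ks * (L * (12 * m + 31) + 11)"
        by (simp add: algebra_simps)
      with v have v: "1 + v + 1 \<le> length ks * (L * (12 * m + 31) + 11) + 4" by linarith
      have "T' (length ks) = (\<lambda>K. if K \<in> set ks then T K @ [i] else T K)"
        by (simp add: T'_def fun_eq_iff)
      then show "Q s' (1 + v + 1)"
        using s' v by (intro Q) (auto simp: I_def simp del: One_nat_def)
    next
      have "T' 0 = T" by (simp add: T'_def fun_eq_iff)
      then show "I 0 s1" using 4 s T by (auto simp: I_def core_def frame_def has_found_def)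
    qed (use 4 s ks in \<open>auto simp: I_def core_def frame_def\<close>)
  qed (use s M_less in \<open>auto simp: core_def\<close>)
qed


definition holds :: "(nat \<times> nat) list \<Rightarrow> (nat \<Rightarrow> nat) \<Rightarrow> bool" where
  "holds zs \<mu> \<longleftrightarrow> (\<forall>t<length zs. \<mu> (M + 2 * t) = fst (zs ! t) \<and> \<mu> (Suc (M + 2 * t)) = snd (zs ! t))"

lemma holds_update:
  assumes "holds zs \<mu>" "t < length zs"
  shows "holds (zs[t := (v, snd (zs ! t))]) (\<mu>(M + 2 * t := v))"
proof -
  have "M + 2 * t' = M + 2 * t \<longleftrightarrow> t' = t" "Suc (M + 2 * t') \<noteq> M + 2 * t" for t' by presburger+
  then show ?thesis using assms by (auto simp: holds_def nth_list_update)
qed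

lemma holds_append:
  assumes "holds zs \<mu>"
  shows "holds (zs @ [(v, w)]) (\<mu>(M + 2 * length zs := v, Suc (M + 2 * length zs) := w))"
proof -
  have "M + 2 * t' = M + 2 * t \<longleftrightarrow> t' = t" "Suc (M + 2 * t') \<noteq> M + 2 * t" for t t' by presburger+
  then show ?thesis using assms by (auto simp: holds_def nth_append less_Suc_eq)
qed

definition low_high_same :: "state \<Rightarrow> state \<Rightarrow> bool" where
  "low_high_same s s' \<longleftrightarrow> (\<forall>a. a < M \<or> W \<le> a \<longrightarrow> mem s' a = mem s a)"

lemma ends_in_extend_list:
  assumes s: "bounded_state X s" "core s" "holds zs (mem s)" "reg s ''f'' = M + 2 * length zs"
    and bit: "mem s (reg s ''ip'' + reg s ''y'') = of_bool \<beta>" "reg s ''ip'' + reg s ''y'' < M"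
    and len: "M + 2 * length (extend_ball r \<beta> zs) \<le> W"
    and small: "\<And>q w. (q, w) \<in> set zs \<Longrightarrow> 2 * q + 1 < X \<and> w + 1 < X"
    and Q: "\<And>s' u. bounded_state X s' \<Longrightarrow> holds (extend_ball r \<beta> zs) (mem s') \<Longrightarrow> low_high_same s s' \<Longrightarrow>
      frame {''x'', ''g'', ''f''} s s' \<Longrightarrow> reg s' ''f'' = M + 2 * length (extend_ball r \<beta> zs) \<Longrightarrow>
      u \<le> 14 * length zs + 10 \<Longrightarrow> Q s' u"
  shows "ends_in extend_list s Q"
proof -
  \<comment> \<open>The list after t entries: t of them rewritten in place, the rest still old, and
    the flipped copies of the first t at the end.\<close>
  define part where "part t = map (\<lambda>(q, w). (2 * q + of_bool \<beta>, w)) (take t zs) @ drop t zs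
     @ map (\<lambda>(q, w). (2 * q + (1 - of_bool \<beta>), w + 1)) (filter (\<lambda>(q, w). w < r) (take t zs))" for t
  define I where "I t s' \<longleftrightarrow> holds (part t) (mem s') \<and> low_high_same s s' \<and>
      reg s' ''x'' = M + 2 * t \<and> reg s' ''g'' = M + 2 * length (part t) \<and> reg s' ''f'' = reg s ''f'' \<and>
      frame {''x'', ''g''} s s'" for t s'
  have part0: "part 0 = zs" and part_end: "part (length zs) = extend_ball r \<beta> zs"
    by (simp_all add: part_def extend_ball_def)
  have length_part: "t \<le> t' \<Longrightarrow> length (part t) \<le> length (part t')" for t t'
  proof -
    assume "t \<le> t'"
    then obtain j where "t' = t + j" using le_Suc_ex by blast
    then show ?thesis by (simp add: part_def take_add)
  qed
  have x_less: "M + 2 * t + 2 \<le> W" if "t < length zs" for t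
    using that len length_part[of 0 "length zs"] part0 part_end by simp
  have MX: "W < X" using X_gt by linarith
  have start: "M + 2 * length zs < X" using s(1,4) by (metis bounded_state_def)
  show ?thesis
    unfolding extend_list_def
  proof (intro ends_in_Seq ends_in_Assign, goal_cases)
    case (7 s1 s2)
    show ?case
    proof (rule ends_in_While[where I = I and n = "length zs" and u = 11])
      fix t s' assume t: "t < length zs" and s': "bounded_state X s'" "I t s'"
      obtain q w where qw: "zs ! t = (q, w)" by (cases "zs ! t")
      have part_t: "part t ! t = (q, w)" "t < length (part t)"
        using t qw by (auto simp: part_def nth_append)
      have part_Suc: "part (Suc t) = (if w < r then (part t @ [(2 * q + (1 - of_bool \<beta>), w + 1)]) else part t)
           [t := (2 * q + of_bool \<beta>, w)]"
        using t qw
        by (simp add: part_def take_Suc_conv_app_nth list_update_append upd_conv_take_nth_drop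
            flip: Cons_nth_drop_Suc)
      have small': "q + q < X" "Suc (q + q) < X" "Suc w < X"
        using small[of q w] qw t nth_mem[OF t] by auto
      have cur: "mem s' (M + 2 * t) = q" "mem s' (Suc (M + 2 * t)) = w" "mem s' (M + 2 * t + 1) = w"
        using s'(2) part_t by (auto simp: I_def holds_def)
      have regs: "reg s' ''r'' = r" "reg s' ''x'' = M + 2 * t" "reg s' ''g'' = M + 2 * length (part t)"
        "reg s' ''ip'' = reg s ''ip''" "reg s' ''y'' = reg s ''y''"
        using s'(2) s(2) by (auto simp: I_def frame_def core_def)
      have bit': "mem s' (reg s ''ip'' + reg s ''y'') = of_bool \<beta>"
        using bit s'(2) by (auto simp: I_def low_high_same_def)
      have neq: "reg s ''ip'' + reg s ''y'' \<noteq> M + 2 * length (part t)"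
        "reg s ''ip'' + reg s ''y'' \<noteq> Suc (M + 2 * length (part t))"
        "M + 2 * t \<noteq> M + 2 * length (part t)" "M + 2 * t \<noteq> Suc (M + 2 * length (part t))"
        "Suc (M + 2 * t) \<noteq> M + 2 * length (part t)" "Suc (M + 2 * t) \<noteq> Suc (M + 2 * length (part t))"
        using bit(2) part_t(2) by presburger+
      have xX: "M + 2 * t + 2 < X" using x_less[OF t] MX by linarith
      have finish: "ends_in (Store (V ''x'') (Add (Add (Load (V ''x'')) (Load (V ''x''))) (Load (Add (V ''ip'') (V ''y'')))) ;;
          Assign ''x'' (Add (V ''x'') (N 2))) s1 (\<lambda>s'' v. I (Suc t) s'' \<and> v \<le> 3)"
        if s1: "bounded_state X s1" "low_high_same s s1" "frame {''x'', ''g''} s s1" "reg s1 ''f'' = reg s ''f''"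
          "reg s1 ''x'' = M + 2 * t" "holds zs' (mem s1)" "reg s1 ''g'' = M + 2 * length zs'"
          "part (Suc t) = zs'[t := (2 * q + of_bool \<beta>, w)]" "t < length zs'" "zs' ! t = (q, w)" for s1 zs'
      proof -
        have r1: "mem s1 (M + 2 * t) = q" "reg s1 ''ip'' = reg s ''ip''" "reg s1 ''y'' = reg s ''y''"
          using s1 by (auto simp: holds_def frame_def)
        obtain c where c: "c = (of_bool \<beta> :: nat)" by simp
        have b1: "mem s1 (reg s ''ip'' + reg s ''y'') = c"
          using bit s1(2) by (auto simp: low_high_same_def c)
        have lt: "q + q + c < X" using small' by (cases \<beta>) (auto simp: c)
        have h: "holds (part (Suc t)) ((mem s1)(M + 2 * t := q + q + c))"
          using holds_update[OF s1(6,9), of "q + q + c"] s1(8,10) by (simp add: mult_2 c)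
        have x: "M \<le> M + 2 * t" "M + 2 * t < W" using x_less[OF t] by simp_all
        have len_eq: "length (part (Suc t)) = length zs'" using s1(8) by simp
        show ?thesis
          apply (rule ends_in_Seq, rule ends_in_Store)
             apply (simp_all add: s1 r1 b1 lt del: One_nat_def)
          apply (rule ends_in_Assign)
             apply (simp_all add: s1 r1 b1 xX[simplified])
          using s1 h x len_eq by (auto simp: I_def low_high_same_def frame_def)
      qed
      show "ends_in extend_entry s' (\<lambda>s' v. I (Suc t) s' \<and> v \<le> 11)"
      proof (cases "w < r")
        case False
        have fin: "ends_in (Store (V ''x'') (Add (Add (Load (V ''x'')) (Load (V ''x''))) (Load (Add (V ''ip'') (V ''y'')))) ;;
          Assign ''x'' (Add (V ''x'') (N 2))) s' (\<lambda>s'' v. I (Suc t) s'' \<and> v \<le> 3)"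
          by (rule finish[of _ "part t"])
             (use s' part_t part_Suc False regs in \<open>auto simp: I_def\<close>)
        show ?thesis
          unfolding extend_entry_def
          apply (rule ends_in_Seq, rule ends_in_If)
             apply (simp_all add: s' regs cur leI[OF False] del: One_nat_def)
          apply (rule ends_in_Skip)
           apply (rule s')
          apply (rule ends_in_mono[OF fin])
          apply auto
          done
      next
        case True
        have "M + 2 * (length (part t) + 1) \<le> W"
        proof -
          have "length (part t) + 1 = length (part (Suc t))" using part_Suc True by simp
          also have "\<dots> \<le> length (part (length zs))" using t by (intro length_part) auto
          finally show ?thesis using len part_end by simp
        qed
        then have g: "M + 2 * length (part t) + 2 \<le> W" by simp
        then have gX: "M + 2 * length (part t) + 2 < X" using MX by linarith
        obtain c where c: "c = (of_bool \<beta> :: nat)" by simp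
        let ?v = "q + q + (Suc 0 - c)"
        have v: "?v < X" using small' by (cases \<beta>) (auto simp: c)
        define s1 where "s1 = s'\<lparr>
           mem := (mem s')(M + 2 * length (part t) := ?v, Suc (M + 2 * length (part t)) := Suc w),
           reg := (reg s')(''g'' := Suc (Suc (M + 2 * length (part t))))\<rparr>"
        have fin: "ends_in (Store (V ''x'') (Add (Add (Load (V ''x'')) (Load (V ''x''))) (Load (Add (V ''ip'') (V ''y'')))) ;;
          Assign ''x'' (Add (V ''x'') (N 2))) s1 (\<lambda>s'' v. I (Suc t) s'' \<and> v \<le> 3)"
          if "bounded_state X s1"
        proof (rule finish[of _ "part t @ [(?v, Suc w)]"])
          show "holds (part t @ [(?v, Suc w)]) (mem s1)"
            using s' holds_append[of "part t" "mem s'" ?v "Suc w"] by (simp add: s1_def I_def)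
          show "low_high_same s s1" using s' g by (auto simp: s1_def I_def low_high_same_def)
        qed (use that s' part_t part_Suc True regs in \<open>auto simp: I_def s1_def frame_def nth_append mult_2 c\<close>)
        show ?thesis
          unfolding extend_entry_def
          apply (rule ends_in_Seq, rule ends_in_If)
             apply (simp_all add: s' regs cur True[folded not_le] del: One_nat_def)
          apply (rule ends_in_Seq, rule ends_in_Store)
             apply (simp_all add: s' regs cur bit'[folded c] v[folded One_nat_def] del: One_nat_def)
          apply (rule ends_in_Seq, rule ends_in_Store)
             apply (simp_all add: regs cur neq small')
          apply (rule ends_in_Assign)
             apply (simp_all add: regs gX[simplified])
          apply (rule ends_in_mono[OF fin[unfolded s1_def]])
          by (simp_all add: s1_def)
      qed
    next
      fix s' v assume s': "bounded_state X s'" "I (length zs) s'" "v \<le> length zs * (11 + 3) + 2"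
      then have g: "reg s' ''g'' < X" by (simp add: bounded_state_def)
      show "ends_in (Assign ''f'' (V ''g'')) s' (\<lambda>s'' va. Q s'' (1 + (1 + (v + va + 1) + 1) + 1))"
        using s' g by (intro ends_in_Assign Q) (auto simp: I_def part_end frame_def low_high_same_def)
    qed (use 7 s in \<open>auto simp: I_def part0 core_def frame_def low_high_same_def\<close>)
  qed (use s start M_le_W MX in \<open>auto simp: core_def\<close>)
qed

end


text \<open>The assumptions collect the combinatorial facts behind the search and are discharged
  later for the computed parameters. \<open>ball_le\<close> covers all lengths up to k because every
  intermediate list is paid for.\<close>

locale closest_pair_search_correct = closest_pair_search +
  fixes B :: nat
  assumes ball_le: "\<And>q bs. length bs \<le> k \<Longrightarrow> length (ball_list r q bs) \<le> B"
    and bucket_le: "\<And>s K. s < m \<Longrightarrow>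
      card {i. i < n \<and> K \<in> fst ` set (ball_list r (M + 2 + s) (window s k (xs ! i)))} \<le> L"
    and meet: "\<exists>s<m. fst ` set (ball_list r (M + 2 + s) (window s k (xs ! fst p)))
      \<inter> fst ` set (ball_list r (M + 2 + s) (window s k (xs ! snd p))) \<noteq> {}"
begin

section \<open>Correctness and cost of the loops of the search\<close>

definition keys :: "nat \<Rightarrow> nat \<Rightarrow> nat set" where
  "keys s i = fst ` set (ball_list r (M + 2 + s) (window s k (xs ! i)))"

lemma in_keysD: "K \<in> keys s i \<Longrightarrow> \<exists>z. length z = k \<and> K = key (M + 2 + s) z"
  by (auto simp: keys_def in_ball_list)

lemma keys_range:
  assumes "K \<in> keys s i" "s < m"
  shows "W \<le> K \<and> K < W + h"
proof -
  obtain z where z: "length z = k" "K = key (M + 2 + s) z" using in_keysD assms by blast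
  have "(M + 2) * 2 ^ k \<le> (M + 2 + s) * 2 ^ k" by (intro mult_right_mono) auto
  moreover have "(M + 2 + s + 1) * 2 ^ k \<le> (M + 2 + m) * 2 ^ k" using assms by (intro mult_right_mono) auto
  moreover have "(M + 2 + m) * 2 ^ k = W + h" by (simp add: W h algebra_simps)
  moreover have "(M + 2 + s) * 2 ^ k \<le> K" "K < (M + 2 + s + 1) * 2 ^ k"
    using key_bounds[of "M + 2 + s" z] unfolding z(1) z(2)[symmetric] by blast+
  ultimately have "W \<le> K" "K < W + h" unfolding W by linarith+
  then show ?thesis by blast
qed

lemma keys_disjoint:
  assumes "K \<in> keys s i" "K \<in> keys s' i'"
  shows "s = s'"
proof -
  obtain z z' where "length z = k" "length z' = k" "K = key (M + 2 + s) z" "K = key (M + 2 + s') z'"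
    using assms in_keysD by meson
  then have "M + 2 + s = M + 2 + s'" using key_inj_base[of z z'] by metis
  then show ?thesis by simp
qed

lemma ends_in_build_list:
  assumes s: "bounded_state X s" "core s" "input_ok (mem s)"
    and i: "reg s ''ip'' = i * m" "i < n" and sv: "reg s ''s'' = sv" "sv < m"
    and Q: "\<And>s' u. bounded_state X s' \<Longrightarrow>
      holds (ball_list r (M + 2 + sv) (window sv k (xs ! i))) (mem s') \<Longrightarrow> low_high_same s s' \<Longrightarrow>
      frame {''x'', ''g'', ''f'', ''l'', ''y''} s s' \<Longrightarrow>
      reg s' ''f'' = M + 2 * length (ball_list r (M + 2 + sv) (window sv k (xs ! i))) \<Longrightarrow>
      u \<le> k * (14 * B + 24) + 12 \<Longrightarrow> Q s' u"
  shows "ends_in build_list s Q"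
proof -
  let ?b = "\<lambda>l. ball_list r (M + 2 + sv) (window sv l (xs ! i))"
  define I where "I l s' \<longleftrightarrow> holds (?b l) (mem s') \<and> low_high_same s s' \<and>
      reg s' ''f'' = M + 2 * length (?b l) \<and> reg s' ''l'' = l \<and> reg s' ''y'' = (sv + l) mod m \<and>
      frame {''x'', ''g'', ''f'', ''l'', ''y''} s s'" for l s'
  have one: "1 \<le> (2::nat) ^ k" by simp
  have M2: "M + 2 \<le> W" using mult_le_mono[OF order.refl one, of "M + 2"] by (simp add: W)
  have lX: "M + sv + 2 < X" "sv < X" "m < X" "W < X" using M2 sv X_gt by linarith+
  have len: "M + 2 * length (?b l) \<le> W" if "l \<le> k" for l
  proof -
    have "length (?b l) \<le> 2 ^ l" using length_ball_list_le[of r _ "window sv l (xs ! i)"] by simp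
    also have "\<dots> \<le> 2 ^ k" using that by (intro power_increasing) auto
    finally have "2 * length (?b l) \<le> 2 * 2 ^ k" by simp
    moreover have "M \<le> M * 2 ^ k" by simp
    moreover have "W = M * 2 ^ k + 2 * 2 ^ k" by (simp add: W add_mult_distrib)
    ultimately show ?thesis by linarith
  qed
  have extend: "?b (Suc l) = extend_ball r (xs ! i ! ((sv + l) mod m)) (?b l)" for l
    using i by (simp add: window_Suc length_xs)
  show ?thesis
    unfolding build_list_def
  proof (rule ends_in_Seq, rule ends_in_Store, goal_cases)
    case (4 s1)
    then have s1: "bounded_state X s1" "reg s1 = reg s" "mem s1 = (mem s)(M := M + sv + 2)"
      using s sv by (simp_all add: core_def)
    show ?case
    proof (rule ends_in_Seq, rule ends_in_Store, goal_cases)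
      case (4 s2)
      then have s2: "bounded_state X s2" "reg s2 = reg s" "mem s2 = (mem s)(M := M + sv + 2, Suc M := 0)"
        using s s1 by (simp_all add: core_def)
      show ?case
      proof (intro ends_in_Seq ends_in_Assign, goal_cases)
        case (10 s3 s4 s5)
        have "window sv 0 (xs ! i) = []" by (simp add: window_def)
        then have init: "I 0 s5"
          using 10 s s2 sv M2
          by (auto simp: I_def holds_def low_high_same_def frame_def core_def)
        have b5: "bounded_state X s5" using 10 by simp
        have cond: "reg s' ''k'' = k \<and> reg s' ''l'' = l" if "I l s'" for l s'
          using that s(2) by (simp add: I_def core_def frame_def)
        show ?case
        proof (rule ends_in_While[where I = I and n = k and u = "14 * B + 20"])
          fix l s' assume l: "l < k" and s': "bounded_state X s'" "I l s'"
          let ?y = "(sv + l) mod m"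
          have y: "?y < m" using sv by simp
          have "i * m + ?y < Suc i * m" using y by simp
          also have "\<dots> \<le> n * m" using i by (intro mult_right_mono) auto
          finally have iy: "i * m + ?y < M" using M by simp
          have regs: "core s'" "reg s' ''ip'' = i * m" "reg s' ''y'' = ?y" "reg s' ''f'' = M + 2 * length (?b l)"
            "holds (?b l) (mem s')"
            using s' s i by (auto simp: I_def core_def frame_def)
          have bit: "mem s' (reg s' ''ip'' + reg s' ''y'') = of_bool (xs ! i ! ?y)"
            "reg s' ''ip'' + reg s' ''y'' < M"
            using s(3) i y iy s' regs by (auto simp: I_def input_ok_def low_high_same_def)
          have small: "2 * q + 1 < X \<and> w + 1 < X" if qw: "(q, w) \<in> set (?b l)" for q w
          proof -
            obtain z where z: "length z = l" "q = key (M + 2 + sv) z"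
              "w = hamming (window sv l (xs ! i)) z"
              using qw by (auto simp: in_ball_list)
            have "q + 1 \<le> (M + 2 + sv + 1) * 2 ^ l" using key_bounds[of "M + 2 + sv" z] z by simp
            then have "2 * q + 1 < (M + 2 + sv + 1) * 2 ^ Suc l" by simp
            also have "\<dots> \<le> (M + 2 + m) * 2 ^ k"
              using sv l by (intro mult_mono power_increasing) auto
            also have "\<dots> = W + h" by (simp add: W h algebra_simps)
            also have "\<dots> < X" using X_gt by simp
            finally have "2 * q + 1 < X" .
            moreover have "w \<le> l" using hamming_le_length[of "window sv l (xs ! i)" z] z by simp
            ultimately show ?thesis using l k_le lX by simp
          qed
          have lenB: "length (?b l) \<le> B" using ball_le[of "window sv l (xs ! i)"] l by simp
          have mod: "(sv + Suc l) mod m = (if Suc ?y = m then 0 else Suc ?y)"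
            by (simp add: mod_Suc)
          show "ends_in (extend_list ;; Assign ''y'' (Add (V ''y'') (N 1)) ;;
              If (Sub (V ''m'') (V ''y'')) Skip (Assign ''y'' (N 0)) ;;
              Assign ''l'' (Add (V ''l'') (N 1))) s' (\<lambda>s' v. I (Suc l) s' \<and> v \<le> 14 * B + 20)"
          proof (rule ends_in_Seq, rule ends_in_extend_list[OF s'(1) regs(1,5,4) bit _ small])
            show "M + 2 * length (extend_ball r (xs ! i ! ?y) (?b l)) \<le> W"
              using len[of "Suc l"] l extend by simp
          next
            fix s6 u assume s6: "bounded_state X s6" "holds (extend_ball r (xs ! i ! ?y) (?b l)) (mem s6)"
              "low_high_same s' s6" "frame {''x'', ''g'', ''f''} s' s6"
              "reg s6 ''f'' = M + 2 * length (extend_ball r (xs ! i ! ?y) (?b l))" "u \<le> 14 * length (?b l) + 10"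
            have "14 * length (?b l) \<le> 14 * B" using lenB by simp
            with s6(6) have u: "u \<le> 14 * B + 10" by linarith
            have r6: "reg s6 ''y'' = ?y" "reg s6 ''m'' = m" "reg s6 ''l'' = l"
              using s6(4) s' s by (auto simp: frame_def I_def core_def)
            have X6: "Suc ?y < X" "Suc l < X" "0 < X" using y l k_le lX by linarith+
            have final: "I (Suc l) s7" if "mem s7 = mem s6" "frame {''y'', ''l''} s6 s7"
              "reg s7 ''y'' = (if Suc ?y = m then 0 else Suc ?y)" "reg s7 ''l'' = Suc l" for s7
              using that s6 s' extend mod by (auto simp: I_def frame_def low_high_same_def)
            show "ends_in (Assign ''y'' (Add (V ''y'') (N 1)) ;;
               If (Sub (V ''m'') (V ''y'')) Skip (Assign ''y'' (N 0)) ;;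
               Assign ''l'' (Add (V ''l'') (N 1))) s6
               (\<lambda>s'' v. I (Suc l) s'' \<and> u + v + 1 \<le> 14 * B + 20)"
              apply (rule ends_in_Seq, rule ends_in_Assign)
                 apply (simp_all add: s6 r6 X6)
              apply (rule ends_in_Seq, rule ends_in_If)
                 apply (simp_all add: r6)
               apply (rule ends_in_Skip)
                apply simp
               apply (rule ends_in_Assign)
                  apply (simp_all add: r6 X6)
               apply (rule conjI, rule final)
              using y u apply (simp_all add: frame_def r6)
              apply (rule ends_in_Assign)
                 apply (simp_all add: r6 X6)
              apply (rule ends_in_Assign)
                 apply (simp_all add: r6 X6)
              apply (rule final)
                 apply (simp_all add: frame_def r6)
              done
          qed
        next
          fix s' v assume s': "bounded_state X s'" "I k s'" and v: "v \<le> k * (14 * B + 20 + 3) + 2"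
          have "k * (14 * B + 20 + 3) \<le> k * (14 * B + 24)" by simp
          with v have v: "v \<le> k * (14 * B + 24) + 2" by linarith
          then show "Q s' (1 + (1 + (1 + (1 + (1 + v + 1) + 1) + 1) + 1) + 1)"
            using s' by (intro Q) (auto simp: I_def simp del: One_nat_def)
        qed (auto simp: b5 init dest: cond)
      qed (use s s2 sv lX in \<open>auto simp: core_def\<close>)
    qed (use s s1 lX in \<open>auto simp: core_def\<close>)
  qed (use s sv lX in \<open>auto simp: core_def\<close>)
qed


text \<open>The pairs \<open>(s', i')\<close> that precede \<open>(s, i)\<close> lexicographically have been processed.\<close>
definition table_content :: "nat \<Rightarrow> nat \<Rightarrow> (nat \<Rightarrow> nat list) \<Rightarrow> bool" where
  "table_content s i T \<longleftrightarrow> (\<forall>K. distinct (T K) \<and>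
     set (T K) = {i'. i' < n \<and> (\<exists>s'<m. K \<in> keys s' i' \<and> (s' < s \<or> s' = s \<and> i' < i))})"

text \<open>The pair is compared when its larger index enters a common bucket, where the smaller
  index is already present. Hence only the position of \<open>snd p\<close> matters.\<close>

definition meeting_passed :: "nat \<Rightarrow> nat \<Rightarrow> bool" where
  "meeting_passed s i \<longleftrightarrow> (\<exists>s'<m. (s' < s \<or> s' = s \<and> snd p < i) \<and> keys s' (fst p) \<inter> keys s' (snd p) \<noteq> {})"

definition ready :: "nat \<Rightarrow> nat \<Rightarrow> state \<Rightarrow> bool" where
  "ready sv i s \<longleftrightarrow> core s \<and> input_ok (mem s) \<and> reg s ''s'' = sv \<and>
     (\<exists>T. table T (mem s) \<and> table_content sv i T) \<and> (meeting_passed sv i \<longrightarrow> has_found p s)"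

text \<open>The constant 22 is 12 for building the list, 4 for inserting its keys and 6 for the two
  updates with their sequencing.\<close>

definition point_cost :: nat where
  "point_cost = k * (14 * B + 24) + B * (L * (12 * m + 31) + 11) + 22"

lemma p_less: "fst p < snd p" "snd p < n"
  using inst by (auto simp: closest_pair_instance_def index_pairs_def)

text \<open>Different shifts use disjoint keys. A bucket met at one shift contains nothing from
  earlier shifts, although the table is never cleared.\<close>

lemma table_content_current:
  assumes "table_content sv i T" "K \<in> keys sv i0" "sv < m"
  shows "set (T K) = {i'. i' < n \<and> K \<in> keys sv i' \<and> i' < i}"
  using assms keys_disjoint unfolding table_content_def by blast

lemma ends_in_process_point:
  assumes s: "bounded_state X s" "ready sv i s" and i: "reg s ''i'' = i" "reg s ''ip'' = i * m" "i < n"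
    and sv: "sv < m"
    and Q: "\<And>s' u. bounded_state X s' \<Longrightarrow> ready sv (Suc i) s' \<Longrightarrow> reg s' ''i'' = Suc i \<Longrightarrow>
      reg s' ''ip'' = Suc i * m \<Longrightarrow> u \<le> point_cost \<Longrightarrow> Q s' u"
  shows "ends_in process_point s Q"
proof -
  let ?b = "ball_list r (M + 2 + sv) (window sv k (xs ! i))"
  obtain T where T: "table T (mem s)" "table_content sv i T"
    and core: "core s" "input_ok (mem s)" "reg s ''s'' = sv" "meeting_passed sv i \<Longrightarrow> has_found p s"
    using s(2) by (auto simp: ready_def)
  have lenB: "length ?b \<le> B" using ball_le by simp
  have set_keys: "set (map fst ?b) = keys sv i" by (simp add: keys_def)
  have input: "input_ok (mem s')" if "\<forall>a<M. mem s' a = mem s a" for s'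
    unfolding input_ok_def
  proof (intro allI impI)
    fix j c assume jc: "j < n" "c < m"
    then have "j * m + c < Suc j * m" by simp
    also have "Suc j * m \<le> n * m" using jc by (intro mult_right_mono) auto
    finally show "mem s' (j * m + c) = of_bool (xs ! j ! c)"
      using that core(2) jc by (simp add: input_ok_def M)
  qed
  have iX: "Suc i < X" "Suc i * m < X"
  proof -
    have "Suc i * m \<le> n * m" using i by (intro mult_right_mono) auto
    then show "Suc i < X" "Suc i * m < X" using i M_le_W M X_gt by linarith+
  qed
  show ?thesis
    unfolding process_point_def
  proof (rule ends_in_Seq, rule ends_in_build_list[OF s(1) core(1,2) i(2,3) core(3) sv])
    fix s1 u1 assume s1: "bounded_state X s1" "holds ?b (mem s1)" "low_high_same s s1"
      "frame {''x'', ''g'', ''f'', ''l'', ''y''} s s1" "reg s1 ''f'' = M + 2 * length ?b"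
      "u1 \<le> k * (14 * B + 24) + 12"
    have c1: "core s1" "input_ok (mem s1)" "reg s1 ''i'' = i" "reg s1 ''ip'' = i * m"
      using s1 core i input[of s1] by (auto simp: core_def frame_def low_high_same_def)
    have T1: "table T (mem s1)"
      using T(1) s1(3) by (auto simp: table_def low_high_same_def)
    have len: "M + 2 * length (map fst ?b) \<le> W"
    proof -
      have "length ?b \<le> 2 ^ k" using length_ball_list_le[of r _ "window sv k (xs ! i)"] by simp
      moreover have "M \<le> M * 2 ^ k" by simp
      moreover have "W = M * 2 ^ k + 2 * 2 ^ k" by (simp add: W add_mult_distrib)
      ultimately show ?thesis unfolding length_map by linarith
    qed
    have K: "W \<le> K \<and> K < W + h \<and> set (T K) \<subseteq> {..<i} \<and> length (T K) \<le> L"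
      if K: "K \<in> set (map fst ?b)" for K
    proof -
      have "K \<in> keys sv i" using K set_keys by simp
      note cur = table_content_current[OF T(2) this sv]
      have "length (T K) = card (set (T K))"
        using T(2) distinct_card[of "T K"] unfolding table_content_def by metis
      also have "\<dots> \<le> card {i'. i' < n \<and> K \<in> keys sv i'}"
        unfolding cur by (intro card_mono) auto
      also have "\<dots> \<le> L" unfolding keys_def by (rule bucket_le[OF sv])
      finally show ?thesis using cur keys_range[OF \<open>K \<in> keys sv i\<close> sv] by auto
    qed
    show "ends_in (insert_keys ;; Assign ''i'' (Add (V ''i'') (N 1)) ;; Assign ''ip'' (Add (V ''ip'') (V ''m'')))
       s1 (\<lambda>s'' v. Q s'' (u1 + v + 1))"
    proof (rule ends_in_Seq, rule ends_in_insert_keys[OF s1(1) c1 i(3), of "map fst ?b" T])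
      show "mem s1 (M + 2 * t) = map fst ?b ! t" if "t < length (map fst ?b)" for t
        using that s1(2) by (simp add: holds_def)
      show "reg s1 ''f'' = M + 2 * length (map fst ?b)" using s1(5) by simp
    next
      fix s2 u2 assume s2: "bounded_state X s2" "\<forall>a<W. mem s2 a = mem s1 a"
        "table (\<lambda>K. if K \<in> set (map fst ?b) then T K @ [i] else T K) (mem s2)"
        "frame {''j'', ''jp'', ''c'', ''e'', ''q'', ''a'', ''b'', ''ad'', ''x''} s1 s2"
        "has_found p s1 \<Longrightarrow> has_found p s2"
        "\<And>K. K \<in> set (map fst ?b) \<Longrightarrow> fst p \<in> set (T K) \<Longrightarrow> snd p = i \<Longrightarrow> has_found p s2"
        "u2 \<le> length (map fst ?b) * (L * (12 * m + 31) + 11) + 4"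
      let ?T = "\<lambda>K. if K \<in> set (map fst ?b) then T K @ [i] else T K"
      have "table_content sv (Suc i) ?T"
        unfolding table_content_def set_keys
      proof (intro allI conjI)
        fix K
        have TK: "distinct (T K)"
          "set (T K) = {i'. i' < n \<and> (\<exists>s'<m. K \<in> keys s' i' \<and> (s' < sv \<or> s' = sv \<and> i' < i))}"
          using T(2) by (auto simp: table_content_def)
        have "i \<notin> set (T K)" if "K \<in> keys sv i"
          using table_content_current[OF T(2) that sv] by simp
        then show "distinct (if K \<in> keys sv i then T K @ [i] else T K)" using TK by simp
        show "set (if K \<in> keys sv i then T K @ [i] else T K)
          = {i'. i' < n \<and> (\<exists>s'<m. K \<in> keys s' i' \<and> (s' < sv \<or> s' = sv \<and> i' < Suc i))}"
          using TK(2) i(3) sv by (auto simp: less_Suc_eq)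
      qed
      moreover have "has_found p s2" if mp: "meeting_passed sv (Suc i)"
      proof (cases "meeting_passed sv i")
        case True
        then have "has_found p s" by (rule core(4))
        then have "has_found p s1" using s1(4) by (simp add: has_found_def frame_def)
        then show ?thesis by (rule s2(5))
      next
        case False
        then have "snd p = i" "keys sv (fst p) \<inter> keys sv i \<noteq> {}"
          using mp unfolding meeting_passed_def by (auto simp: less_Suc_eq)
        then obtain K where K: "K \<in> keys sv (fst p)" "K \<in> keys sv i" by blast
        have "fst p \<in> set (T K)"
          using table_content_current[OF T(2) K(2) sv] K p_less \<open>snd p = i\<close> by simp
        then show ?thesis using s2(6)[of K] K \<open>snd p = i\<close> set_keys by simp
      qed
      moreover have "input_ok (mem s2)"
        by (rule input) (use s2(2) s1(3) M_le_W in \<open>auto simp: low_high_same_def\<close>)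
      moreover have "core s2" using s2(4) c1 by (simp add: core_def frame_def)
      moreover have r2: "reg s2 ''s'' = sv" "reg s2 ''i'' = i" "reg s2 ''ip'' = i * m" "reg s2 ''m'' = m"
        using s1(4) s2(4) core c1 by (simp_all add: frame_def core_def)
      ultimately have s2': "ready sv (Suc i) s2" using s2(3) unfolding ready_def by blast
      have "length (map fst ?b) * (L * (12 * m + 31) + 11) \<le> B * (L * (12 * m + 31) + 11)"
        using lenB by (intro mult_right_mono) auto
      then have u: "u1 + u2 + 6 \<le> point_cost"
        using s1(6) s2(7) unfolding point_cost_def by linarith
      have fin: "Q s3 v" if "bounded_state X s3" "mem s3 = mem s2" "frame {''i'', ''ip''} s2 s3"
        "reg s3 ''i'' = Suc i" "reg s3 ''ip'' = Suc i * m" "v \<le> u1 + u2 + 6" for s3 v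
      proof (rule Q)
        show "ready sv (Suc i) s3" using s2' that(2,3) by (simp add: ready_def core_def frame_def has_found_def)
        show "v \<le> point_cost" using u that(6) by linarith
      qed (use that in auto)
      show "ends_in (Assign ''i'' (Add (V ''i'') (N 1)) ;; Assign ''ip'' (Add (V ''ip'') (V ''m'')))
          s2 (\<lambda>s'' v. Q s'' (u1 + (u2 + v + 1) + 1))"
        apply (rule ends_in_Seq, rule ends_in_Assign)
           apply (simp_all add: s2 r2 iX)
        apply (rule ends_in_Assign)
           apply (simp_all add: r2 iX[simplified] add.commute)
        apply (rule fin)
             apply (simp_all add: frame_def r2)
        done
    qed (use len T1 K distinct_ball_list in auto)
  qed
qed

lemma ends_in_process_shift:
  assumes s: "bounded_state X s" "ready sv 0 s" and sv: "sv < m"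
    and Q: "\<And>s' u. bounded_state X s' \<Longrightarrow> ready (Suc sv) 0 s' \<Longrightarrow>
      u \<le> n * (point_cost + 3) + 12 \<Longrightarrow> Q s' u"
  shows "ends_in process_shift s Q"
proof -
  define I where "I i s' \<longleftrightarrow> ready sv i s' \<and> reg s' ''i'' = i \<and> reg s' ''ip'' = i * m" for i s'
  have X0: "0 < X" using X8 by simp
  have next_shift: "table_content (Suc sv) 0 T" if "table_content sv n T" for T
    using that sv unfolding table_content_def by (auto simp: less_Suc_eq)
  have next_meeting: "meeting_passed sv n" if "meeting_passed (Suc sv) 0"
    using that p_less unfolding meeting_passed_def by (auto simp: less_Suc_eq)
  show ?thesis
    unfolding process_shift_def
  proof (intro ends_in_Seq ends_in_Assign, goal_cases)
    case (7 s1 s2)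
    have "I 0 s2" using 7 s by (simp add: I_def ready_def core_def has_found_def)
    then show ?case
    proof (intro ends_in_While[where I = I and n = n and u = point_cost])
      fix i s' assume i: "i < n" and s': "bounded_state X s'" "I i s'"
      then show "ends_in process_point s' (\<lambda>s' v. I (Suc i) s' \<and> v \<le> point_cost)"
        by (intro ends_in_process_point[where sv = sv and i = i] sv) (auto simp: I_def)
    next
      fix s' v assume s': "bounded_state X s'" "I n s'" and v: "v \<le> n * (point_cost + 3) + 2"
      obtain T where T: "table T (mem s')" "table_content sv n T" using s' by (auto simp: I_def ready_def)
      have r: "reg s' ''s'' = sv" using s' by (simp add: I_def ready_def)
      have "Suc sv < X" using sv X_gt by linarith
      then show "ends_in (Assign ''s'' (Add (V ''s'') (N 1))) s'
          (\<lambda>s'' va. Q s'' (1 + (1 + (v + va + 1) + 1) + 1))"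
        using s' r v next_shift[OF T(2)] T(1) next_meeting
        by (intro ends_in_Assign Q) (auto simp: I_def ready_def core_def has_found_def)
    qed (use 7 in \<open>auto simp: I_def ready_def core_def\<close>)
  qed (use s X0 in auto)
qed

lemma ends_in_search:
  assumes s: "bounded_state X s" "core s" "input_ok (mem s)" and zero: "\<And>a. M \<le> a \<Longrightarrow> mem s a = 0"
    and Q: "\<And>s' u. bounded_state X s' \<Longrightarrow> has_found p s' \<Longrightarrow>
      u \<le> m * (n * (point_cost + 3) + 15) + 4 \<Longrightarrow> Q s' u"
  shows "ends_in search s Q"
proof -
  have X0: "0 < X" using X8 by simp
  have T0: "table (\<lambda>_. []) (mem s)" using zero M_le_W by (auto simp: table_def)
  have C0: "table_content 0 0 (\<lambda>_. [])" by (simp add: table_content_def)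
  have M0: "\<not> meeting_passed 0 0" by (simp add: meeting_passed_def)
  have M1: "meeting_passed m 0" using meet unfolding meeting_passed_def keys_def by auto
  show ?thesis
    unfolding search_def
  proof (intro ends_in_Seq ends_in_Assign, goal_cases)
    case (4 s1)
    have "ready 0 0 s1" using 4 s T0 C0 M0 by (auto simp: ready_def core_def)
    then show ?case
    proof (intro ends_in_While[where I = "\<lambda>sv. ready sv 0" and n = m and u = "n * (point_cost + 3) + 12"])
      fix sv s' assume "sv < m" "bounded_state X s'" "ready sv 0 s'"
      then show "ends_in process_shift s' (\<lambda>s' v. ready (Suc sv) 0 s' \<and> v \<le> n * (point_cost + 3) + 12)"
        by (intro ends_in_process_shift[where sv = sv]) auto
    next
      fix s' v assume "bounded_state X s'" "ready m 0 s'" "v \<le> m * (n * (point_cost + 3) + 12 + 3) + 2"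
      then show "Q s' (1 + v + 1)" using M1 by (intro Q) (auto simp: ready_def algebra_simps)
    qed (use 4 in \<open>auto simp: ready_def core_def\<close>)
  qed (use s X0 in auto)
qed

end


section \<open>Parameters and running time\<close>

definition set_window_length :: com where
  "set_window_length =
     Assign ''e'' (Sub (V ''m'') (V ''dmin'')) ;;
     mult_into ''pp'' ''e'' ''e'' ;;
     Assign ''f'' (Add (Sub (V ''m'') (Add (V ''d2'') (V ''d2''))) (N 6)) ;;
     mult_into ''g'' ''m'' ''f'' ;;
     mult_into ''q'' ''m'' ''g'' ;;
     div_into ''k'' ''q'' ''pp'' ;;
     If (Sub (V ''k'') (V ''m'')) (Assign ''k'' (V ''m'')) Skip"

definition set_layout :: com where
  "set_layout =
     mult_into ''q'' ''k'' ''dmin'' ;;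
     Assign ''f'' (Add (V ''m'') (V ''m'')) ;;
     div_into ''r'' ''q'' ''f'' ;;
     mult_into ''M'' ''m'' ''n'' ;;
     Assign ''h'' (V ''m'') ;;
     double_times ''h'' ''k''"

definition closest_pair_program :: com where
  "closest_pair_program = set_window_length ;; set_layout ;; search"

lemma oracle_free_closest_pair_program: "oracle_free closest_pair_program"
  by (simp add: closest_pair_program_def set_window_length_def set_layout_def search_def process_shift_def process_point_def
      build_list_def extend_list_def extend_entry_def insert_keys_def insert_key_def compare_pair_def
      distance_loop_def mult_into_def div_into_def double_times_def)

text \<open>With \<open>\<delta> = d/m\<close> and \<open>\<delta>' = d2/m\<close>, the window length is \<open>(1 - 2\<delta>') m/(1 - \<delta>)\<^sup>2\<close> up to an additive
  constant and the radius is half the expected distance of the closest pair inside the window. Then two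
  random words of a bucket are expected to have a distance slightly below \<open>d2\<close>.\<close>
definition window_length :: "nat \<Rightarrow> nat \<Rightarrow> nat \<Rightarrow> nat" where
  "window_length m d d2 = min m (ceil_div (m * (m * (m - 2 * d2 + 6))) ((m - d) * (m - d)))"

definition ball_radius :: "nat \<Rightarrow> nat \<Rightarrow> nat \<Rightarrow> nat" where
  "ball_radius m d k = ceil_div (k * d) (2 * m)"

lemma (in ram) ends_in_set_window_length:
  assumes s: "bounded_state X s"
    and regs: "reg s ''m'' = m" "reg s ''dmin'' = d" "reg s ''d2'' = d2"
    and m: "d < m" and X: "m * (m * (m + 6)) < X"
    and Q: "\<And>s' u. bounded_state X s' \<Longrightarrow> mem s' = mem s \<Longrightarrow> reg s' ''n'' = reg s ''n'' \<Longrightarrow> reg s' ''m'' = m \<Longrightarrow>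
      reg s' ''dmin'' = d \<Longrightarrow> reg s' ''k'' = window_length m d d2 \<Longrightarrow> u \<le> 100 * m ^ 3 \<Longrightarrow> Q s' u"
  shows "ends_in set_window_length s Q"
proof -
  let ?pp = "(m - d) * (m - d)"
  let ?f = "m - (d2 + d2) + 6"
  let ?k = "ceil_div (m * (m * ?f)) ?pp"
  have pp: "0 < ?pp" using m by simp
  have "m * (m * ?f) \<le> m * (m * (m + 6))" by (intro mult_mono) auto
  then have q: "m * (m * ?f) < X" "m * (m * ?f) \<le> m ^ 3 + 6 * m\<^sup>2"
    using X by (auto simp: power3_eq_cube power2_eq_square algebra_simps)
  have m1: "1 \<le> m" using m by simp
  have mf: "m * ?f < X" "?f < X" "?pp < X" "m < X"
  proof -
    have a: "m * ?f \<le> m * (m * ?f)" using m1 by simp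
    have b: "?f \<le> m * ?f" using m1 by simp
    have c: "?pp \<le> m * (m + 6)" by (intro mult_mono) auto
    have d: "m * (m + 6) \<le> m * (m * (m + 6))" using m1 by simp
    have e: "m \<le> m * (m + 6)" using m1 by simp
    show "m * ?f < X" "?f < X" "?pp < X" "m < X"
      using a b c d e q X by linarith+
  qed
  have kq: "?k \<le> m * (m * ?f)"
  proof -
    have "m * (m * ?f) * 1 \<le> m * (m * ?f) * ?pp" using pp by (intro mult_left_mono) auto
    then show ?thesis using pp by (simp add: ceil_div_le_iff)
  qed
  have k': "window_length m d d2 = (if m < ?k then m else ?k)" by (simp add: window_length_def mult_2)
  have "m\<^sup>2 \<le> m ^ 3" "m \<le> m ^ 3" "1 \<le> m ^ 3"
    using m1 power_increasing[of 2 3 m] power_increasing[of 1 3 m] by auto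
  then have cost: "u \<le> 100 * m ^ 3" if "u \<le> 6 * ?k + 18 * m + 38" for u
    using that kq q(2) by linarith
  show ?thesis
    unfolding set_window_length_def
    apply (rule ends_in_Seq, rule ends_in_Assign)
       apply (simp_all add: s regs mf less_imp_diff_less del: One_nat_def)
    apply (rule ends_in_Seq, rule ends_in_mult_into)
            apply (simp_all add: regs mf del: One_nat_def)
    apply (rule ends_in_Seq, rule ends_in_Assign)
       apply (simp_all add: regs mf del: One_nat_def)
    apply (rule ends_in_Seq, rule ends_in_mult_into)
            apply (simp_all add: regs mf del: One_nat_def)
    apply (rule ends_in_Seq, rule ends_in_mult_into)
            apply (simp_all add: regs mf q del: One_nat_def)
    apply (rule ends_in_Seq, rule ends_in_div_into)
         apply (simp_all add: regs mf q m del: One_nat_def)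
    apply (rule ends_in_If)
       apply (simp_all add: regs del: One_nat_def)
     apply (rule ends_in_Assign)
        apply (simp_all add: regs mf del: One_nat_def)
     apply (rule Q)
           apply (simp_all add: regs k')
     apply (rule cost, linarith)
    apply (rule ends_in_Skip)
     apply simp
    apply (rule Q)
          apply (simp_all add: regs k')
    apply (rule cost, linarith)
    done
qed

lemma (in ram) ends_in_set_layout:
  assumes s: "bounded_state X s"
    and regs: "reg s ''n'' = n" "reg s ''m'' = m" "reg s ''dmin'' = d" "reg s ''k'' = k"
    and m: "d < m" "k \<le> m" and X: "m * (m + 6) < X" "n * m < X" "m * 2 ^ m < X"
    and Q: "\<And>s' u. bounded_state X s' \<Longrightarrow> mem s' = mem s \<Longrightarrow> reg s' ''n'' = n \<Longrightarrow> reg s' ''m'' = m \<Longrightarrow>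
      reg s' ''dmin'' = d \<Longrightarrow> reg s' ''k'' = k \<Longrightarrow> reg s' ''r'' = ball_radius m d k \<Longrightarrow> reg s' ''M'' = n * m \<Longrightarrow>
      reg s' ''h'' = m * 2 ^ k \<Longrightarrow> u \<le> 100 * m ^ 3 \<Longrightarrow> Q s' u"
  shows "ends_in set_layout s Q"
proof -
  have m1: "1 \<le> m" using m by simp
  have kd: "k * d \<le> m * m" using m by (intro mult_mono) auto
  have mm: "k * d < X" "m + m < X" "m < X"
    using kd X(1) m1 by (simp_all add: algebra_simps)
  have r: "ball_radius m d k = ceil_div (k * d) (m + m)" by (simp add: ball_radius_def mult_2)
  have rm: "ball_radius m d k \<le> m"
  proof -
    have "k * d \<le> m * (2 * m)" using kd by simp
    then show ?thesis using m1 by (simp add: ball_radius_def ceil_div_le_iff)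
  qed
  have hX: "m * 2 ^ k < X"
  proof -
    have "m * 2 ^ k \<le> m * 2 ^ m" using m by (intro mult_left_mono power_increasing) auto
    then show ?thesis using X by linarith
  qed
  have nm: "m * n < X" using X by (simp add: mult.commute)
  have "m \<le> m ^ 3" "1 \<le> m ^ 3"
    using m1 power_increasing[of 1 3 m] by auto
  then have cost: "u \<le> 100 * m ^ 3" if "u \<le> 6 * ball_radius m d k + 12 * k + 6 * m + 40" for u
    using that rm m by linarith
  show ?thesis
    unfolding set_layout_def
    apply (rule ends_in_Seq, rule ends_in_mult_into)
            apply (simp_all add: s regs mm del: One_nat_def)
    apply (rule ends_in_Seq, rule ends_in_Assign)
       apply (simp_all add: regs mm del: One_nat_def)
    apply (rule ends_in_Seq, rule ends_in_div_into)
         apply (simp_all add: regs m1[unfolded One_nat_def Suc_le_eq] r[symmetric] del: One_nat_def)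
    apply (rule ends_in_Seq, rule ends_in_mult_into)
            apply (simp_all add: regs nm del: One_nat_def)
    apply (rule ends_in_Seq, rule ends_in_Assign)
       apply (simp_all add: regs mm del: One_nat_def)
    apply (rule ends_in_double_times)
         apply (simp_all add: regs hX del: One_nat_def)
    apply (rule Q)
             apply (simp_all add: regs mult.commute[of m n])
    apply (rule cost, linarith)
    done
qed


section \<open>Sizes of balls and buckets for the chosen parameters\<close>

lemma in_keys_ball_list:
  "K \<in> fst ` set (ball_list r q bs) \<longleftrightarrow> (\<exists>z. length z = length bs \<and> K = key q z \<and> hamming bs z \<le> r)"
proof -
  have "K \<in> fst ` set (ball_list r q bs) \<longleftrightarrow> (\<exists>w. (K, w) \<in> set (ball_list r q bs))" by force
  then show ?thesis unfolding in_ball_list by blast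
qed

lemma length_ball_list_0: "length (ball_list 0 q bs) = 1"
  by (induction bs rule: rev_induct) (auto simp: extend_ball_def)

text \<open>Chernoff's bound at x = \<alpha>/(1 - \<alpha>), the optimal weight for radius \<alpha>
  k. Rounding the radius up costs at most one factor 1/x \<le> 1/\<alpha> \<le> 2m, where d \<ge> 1
  is used. For d = 0 the weight would be 0, but the ball is a single point.\<close>

lemma length_ball_list_entropy:
  assumes "0 < m" "d < m" "length bs \<le> k"
  shows "real (length (ball_list (ball_radius m d k) q bs)) \<le> 2 * m * 2 powr (k * H2 (real d / (2 * real m)))"
proof (cases "d = 0")
  case True
  then have "ball_radius m d k = 0" using assms by (simp add: ball_radius_def ceil_div_def)
  moreover have "0 \<le> k * H2 (real d / (2 * real m))" using assms by (intro mult_nonneg_nonneg H2_nonneg) auto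
  then have "1 * 1 \<le> 2 * real m * 2 powr (k * H2 (real d / (2 * real m)))"
    using assms by (intro mult_mono ge_one_powr_ge_zero) auto
  ultimately show ?thesis by (simp add: length_ball_list_0)
next
  case False
  define \<alpha> where "\<alpha> = real d / (2 * real m)"
  define x where "x = \<alpha> / (1 - \<alpha>)"
  define r where "r = ball_radius m d k"
  have \<alpha>: "0 < \<alpha>" "\<alpha> < 1 / 2" "1 / \<alpha> \<le> 2 * m" using assms False by (auto simp: \<alpha>_def field_simps)
  then have x: "0 < x" "x \<le> 1" "1 + x = 1 / (1 - \<alpha>)" by (auto simp: x_def field_simps)
  have "r \<le> k * \<alpha> + 1"
  proof (cases "r = 0")
    case False
    then have "\<not> r \<le> r - 1" by simp
    then have "\<not> k * d \<le> (r - 1) * (2 * m)"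
      unfolding r_def ball_radius_def using assms by (subst ceil_div_le_iff[symmetric]) auto
    then have "(r - 1) * (2 * m) < k * d" by simp
    then have "real (r - 1) * (2 * real m) < real k * real d"
      by (metis of_nat_less_iff of_nat_mult of_nat_numeral)
    then have "real (r - 1) < k * \<alpha>" using assms by (simp add: \<alpha>_def field_simps)
    then show ?thesis using False by simp
  qed (use \<alpha> in simp)
  then have "x powr (k * \<alpha> + 1) \<le> x ^ r"
    using x by (subst powr_realpow[symmetric]) (auto intro!: powr_mono')
  moreover have "length (ball_list r q bs) * x ^ r \<le> (1 + x) ^ length bs"
    by (rule length_ball_list) (use x in auto)
  moreover have "(1 + x) ^ length bs \<le> (1 + x) ^ k" using assms x(1) by (intro power_increasing) auto
  ultimately have "length (ball_list r q bs) * x powr (k * \<alpha> + 1) \<le> (1 + x) ^ k"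
    by (meson mult_left_mono of_nat_0_le_iff order_trans)
  then have "length (ball_list r q bs) \<le> (1 + x) ^ k / x powr (k * \<alpha> + 1)"
    using x by (subst pos_le_divide_eq) auto
  also have "\<dots> = (1 + x) powr k * x powr - (k * \<alpha> + 1)"
    unfolding powr_minus_divide using x \<alpha> by (subst powr_realpow) auto
  also have "\<dots> = 2 powr (k * H2 \<alpha>) * ((1 - \<alpha>) / \<alpha>)"
  proof -
    define l where "l = log 2 (1 - \<alpha>)"
    define l' where "l' = log 2 \<alpha>"
    have l: "1 - \<alpha> = 2 powr l" "\<alpha> = 2 powr l'" using \<alpha> by (simp_all add: l_def l'_def)
    have "1 + x = 2 powr - l" using x(3) l(1) by (simp add: powr_minus_divide)
    moreover have "x = 2 powr (l' - l)" "(1 - \<alpha>) / \<alpha> = 2 powr (l - l')"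
      unfolding x_def powr_diff l[symmetric] by simp_all
    ultimately have "(1 + x) powr k * x powr - (k * \<alpha> + 1) = 2 powr (- l * k + (l' - l) * - (k * \<alpha> + 1))"
      by (simp only: powr_powr powr_add)
    also have "- l * k + (l' - l) * - (k * \<alpha> + 1) = k * H2 \<alpha> + (l - l')"
      by (simp add: H2_def l_def l'_def algebra_simps)
    also have "2 powr \<dots> = 2 powr (k * H2 \<alpha>) * ((1 - \<alpha>) / \<alpha>)"
      unfolding powr_add using \<open>(1 - \<alpha>) / \<alpha> = 2 powr (l - l')\<close> by simp
    finally show ?thesis .
  qed
  also have "\<dots> \<le> 2 powr (k * H2 \<alpha>) * (2 * m)"
  proof (rule mult_left_mono)
    have "(1 - \<alpha>) / \<alpha> \<le> 1 / \<alpha>" using \<alpha> by (intro divide_right_mono) auto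
    then show "(1 - \<alpha>) / \<alpha> \<le> 2 * m" using \<alpha> by simp
  qed auto
  finally show ?thesis by (simp add: r_def \<alpha>_def mult.commute)
qed

context
  fixes n m xs p
  assumes inst: "closest_pair_instance n m xs p"
begin

lemma instance_facts:
  shows "3 \<le> n" "fst p < snd p" "snd p < n" "\<And>i. i < n \<Longrightarrow> length (xs ! i) = m"
    "hamming (xs ! fst p) (xs ! snd p) = d_min xs"
proof -
  show n: "3 \<le> n" and "fst p < snd p" "snd p < n"
    using inst by (auto simp: closest_pair_instance_def index_pairs_def)
  show "length (xs ! i) = m" if "i < n" for i
  proof -
    have "xs ! i \<in> set xs" "set xs \<subseteq> cube m"
      using inst that by (auto simp: closest_pair_instance_def)
    then show ?thesis by (auto simp: cube_def)
  qed
  show "hamming (xs ! fst p) (xs ! snd p) = d_min xs"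
    using inst by (auto simp: closest_pair_instance_def pair_dist_def)
qed

lemma d_second_facts:
  shows "d_min xs < d_second xs" "d_second xs \<le> m"
    "\<And>i j. i < n \<Longrightarrow> j < n \<Longrightarrow> i \<noteq> j \<Longrightarrow> (i, j) \<noteq> p \<Longrightarrow> (j, i) \<noteq> p \<Longrightarrow> d_second xs \<le> hamming (xs ! i) (xs ! j)"
proof -
  have I: "length xs = n" "\<And>q. q \<in> index_pairs n \<Longrightarrow> pair_dist xs q = d_min xs \<longleftrightarrow> q = p"
    using inst by (auto simp: closest_pair_instance_def)
  have "index_pairs n \<subseteq> {..<n} \<times> {..<n}" by (auto simp: index_pairs_def)
  then have fin: "finite (index_pairs n)" by (rule finite_subset) simp
  define S where "S = pair_dist xs ` index_pairs n - {d_min xs}"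
  have finS: "finite S" using fin by (simp add: S_def)
  have d2: "d_second xs = Min S" by (simp add: d_second_def S_def I)
  have in_S: "pair_dist xs q \<in> S" if "q \<in> index_pairs n" "q \<noteq> p" for q
    using that I by (auto simp: S_def)
  have "(0, 1) \<in> index_pairs n" "(0, 2) \<in> index_pairs n"
    using instance_facts(1) by (auto simp: index_pairs_def)
  then have "S \<noteq> {}" using in_S[of "(0, 1)"] in_S[of "(0, 2)"] by (cases "p = (0, 1)") auto
  then have MinS: "Min S \<in> S" using finS by simp
  have d_min_le: "d_min xs \<le> pair_dist xs q" if "q \<in> index_pairs n" for q
    unfolding d_min_def using fin that I by (intro Min_le) auto
  show "d_min xs < d_second xs"
    using MinS d_min_le unfolding d2 S_def by force
  show "d_second xs \<le> m"
  proof -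
    obtain q where "q \<in> index_pairs n" "d_second xs = pair_dist xs q" using MinS unfolding d2 S_def by auto
    then show ?thesis
      using hamming_le_length[of "xs ! fst q" "xs ! snd q"] instance_facts(4)[of "fst q"]
      by (auto simp: pair_dist_def index_pairs_def)
  qed
  have less: "d_second xs \<le> hamming (xs ! i) (xs ! j)" if "i < j" "j < n" "(i, j) \<noteq> p" for i j
    using in_S[of "(i, j)"] that finS unfolding d2 by (auto simp: index_pairs_def pair_dist_def)
  show "d_second xs \<le> hamming (xs ! i) (xs ! j)"
    if "i < n" "j < n" "i \<noteq> j" "(i, j) \<noteq> p" "(j, i) \<noteq> p" for i j
    using less[of i j] less[of j i] that instance_facts(4) by (metis hamming_commute linorder_neqE_nat)
qed

text \<open>Equal vectors are at distance 0 < d2 and must be the closest pair, so without one of its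
  members the words are distinct. The bound keeps addresses below 2^O(m).\<close>

lemma number_of_words: "n \<le> 2 ^ (m + 1)"
proof -
  let ?I = "{..<n} - {fst p}"
  have "inj_on (\<lambda>i. xs ! i) ?I"
  proof (rule inj_onI, rule ccontr)
    fix i j assume ij: "i \<in> ?I" "j \<in> ?I" "xs ! i = xs ! j" "i \<noteq> j"
    then have "d_second xs \<le> hamming (xs ! i) (xs ! j)" by (intro d_second_facts(3)) auto
    then show False using ij d_second_facts(1) by (simp add: hamming_eq_sum)
  qed
  then have "card ?I = card ((\<lambda>i. xs ! i) ` ?I)" by (simp add: card_image)
  also have "\<dots> \<le> card {x :: bool list. set x \<subseteq> UNIV \<and> length x = m}"
    using instance_facts(4) by (intro card_mono finite_lists_length_eq) auto
  also have "\<dots> = 2 ^ m" by (subst card_lists_length_eq) auto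
  finally have "n - 1 \<le> 2 ^ m" using instance_facts by simp
  moreover have "1 \<le> (2::nat) ^ m" "(2::nat) ^ (m + 1) = 2 * 2 ^ m" by simp_all
  ultimately show ?thesis by linarith
qed

text \<open>Without \<open>fst p\<close> all distances are at least d2 and the Plotkin bound
  applies; \<open>fst p\<close> is added back as the + 1. For k < m the average distance is at most
  d2 - 1, hence the size at most d2. If the window is all of m coordinates, the gain is only about
  1/m, and the size can be as large as d2 m.\<close>

lemma bucket_size:
  fixes k r s q :: nat
  defines "k \<equiv> window_length m (d_min xs) (d_second xs)"
  defines "r \<equiv> ball_radius m (d_min xs) k"
  shows "card {i. i < n \<and> K \<in> fst ` set (ball_list r q (window s k (xs ! i)))} \<le> m\<^sup>2 + 1"
proof -
  let ?d = "d_min xs" and ?d2 = "d_second xs"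
  let ?S = "{i. i < n \<and> K \<in> fst ` set (ball_list r q (window s k (xs ! i)))}"
  note d2 = d_second_facts
  have m: "0 < m" "?d < m" using d2 by linarith+
  show ?thesis
  proof (cases "?S = {}")
    case False
    then obtain z where z: "length z = k" "K = key q z"
      by (auto simp: in_ball_list)
    define I where "I = ?S - {fst p}"
    define L where "L = real (card I)"
    have fin: "finite I" by (simp add: I_def)
    have near: "hamming (window s k (xs ! i)) z \<le> r" if "i \<in> I" for i
    proof -
      obtain z' where "length z' = k" "K = key q z'" "hamming (window s k (xs ! i)) z' \<le> r"
        using \<open>i \<in> I\<close> by (auto simp: I_def in_ball_list)
      moreover from this have "z' = z" using z key_inj[of z' z q] by simp
      ultimately show ?thesis by simp
    qed
    have far: "?d2 \<le> hamming (xs ! i) (xs ! j)" if "i \<in> I" "j \<in> I" "i \<noteq> j" for i j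
      using that by (intro d2(3)) (auto simp: I_def)
    have len: "length (xs ! i) = m" if "i \<in> I" for i
      using that instance_facts(4) by (auto simp: I_def)
    have km: "k \<le> m" by (simp add: k_def window_length_def)
    have plotkin: "?d2 * (L\<^sup>2 - L) \<le> L\<^sup>2 * ((real m - real k) / 2 + 2 * real r * (1 - 2 * \<theta>) + 2 * real k * \<theta>\<^sup>2)"
      if "\<theta> \<le> 1 / 2" for \<theta>
      unfolding L_def by (rule bucket_plotkin[OF fin len far km z(1) near that]) auto
    have L: "L \<le> m\<^sup>2"
    proof (cases "k = m")
      case True
      have r2: "r \<le> j \<longleftrightarrow> ?d \<le> 2 * j" for j
        unfolding r_def ball_radius_def True using m
        by (subst ceil_div_le_iff) (auto simp: mult.commute[of _ m] mult.left_commute[of _ m])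
      have "2 * (r - 1) < ?d \<or> r = 0" using r2[of "r - 1"] by linarith
      \<comment> \<open>The radius is d/2 rounded up, so 2r \<le> d + 1 \<le> d2.\<close>
      then have rd: "2 * r \<le> ?d2" "2 * r \<le> m" using d2(1,2) by linarith+
      define \<theta> where "\<theta> = real r / real m"
      have "\<theta> \<le> 1 / 2" using rd m by (simp add: \<theta>_def field_simps)
      from plotkin[OF this] have "?d2 * (L\<^sup>2 - L) \<le> L\<^sup>2 * (2 * r - 2 * r\<^sup>2 / m)"
        using m by (simp add: True \<theta>_def power2_eq_square field_simps)
      also have "\<dots> \<le> L\<^sup>2 * (?d2 - 2 * r\<^sup>2 / m)" using rd by (intro mult_left_mono) auto
      finally have 1: "L\<^sup>2 * (2 * r\<^sup>2 / m) \<le> ?d2 * L" by (simp add: algebra_simps)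
      show ?thesis
      proof (cases "r = 0")
        case True
        then have "?d2 * (L\<^sup>2 - L) \<le> 0" using \<open>?d2 * (L\<^sup>2 - L) \<le> L\<^sup>2 * (2 * r - 2 * r\<^sup>2 / m)\<close> by simp
        then have "L * L \<le> 1 * L" using d2(1) by (simp add: mult_le_0_iff power2_eq_square)
        then have "L \<le> 1" by (cases "L = 0") (auto simp: L_def)
        also have "\<dots> \<le> m\<^sup>2" using m by simp
        finally show ?thesis .
      next
        case False
        \<comment> \<open>For r \<ge> 1 the deficit 2 r^2/m of the average distance is at least 1/m,
          which is where the second factor m of the bound comes from.\<close>
        have "L\<^sup>2 * (1 / m) \<le> L\<^sup>2 * (2 * r\<^sup>2 / m)"
        proof (intro mult_left_mono divide_right_mono)
          have "1 \<le> r\<^sup>2" using False by simp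
          then show "1 \<le> real (2 * r\<^sup>2)" by linarith
        qed auto
        with 1 have "L * L \<le> (?d2 * m) * L" using m by (simp add: power2_eq_square field_simps)
        then have "L \<le> ?d2 * m" by (cases "L = 0") (auto simp: L_def)
        also have "?d2 * m \<le> m * m" using d2(2) by (intro mult_right_mono) auto
        finally show ?thesis by (simp add: power2_eq_square)
      qed
    next
      case False
      then have k: "k = ceil_div (m * (m * (m - 2 * ?d2 + 6))) ((m - ?d) * (m - ?d))"
        by (auto simp: k_def window_length_def min_def split: if_splits)
      have pp: "0 < (m - ?d) * (m - ?d)" using m by simp
      have "m * (m * (m - 2 * ?d2 + 6)) \<le> k * ((m - ?d) * (m - ?d))"
        unfolding ceil_div_le_iff[OF pp, symmetric] using k by simp
      then have "real (m * (m * (m - 2 * ?d2 + 6))) \<le> real (k * ((m - ?d) * (m - ?d)))"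
        by (simp only: of_nat_le_iff)
      moreover have "real m * (real m * (real m - 2 * ?d2 + 6)) \<le> real (m * (m * (m - 2 * ?d2 + 6)))"
        unfolding of_nat_mult by (intro mult_left_mono) auto
      moreover have "real (m - ?d) = real m - ?d" using m by (simp add: of_nat_diff)
      ultimately have "real m * (real m * (real m - 2 * ?d2 + 6)) \<le> k * ((real m - ?d) * (real m - ?d))"
        by simp
      moreover define a where "a = real ?d / real m"
      moreover have "real m - ?d = m * (1 - a)" using m by (simp add: a_def field_simps)
      ultimately have "(real m * real m) * (real m - 2 * ?d2 + 6) \<le> (real m * real m) * (k * (1 - a)\<^sup>2)"
        by (simp add: power2_eq_square mult.commute mult.left_commute)
      \<comment> \<open>The 6 pays for rounding: half of it, 3, covers the loss of at most 2 from
        rounding r up and leaves the gap 1.\<close>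
      then have kk: "real m - 2 * ?d2 + 6 \<le> k * (1 - a)\<^sup>2" using m by simp
      have a: "0 \<le> a" "a \<le> 1" using m by (auto simp: a_def)
      have rk: "real r \<le> k * a / 2 + 1"
      proof (cases "r = 0")
        case False
        then have "\<not> r \<le> r - 1" by simp
        then have "\<not> k * ?d \<le> (r - 1) * (2 * m)"
          unfolding r_def ball_radius_def using m by (subst ceil_div_le_iff[symmetric]) auto
        then have "(r - 1) * (2 * m) < k * ?d" by simp
        then have "real (r - 1) * (2 * real m) < real k * real ?d"
          by (metis of_nat_less_iff of_nat_mult of_nat_numeral)
        then have "real (r - 1) < k * a / 2" using m by (simp add: a_def field_simps)
        then show ?thesis using False by simp
      qed (use a in simp)
      \<comment> \<open>The tangent is taken at the density a/2 of deviations in the window. Then (m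
        - k)/2 + k a (1 - a) + k a^2/2 = m/2 - k (1 - a)^2/2.\<close>
      have "?d2 * (L\<^sup>2 - L) \<le> L\<^sup>2 * ((real m - real k) / 2 + 2 * real r * (1 - a) + 2 * real k * (a / 2)\<^sup>2)"
        using plotkin[of "a / 2"] a by simp
      also have "\<dots> \<le> L\<^sup>2 * (real ?d2 - 1)"
      proof (rule mult_left_mono)
        have "2 * real r * (1 - a) \<le> 2 * (k * a / 2 + 1) * (1 - a)"
          using rk a by (intro mult_right_mono mult_left_mono) auto
        then have "(real m - real k) / 2 + 2 * real r * (1 - a) + 2 * real k * (a / 2)\<^sup>2
            \<le> real m / 2 - k * (1 - a)\<^sup>2 / 2 + 2 * (1 - a)"
          by (simp add: power2_eq_square field_simps)
        also have "\<dots> \<le> real ?d2 - 1" using kk a by (simp add: field_simps)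
        finally show "(real m - real k) / 2 + 2 * real r * (1 - a) + 2 * real k * (a / 2)\<^sup>2 \<le> real ?d2 - 1" .
      qed auto
      finally have "L * L \<le> ?d2 * L" by (simp add: algebra_simps power2_eq_square)
      then have "L \<le> ?d2" by (cases "L = 0") (auto simp: L_def)
      also have "\<dots> \<le> m" using d2(2) by simp
      also have "\<dots> \<le> m\<^sup>2" using m by (simp add: power2_eq_square)
      finally show ?thesis .
    qed
    then have "real (card I) \<le> real (m\<^sup>2)" by (simp add: L_def)
    then have "card I \<le> m\<^sup>2" by (simp only: of_nat_le_iff)
    moreover have "card ?S \<le> card (insert (fst p) I)" by (intro card_mono) (auto simp: I_def)
    moreover have "card (insert (fst p) I) \<le> card I + 1" using card_insert_le_m1 fin by (simp add: card_insert_if)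
    ultimately show ?thesis by linarith
  next
    case True
    then show ?thesis by (simp only: card.empty)
  qed
qed

text \<open>At a good shift the windows of the pair are at distance at most k d/m \<le> 2r, and a
  midpoint supplies the common key.\<close>

lemma pair_meets:
  fixes k r :: nat and q :: "nat \<Rightarrow> nat"
  defines "r \<equiv> ball_radius m (d_min xs) k"
  shows "\<exists>s<m. fst ` set (ball_list r (q s) (window s k (xs ! fst p)))
      \<inter> fst ` set (ball_list r (q s) (window s k (xs ! snd p))) \<noteq> {}"
proof -
  have m: "0 < m" using d_second_facts by linarith
  let ?x = "xs ! fst p" and ?y = "xs ! snd p"
  have len: "length ?x = m" "length ?y = m" using instance_facts by auto
  obtain s where s: "s < m" "hamming (window s k ?x) (window s k ?y) * m \<le> d_min xs * k"
    using exists_good_shift[OF len m] instance_facts(5) by metis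
  have "k * d_min xs \<le> r * (2 * m)"
    using m ceil_div_le_iff[of "2 * m" "k * d_min xs" r] by (simp add: r_def ball_radius_def)
  with s have "hamming (window s k ?x) (window s k ?y) * m \<le> (r + r) * m"
    by (simp add: algebra_simps)
  then have "hamming (window s k ?x) (window s k ?y) \<le> r + r" using m by simp
  then obtain z where "length z = k" "hamming (window s k ?x) z \<le> r" "hamming (window s k ?y) z \<le> r"
    using hamming_midpoint[of "window s k ?x" "window s k ?y" r r] by auto
  then have "key (q s) z \<in> fst ` set (ball_list r (q s) (window s k ?x))
      \<inter> fst ` set (ball_list r (q s) (window s k ?y))"
    unfolding Int_iff in_keys_ball_list by auto
  with s show ?thesis by blast
qed


text \<open>With P = 2^m, n \<le> 2P and m, 2^k \<le> P, all addresses are polynomials of degree at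
  most 4 in P. Crude constants suffice because only the logarithm matters.\<close>

lemma layout_bound:
  fixes k :: nat
  assumes "k \<le> m"
  shows "(n * m + 2) * 2 ^ k + (m\<^sup>2 + 1 + 1) * (m * 2 ^ k) + n + m < 2 ^ (4 * m + 6)"
    "m * (m * (m + 6)) < 2 ^ (4 * m + 6)" "n * m < 2 ^ (4 * m + 6)" "m * 2 ^ m < 2 ^ (4 * m + 6)"
proof -
  define P where "P = (2 :: nat) ^ m"
  have m: "m \<le> P" and P: "1 \<le> P" by (simp_all add: P_def less_imp_le)
  have n: "n \<le> 2 * P" using number_of_words by (simp add: P_def)
  have k: "2 ^ k \<le> P" unfolding P_def using assms by (intro power_increasing) auto
  have pow: "P \<le> P ^ 4" "P\<^sup>2 \<le> P ^ 4" "P ^ 3 \<le> P ^ 4" "1 \<le> P ^ 4"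
    using P power_increasing[of 1 4 P] power_increasing[of 2 4 P] power_increasing[of 3 4 P] by auto
  have X: "2 ^ (4 * m + 6) = 64 * P ^ 4" by (simp add: P_def power_add power_mult mult.commute flip: power_mult)
  have nm: "n * m \<le> 2 * P\<^sup>2" using mult_mono[OF n m] by (simp add: power2_eq_square)
  have "(n * m + 2) * 2 ^ k \<le> (2 * P\<^sup>2 + 2) * P" using nm k by (intro mult_mono) auto
  also have "\<dots> = 2 * P ^ 3 + 2 * P" by (simp add: power2_eq_square power3_eq_cube algebra_simps)
  finally have 1: "(n * m + 2) * 2 ^ k \<le> 4 * P ^ 4" using pow by linarith
  have "m\<^sup>2 + 1 + 1 \<le> 3 * P\<^sup>2"
  proof -
    have "m\<^sup>2 \<le> P\<^sup>2" "1 \<le> P\<^sup>2" using m P by (auto intro: power_mono)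
    then show ?thesis by linarith
  qed
  then have "(m\<^sup>2 + 1 + 1) * (m * 2 ^ k) \<le> (3 * P\<^sup>2) * (P * P)" using m k by (intro mult_mono) auto
  also have "\<dots> = 3 * P ^ 4" by (simp add: power2_eq_square power4_eq_xxxx)
  finally have 2: "(m\<^sup>2 + 1 + 1) * (m * 2 ^ k) \<le> 3 * P ^ 4" .
  show "(n * m + 2) * 2 ^ k + (m\<^sup>2 + 1 + 1) * (m * 2 ^ k) + n + m < 2 ^ (4 * m + 6)"
    unfolding X using 1 2 n m pow by linarith
  have "m * (m * (m + 6)) \<le> P * (P * (7 * P))" using m P by (intro mult_mono) auto
  then show "m * (m * (m + 6)) < 2 ^ (4 * m + 6)"
    unfolding X using pow by (simp add: power3_eq_cube)
  show "n * m < 2 ^ (4 * m + 6)" unfolding X using nm pow by linarith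
  have "m * 2 ^ m \<le> P\<^sup>2" using m by (simp add: P_def power2_eq_square)
  then show "m * 2 ^ m < 2 ^ (4 * m + 6)" unfolding X using pow by linarith
qed

theorem closest_pair_program_correct:
  fixes k :: nat
  defines "k \<equiv> window_length m (d_min xs) (d_second xs)"
  shows "finds_pair_within D closest_pair_program n m xs p
     (436000 * (real n * real m ^ 6 * 2 powr (k * H2 (real (d_min xs) / (2 * real m))))) 1"
proof -
  let ?d = "d_min xs" and ?d2 = "d_second xs"
  define r where "r = ball_radius m ?d k"
  define X where "X = (2 :: nat) ^ (4 * m + 6)"
  define L where "L = m\<^sup>2 + 1"
  define E where "E = 2 * m * 2 powr (k * H2 (real ?d / (2 * real m)))"
  define B where "B = nat \<lfloor>E\<rfloor>"
  have m: "0 < m" "?d < m" and km: "k \<le> m"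
    using d_second_facts by (auto simp: k_def window_length_def)
  have ball: "length (ball_list r q bs) \<le> B" if "length bs \<le> k" for q bs
    using length_ball_list_entropy[OF m that, of q] unfolding B_def r_def E_def
    by (intro le_nat_floor) simp
  note X = layout_bound[OF km, folded X_def]
  interpret closest_pair_search_correct D X n m xs p k r L "n * m" "(n * m + 2) * 2 ^ k" "m * 2 ^ k" B
  proof
    show "8 \<le> X" using power_increasing[of 3 "4 * m + 6" "2 :: nat"] by (simp add: X_def)
    show "closest_pair_instance n m xs p" by (rule inst)
    show "(n * m + 2) * 2 ^ k + (L + 1) * (m * 2 ^ k) + n + m < X" using X(1) by (simp add: L_def)
    show "card {i. i < n \<and> K \<in> fst ` set (ball_list r (n * m + 2 + s) (window s k (xs ! i)))} \<le> L" for s K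
      unfolding L_def r_def k_def by (rule bucket_size)
    show "\<exists>s<m. fst ` set (ball_list r (n * m + 2 + s) (window s k (xs ! fst p)))
        \<inter> fst ` set (ball_list r (n * m + 2 + s) (window s k (xs ! snd p))) \<noteq> {}"
      unfolding r_def by (rule pair_meets)
  qed (use km ball in auto)
  define s0 where "s0 = input_state n m xs"
  have "n + m < X" "d_min xs \<le> m" "d_second xs \<le> m" "1 < X"
    using X_gt m d_second_facts(2) X8 by linarith+
  then have b0: "bounded_state X s0"
    by (auto simp: bounded_state_def s0_def input_state_def)
  have regs: "reg s0 ''n'' = n" "reg s0 ''m'' = m" "reg s0 ''dmin'' = ?d" "reg s0 ''d2'' = ?d2"
    by (simp_all add: s0_def input_state_def)
  have in0: "input_ok (mem s0)"
    unfolding input_ok_def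
  proof (intro allI impI)
    fix i c assume ic: "i < n" "c < m"
    then have "i * m + c < Suc i * m" by simp
    also have "Suc i * m \<le> n * m" using ic by (intro mult_right_mono) auto
    finally show "mem s0 (i * m + c) = of_bool (xs ! i ! c)"
      using ic by (simp add: s0_def input_state_def)
  qed
  have zero0: "mem s0 a = 0" if "n * m \<le> a" for a
    using that by (simp add: s0_def input_state_def)
  have "ends_in closest_pair_program s0
      (\<lambda>s' u. has_found p s' \<and> u \<le> 200 * m ^ 3 + m * (n * (point_cost + 3) + 15) + 6)"
    unfolding closest_pair_program_def
  proof (rule ends_in_Seq, rule ends_in_set_window_length[OF b0 regs(2-4) m(2) X(2)])
    fix s1 u1 assume s1: "bounded_state X s1" "mem s1 = mem s0" "reg s1 ''n'' = reg s0 ''n''" "reg s1 ''m'' = m"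
      "reg s1 ''dmin'' = ?d" "reg s1 ''k'' = window_length m ?d ?d2" "u1 \<le> 100 * m ^ 3"
    have n1: "reg s1 ''n'' = n" and k1: "reg s1 ''k'' = k" using s1 regs by (simp_all add: k_def)
    have "m * (m + 6) \<le> m * (m * (m + 6))" using m by simp
    then have X': "m * (m + 6) < X" using X(2) by linarith
    show "ends_in (set_layout ;; search) s1
       (\<lambda>s'' v. has_found p s'' \<and> u1 + v + 1 \<le> 200 * m ^ 3 + m * (n * (point_cost + 3) + 15) + 6)"
    proof (rule ends_in_Seq, rule ends_in_set_layout[OF s1(1) n1 s1(4,5) k1 m(2) km X' X(3,4)])
      fix s2 u2 assume s2: "bounded_state X s2" "mem s2 = mem s1" "reg s2 ''n'' = n" "reg s2 ''m'' = m"
        "reg s2 ''dmin'' = ?d" "reg s2 ''k'' = k" "reg s2 ''r'' = ball_radius m ?d k" "reg s2 ''M'' = n * m"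
        "reg s2 ''h'' = m * 2 ^ k" "u2 \<le> 100 * m ^ 3"
      have "core s2" using s2(3-6,8,9) s2(7)[folded r_def] by (simp add: core_def)
      then show "ends_in search s2 (\<lambda>s'' v. has_found p s'' \<and>
          u1 + (u2 + v + 1) + 1 \<le> 200 * m ^ 3 + m * (n * (point_cost + 3) + 15) + 6)"
      proof (rule ends_in_search[OF s2(1)])
        show "input_ok (mem s2)" "\<And>a. n * m \<le> a \<Longrightarrow> mem s2 a = 0"
          using s2(2) s1(2) in0 zero0 by simp_all
        fix s3 u3 assume "has_found p s3" "u3 \<le> m * (n * (point_cost + 3) + 15) + 4"
        then show "has_found p s3 \<and>
            u1 + (u2 + u3 + 1) + 1 \<le> 200 * m ^ 3 + m * (n * (point_cost + 3) + 15) + 6"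
          using s1(7) s2(10) by simp
      qed
    qed
  qed
  then obtain s' t u where run: "reaches D closest_pair_program s0 t Skip s'" "t \<le> u * unit_cost X"
    "has_found p s'" "u \<le> 200 * m ^ 3 + m * (n * (point_cost + 3) + 15) + 6"
    unfolding ends_in_def by blast
  have m1: "1 \<le> m" using m by simp
  have B1: "1 \<le> B" using ball[of "[]" 0] by simp
  have mp: "1 \<le> m ^ 3" "m \<le> m ^ 3" "m ^ 3 \<le> m ^ 4" "m \<le> m ^ 4"
    using m1 power_increasing[of 1 3 m] power_increasing[of 3 4 m] power_increasing[of 1 4 m] by auto
  \<comment> \<open>Three factors m come from comparing with at most m^2 + 1 words at O(m) steps
    each. The constant is 38 + 97 + 22 + 3.\<close>
  have "point_cost + 3 \<le> 160 * (m ^ 3 * B)"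
  proof -
    define T where "T = m ^ 3 * B"
    have "1 * 1 \<le> T" unfolding T_def using mp(1) B1 by (rule mult_le_mono)
    moreover have "k * (14 * B + 24) \<le> m ^ 3 * (38 * B)" using B1 km mp by (intro mult_mono) auto
    then have "k * (14 * B + 24) \<le> 38 * T" by (simp add: T_def)
    moreover have "L * (12 * m + 31) \<le> (2 * m\<^sup>2) * (43 * m)"
      using m1 by (intro mult_mono) (auto simp: L_def)
    moreover have "(2 * m\<^sup>2) * (43 * m) = 86 * m ^ 3" by (simp add: power2_eq_square power3_eq_cube)
    ultimately have "L * (12 * m + 31) + 11 \<le> 97 * m ^ 3"
      using mp(1) by linarith
    then have "B * (L * (12 * m + 31) + 11) \<le> B * (97 * m ^ 3)" by (rule mult_left_mono) simp
    then have "B * (L * (12 * m + 31) + 11) \<le> 97 * T" by (simp add: T_def)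
    then show ?thesis
      using \<open>1 * 1 \<le> T\<close> \<open>k * (14 * B + 24) \<le> 38 * T\<close>
      unfolding point_cost_def T_def[symmetric] by linarith
  qed
  then have "m * (n * (point_cost + 3)) \<le> m * (n * (160 * (m ^ 3 * B)))" by (intro mult_left_mono) auto
  also have "\<dots> = 160 * (n * m ^ 4 * B)" by (simp add: power3_eq_cube power4_eq_xxxx)
  finally have "m * (n * (point_cost + 3)) \<le> 160 * (n * m ^ 4 * B)" .
  moreover have "m ^ 4 * 1 \<le> m ^ 4 * (n * B)" using B1 instance_facts(1) by (intro mult_left_mono) auto
  then have "m ^ 4 \<le> n * m ^ 4 * B" by (simp add: mult.commute mult.left_commute)
  moreover have "m * (n * (point_cost + 3) + 15) = m * (n * (point_cost + 3)) + 15 * m"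
    by (simp add: distrib_left)
  \<comment> \<open>The constants 200, 160, 15 and 6 add up to 381.\<close>
  ultimately have u: "u \<le> 400 * (n * m ^ 4 * B)"
    using run(4) mp by linarith
  have "floorlog 2 (32 * X) = 4 * m + 12"
  proof -
    have "32 * X = 2 ^ (4 * m + 11)" by (simp add: X_def power_add)
    then show ?thesis using floorlog_power[of 1 2 "4 * m + 11"] by (simp add: floorlog_def)
  qed
  then have W: "unit_cost X \<le> 545 * m" using m1 by (simp add: unit_cost_def)
  have "t \<le> 400 * (n * m ^ 4 * B) * (545 * m)"
    using run(2) mult_le_mono[OF u W] by linarith
  then have "real t \<le> real (400 * (n * m ^ 4 * B) * (545 * m))" by (simp only: of_nat_le_iff)
  also have "\<dots> = 218000 * (real n * real m ^ 5) * B" by (simp add: eval_nat_numeral)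
  also have "\<dots> \<le> 218000 * (real n * real m ^ 5) * E"
  proof (rule mult_left_mono)
    have "0 \<le> E" by (simp add: E_def)
    then show "real B \<le> E" unfolding B_def by linarith
  qed auto
  \<comment> \<open>Of the six factors m, four are in the number of steps, one is the price of a
    step and one is the polynomial factor of the ball size.\<close>
  also have "\<dots> = 436000 * (real n * real m ^ 6 * 2 powr (k * H2 (real ?d / (2 * real m))))"
    by (simp add: E_def eval_nat_numeral)
  finally have time: "real t \<le> 436000 * (real n * real m ^ 6 * 2 powr (k * H2 (real ?d / (2 * real m))))" .
  obtain j where "run D j closest_pair_program s0 = return_pmf (Skip, s', t)"
    using reaches_run[OF run(1)] by blast
  then show ?thesis
    using time run(3) unfolding finds_pair_within_def s0_def[symmetric]
    by (intro exI[of _ j]) (simp add: has_found_def)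
qed

end


section \<open>Monotonicity of the entropy and the Zyablov rate\<close>

lemma H2_symmetric: "H2 (1 - x) = H2 x"
  by (simp add: H2_def algebra_simps)

text \<open>For b \<le> 2/3 the point b lies between b/2 and 1 - b/2, where H2 has the same value by
  symmetry; concavity does the rest.\<close>

lemma H2_half_le_H2:
  assumes "0 \<le> b" "b \<le> 2 / 3"
  shows "H2 (b / 2) \<le> H2 b"
proof -
  consider "b = 2 / 3" | "b < 2 / 3" using assms by linarith
  then show ?thesis
  proof cases
    case 1
    show ?thesis unfolding 1 using H2_symmetric[of "1 / 3"] by simp
  next
    case 2
    have "H2 (b / 2) + 0 * b \<le> H2 b"
      by (rule linear_le_H2[of "b / 2" b "1 - b / 2"]) (use 2 assms H2_symmetric[of "b / 2"] in auto)
    then show ?thesis by simp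
  qed
qed

text \<open>Gibbs' inequality at q = 1/2 is strict away from 1/2, since ln t = t - 1 forces t =
  1.\<close>

lemma H2_less_1:
  assumes "0 \<le> x" "x < 1 / 2"
  shows "H2 x < 1"
proof (cases "x = 0")
  case False
  have strict: "y * ln (1 / 2) - y * ln y < 1 / 2 - y" if "0 < y" "y \<noteq> 1 / 2" for y :: real
  proof -
    have "ln (1 / 2 / y) \<noteq> 1 / 2 / y - 1"
    proof
      assume "ln (1 / 2 / y) = 1 / 2 / y - 1"
      then have "1 / 2 / y = 1" using that by (intro ln_eq_minus_one) auto
      then show False using that by simp
    qed
    then have "ln (1 / 2 / y) < 1 / 2 / y - 1" using that ln_le_minus_one[of "1 / 2 / y"] by simp
    then have "y * ln (1 / 2 / y) < y * (1 / 2 / y - 1)" using that by (intro mult_strict_left_mono)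
    also have "\<dots> = 1 / 2 - y" using that by (simp add: field_simps)
    also have "ln (1 / 2 / y) = ln (1 / 2) - ln y" using that by (subst ln_div) auto
    finally show ?thesis by (simp add: algebra_simps)
  qed
  have "x * ln (1 / 2) - x * ln x + ((1 - x) * ln (1 / 2) - (1 - x) * ln (1 - x)) < (1 / 2 - x) + (1 / 2 - (1 - x))"
    using False assms by (intro add_strict_mono strict) auto
  then have "- x * ln x - (1 - x) * ln (1 - x) < - ln (1 / 2)" by (simp add: algebra_simps)
  then have "- x * ln x - (1 - x) * ln (1 - x) < ln 2" by (simp add: ln_div)
  then have "(- x * ln x - (1 - x) * ln (1 - x)) / ln 2 < 1" by simp
  then show ?thesis by (simp add: H2_def log_def diff_divide_distrib)
qed (simp add: H2_def)

text \<open>The point y is a mixture of x and the maximiser 1/2 with positive weight on 1/2, so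
  concavity lifts its value strictly above that of x.\<close>

lemma H2_strict_mono:
  assumes "0 \<le> x" "x < y" "y \<le> 1 / 2"
  shows "H2 x < H2 y"
proof -
  define t where "t = (y - x) / (1 / 2 - x)"
  have t: "0 < t" "t \<le> 1" using assms by (auto simp: t_def)
  have "t * (1 / 2 - x) = y - x" using assms by (simp add: t_def)
  then have "y = (1 - t) * x + t * (1 / 2)" by (simp add: algebra_simps)
  then have "(1 - t) * H2 x + t * H2 (1 / 2) \<le> H2 y"
    using H2_concave[of x "1 / 2" t] assms t by simp
  moreover have "t * H2 x < t * H2 (1 / 2)"
    using t H2_less_1[of x] assms by (intro mult_strict_left_mono) (auto simp: H2_values)
  ultimately show ?thesis by (simp add: algebra_simps)
qed

text \<open>Outside the image of H2 the inverse is unspecified, so y must first be shown to be a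
  value of H2. The intermediate value theorem is applied on [b, 1/2], where the arguments of both
  logarithms are positive.\<close>

lemma H2_inv_nonneg:
  assumes "0 < b" "b < 1 / 2" "H2 b < y" "y < 1"
  shows "0 \<le> H2_inv y"
proof -
  have "continuous_on {b..1 / 2} H2"
    unfolding H2_def using assms by (intro continuous_intros) auto
  moreover have "H2 (1 / 2) = 1" by (rule H2_values)
  ultimately obtain x where "b \<le> x" "x \<le> 1 / 2" "H2 x = y"
    using IVT'[of H2 b y "1 / 2"] assms by auto
  moreover have "inj_on H2 {0..1 / 2}"
  proof (rule inj_onI)
    fix u v assume "u \<in> {0..1 / 2}" "v \<in> {0..1 / 2}" "H2 u = H2 v"
    then show "u = v" using H2_strict_mono[of u v] H2_strict_mono[of v u] by (cases u v rule: linorder_cases) auto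
  qed
  ultimately have "H2_inv y \<in> {0..1 / 2}"
    unfolding H2_inv_def using assms by (intro the_inv_into_into) (auto intro!: image_eqI)
  then show ?thesis by simp
qed

lemma zyablov_rate_le:
  assumes "0 < b" "b < 1 / 2"
  shows "zyablov_rate b \<le> 1 - H2 b"
  unfolding zyablov_rate_def
proof (rule cSUP_least)
  show "{0<..<1 - H2 b} \<noteq> {}" using H2_less_1[of b] assms by simp
  fix r assume r: "r \<in> {0<..<1 - H2 b}"
  then have "0 \<le> H2_inv (1 - r)" using assms by (intro H2_inv_nonneg[of b]) auto
  \<comment> \<open>Nonnegativity is enough for the factor to be at most 1; at 0 the quotient is 0
    by convention.\<close>
  then have "r * (1 - b / H2_inv (1 - r)) \<le> r * 1" using r assms by (intro mult_left_mono) auto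
  also have "\<dots> \<le> 1 - H2 b" using r by simp
  finally show "r * (1 - b / H2_inv (1 - r)) \<le> 1 - H2 b" .
qed

section \<open>The exponent of the running time\<close>

lemma ceil_div_less: "0 < b \<Longrightarrow> real (ceil_div a b) \<le> a / b + 1"
proof (cases "ceil_div a b = 0")
  case False
  assume b: "0 < b"
  have "\<not> ceil_div a b \<le> ceil_div a b - 1" using False by simp
  then have "(ceil_div a b - 1) * b < a" using ceil_div_le_iff[OF b, of a] by simp
  then have "real (ceil_div a b - 1) * real b < real a" by (metis of_nat_less_iff of_nat_mult)
  then have "real (ceil_div a b - 1) < a / b" using b by (simp add: field_simps)
  then show ?thesis using False by simp
qed simp

lemma exponent_bound:
  assumes d: "d < d2" "d2 \<le> m"
  defines "a \<equiv> real d / real m" and "b \<equiv> real d2 / real m"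
  defines "E \<equiv> real (window_length m d d2) * H2 (real d / (2 * real m))"
  shows "b \<le> 2 / 3 \<Longrightarrow> E \<le> (H2 b - lens_exp a b) * m + 55"
    and "E \<le> (H2 b - lens_exp a b) * m + 2 * m"
proof -
  let ?k = "window_length m d d2" and ?h = "H2 (a / 2)"
  have m: "0 < m" using d by simp
  have ab: "0 \<le> a" "a < b" "b \<le> 1" using d m by (auto simp: a_def b_def divide_strict_right_mono)
  have E: "E = ?k * ?h" by (simp add: E_def a_def mult.commute)
  have h: "0 \<le> ?h" "?h \<le> 1" using ab by (auto intro: H2_nonneg H2_le_1)
  have kh: "?k * ?h \<le> ?k" using h by (simp add: mult_left_le)
  have lens: "lens_exp a b \<le> H2 (b / 2)" using ab by (intro lens_exp_le_H2_half) auto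
  have "0 < (m - d) * (m - d)" using d by simp
  from ceil_div_less[OF this, of "m * (m * (m - 2 * d2 + 6))"]
  have "real ?k \<le> real (m * (m * (m - 2 * d2 + 6))) / real ((m - d) * (m - d)) + 1"
    by (rule order.trans[rotated]) (simp add: window_length_def)
  also have "real (m * (m * (m - 2 * d2 + 6))) / real ((m - d) * (m - d))
      = real (m - 2 * d2 + 6) / (1 - a)\<^sup>2"
  proof -
    have "real (m - d) = m * (1 - a)" using d m by (simp add: a_def of_nat_diff field_simps)
    then show ?thesis using m by (simp add: power2_eq_square)
  qed
  finally have k: "?k \<le> real (m - 2 * d2 + 6) / (1 - a)\<^sup>2 + 1" .
  show "E \<le> (H2 b - lens_exp a b) * m + 55" if b: "b \<le> 2 / 3"
  proof (cases "b \<le> 1 / 2")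
    case True
    then have d2: "2 * d2 \<le> m" using m by (simp add: b_def field_simps)
    \<comment> \<open>Since a < b \<le> 1/2, the additive 6 lengthens the window by at most 24, and
      rounding adds 1.\<close>
    have "1 / 4 \<le> (1 - a)\<^sup>2" using power_mono[of "1 / 2" "1 - a" 2] ab True by (simp add: power2_eq_square)
    then have "6 / (1 - a)\<^sup>2 \<le> 24" by (subst pos_divide_le_eq) auto
    moreover have "real (m - 2 * d2 + 6) / (1 - a)\<^sup>2 = m * ((1 - 2 * b) / (1 - a)\<^sup>2) + 6 / (1 - a)\<^sup>2"
      using d2 m by (simp add: of_nat_diff b_def add_divide_distrib diff_divide_distrib algebra_simps)
    ultimately have "?k \<le> m * ((1 - 2 * b) / (1 - a)\<^sup>2) + 25" using k by linarith
    then have "?k * ?h \<le> (m * ((1 - 2 * b) / (1 - a)\<^sup>2) + 25) * ?h" using h by (intro mult_right_mono)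
    also have "\<dots> = m * ((1 - 2 * b) / (1 - a)\<^sup>2 * ?h) + 25 * ?h" by (simp add: distrib_right)
    also have "\<dots> \<le> m * (H2 b - lens_exp a b) + 25 * 1"
      using exponent_ineq[of a b] ab True h by (intro add_mono mult_left_mono) auto
    finally show ?thesis by (simp add: E mult.commute)
  next
    case False
    \<comment> \<open>Beyond 1/2 the truncated difference is 0 and only the 6 remains, so the window
      has at most 6 * 9 + 1 = 55 coordinates. The exponent of the claim must still not be negative,
      which holds up to b = 2/3 by \<open>H2_half_le_H2\<close>.\<close>
    then have "m - 2 * d2 = 0" using m by (simp add: b_def field_simps)
    moreover have "1 / 9 \<le> (1 - a)\<^sup>2" using power_mono[of "1 / 3" "1 - a" 2] ab b by (simp add: power2_eq_square)
    then have "6 / (1 - a)\<^sup>2 \<le> 54" by (subst pos_divide_le_eq) auto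
    ultimately have "?k \<le> 55" using k by simp
    moreover have "0 \<le> (H2 b - lens_exp a b) * m"
      using lens H2_half_le_H2[of b] ab b by (intro mult_nonneg_nonneg) auto
    ultimately show ?thesis using kh E by linarith
  qed
  \<comment> \<open>The crude bound: the ball exponent is at most m and the exponent of the claim is
    at least - m. It serves for the finitely many small m.\<close>
  have "?k \<le> m" by (simp add: window_length_def)
  moreover have "lens_exp a b \<le> 1" using lens H2_le_1[of "b / 2"] ab by simp
  then have "(- 1) * real m \<le> (H2 b - lens_exp a b) * m"
    using H2_nonneg[of b] ab by (intro mult_right_mono) auto
  ultimately show "E \<le> (H2 b - lens_exp a b) * m + 2 * m" using kh E by linarith
qed

text \<open>A coordinate separates at most two of the three pairs, since two of three bits
  agree.\<close>

lemma three_words_distance: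
  assumes "length x = m" "length y = m" "length z = m"
  shows "hamming x y + hamming y z + hamming x z \<le> 2 * m"
proof -
  have "hamming x y + hamming y z + hamming x z
      = (\<Sum>i<m. of_bool (x ! i \<noteq> y ! i) + of_bool (y ! i \<noteq> z ! i) + of_bool (x ! i \<noteq> z ! i))"
    using assms by (simp add: hamming_eq_sum sum.distrib del: sum_of_bool_eq)
  also have "\<dots> \<le> (\<Sum>i<m. 2)" by (intro sum_mono) auto
  finally show ?thesis by (simp add: mult.commute)
qed

text \<open>A code of relative distance above \<open>2/3\<close> has at most two words, so it stays away from the
  Gilbert--Varshamov bound unless the block length is small.\<close>
lemma meets_GV_large_distance:
  assumes C: "binary_code m K d C" and GV: "meets_GV \<epsilon> m K d" and d: "2 / 3 < real d / real m" "d \<le> m"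
  shows "1 / 15 \<le> 1 / real m + \<epsilon> m"
proof -
  have m: "0 < m" using d by (cases "m = 0") auto
  have K: "0 < K" using GV by (simp add: meets_GV_def)
  have "K \<le> 2"
  proof (rule ccontr)
    assume "\<not> K \<le> 2"
    then have "3 \<le> card C" using C by (simp add: binary_code_def)
    then obtain S where "S \<subseteq> C" "card S = 3" by (meson obtain_subset_with_card_n)
    then obtain x y z where xyz: "x \<in> C" "y \<in> C" "z \<in> C" "x \<noteq> y" "y \<noteq> z" "x \<noteq> z"
      by (auto simp: card_3_iff)
    then have "d \<le> hamming x y" "d \<le> hamming y z" "d \<le> hamming x z"
      and "length x = m" "length y = m" "length z = m"
      using C by (auto simp: binary_code_def cube_def)
    then have "3 * d \<le> 2 * m" using three_words_distance[of x m y z] by simp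
    then have "3 * real d \<le> 2 * real m" by (metis of_nat_le_iff of_nat_mult of_nat_numeral)
    then show False using d m by (simp add: field_simps)
  qed
  then have "log 2 (real K) \<le> log 2 2" using K by (subst log_le_cancel_iff) auto
  then have "1 / real m * log 2 (real K) \<le> 1 / real m * 1" by (intro mult_left_mono) auto
  \<comment> \<open>The cross entropy at q = 2/3 is log 3 - d/m. Hence 1 - H2(d/m) > 5/3 - log 3
    \<ge> 5/3 - 65/41 = 10/123 > 1/15.\<close>
  moreover have "H2 (d / m) \<le> d / m * - log 2 (2 / 3) + (1 - d / m) * - log 2 (1 - 2 / 3)"
    using d m by (intro H2_le_cross) auto
  then have "H2 (d / m) \<le> log 2 3 - d / m" by (simp add: log_divide algebra_simps)
  ultimately show ?thesis using GV d log2_3_bounds unfolding meets_GV_def by linarith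
qed

lemma finds_pair_within_mono:
  assumes "finds_pair_within D P n m xs p T 1" "T \<le> T'" "q \<le> 1"
  shows "finds_pair_within D P n m xs p T' q"
proof -
  obtain k where "\<forall>(c, s, t)\<in>set_pmf (run D k P (input_state n m xs)). c = Skip \<and> real t \<le> T"
    "1 \<le> measure_pmf.prob (run D k P (input_state n m xs)) {(c, s, t). (reg s ''a'', reg s ''b'') = p}"
    using assms(1) unfolding finds_pair_within_def by blast
  then show ?thesis using assms(2,3) unfolding finds_pair_within_def by (intro exI[of _ k]) force
qed

lemma closest_pair_program_time:
  fixes F c A :: real
  assumes inst: "closest_pair_instance n m xs p"
    and E: "window_length m (d_min xs) (d_second xs) * H2 (real (d_min xs) / (2 * real m)) \<le> F * m + c"
    and A: "436000 * 2 powr c \<le> A"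
  shows "finds_pair_within D closest_pair_program n m xs p
    (A * (real n * (log 2 (real n))\<^sup>2 * 2 powr (F * real m) * real m ^ 6)) (1 - 1 / (real n)\<^sup>2)"
proof (rule finds_pair_within_mono[OF closest_pair_program_correct[OF inst]])
  have "3 \<le> n" using inst by (simp add: closest_pair_instance_def)
  then have "log 2 2 \<le> log 2 (real n)" by (subst log_le_cancel_iff) auto
  \<comment> \<open>From n \<ge> 2 the logarithm is at least 1, so its square only enlarges the
    bound.\<close>
  then have L: "1 \<le> (log 2 (real n))\<^sup>2" by simp
  let ?e = "window_length m (d_min xs) (d_second xs) * H2 (real (d_min xs) / (2 * real m))"
  have "2 powr ?e \<le> 2 powr (F * m + c)" using E by (intro powr_mono) auto
  also have "\<dots> = 2 powr (F * m) * 2 powr c" by (rule powr_add)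
  finally have "436000 * (real n * real m ^ 6 * 2 powr ?e)
      \<le> 436000 * (real n * real m ^ 6 * (2 powr (F * m) * 2 powr c))"
    by (intro mult_left_mono) auto
  also have "\<dots> = (436000 * 2 powr c) * (real n * 1 * 2 powr (F * m) * real m ^ 6)" by simp
  also have "\<dots> \<le> A * (real n * (log 2 (real n))\<^sup>2 * 2 powr (F * m) * real m ^ 6)"
    using A L by (intro mult_mono order.trans[OF _ A] mult_left_mono mult_right_mono) auto
  finally show "436000 * (real n * real m ^ 6 * 2 powr ?e)
      \<le> A * (real n * (log 2 (real n))\<^sup>2 * 2 powr (F * real m) * real m ^ 6)" .
qed simp

lemma minus_lens_exp: "c - a - (1 - a) * H2 ((b - a) / (2 * (1 - a))) = c - lens_exp a b"
  by (simp add: lens_exp_def)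

theorem mainTheorem2:
  shows
  "(\<exists>P (A :: real) (e :: nat). oracle_free P \<and>
      (\<forall>n m xs p. closest_pair_instance n m xs p \<and> real (d_second xs) / real m < 1 / 2 \<longrightarrow>
        (let \<delta> = real (d_min xs) / real m; \<delta>' = real (d_second xs) / real m in
          finds_pair_within (\<lambda>_. []) P n m xs p
            (A * (real n * (log 2 (real n))\<^sup>2
               * 2 powr ((1 - zyablov_rate \<delta>' - \<delta>
                          - (1 - \<delta>) * H2 ((\<delta>' - \<delta>) / (2 * (1 - \<delta>)))) * real m)
               * real m ^ e))
            (1 - 1 / (real n)\<^sup>2))))
   \<and>
   (\<forall>\<epsilon> :: nat \<Rightarrow> real. \<epsilon> \<longlonglongrightarrow> 0 \<longrightarrow>
     (\<exists>P (A :: real) (e :: nat).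
      (\<forall>n m xs p K C D. closest_pair_instance n m xs p
          \<and> binary_code m K (d_second xs) C \<and> meets_GV \<epsilon> m K (d_second xs)
          \<and> decodes m (d_second xs) C D \<longrightarrow>
        (let \<delta> = real (d_min xs) / real m; \<delta>' = real (d_second xs) / real m in
          finds_pair_within D P n m xs p
            (A * (real n * (log 2 (real n))\<^sup>2
               * 2 powr ((H2 \<delta>' - \<delta>
                          - (1 - \<delta>) * H2 ((\<delta>' - \<delta>) / (2 * (1 - \<delta>)))) * real m)
               * real m ^ e))
            (1 - 1 / (real n)\<^sup>2)))))"
proof (intro conjI allI impI, goal_cases)
  case 1
  show ?case
  proof (intro exI[of _ closest_pair_program] exI[of _ "436000 * 2 powr 55"] exI[of _ 6] conjI allI impI,
      unfold Let_def, goal_cases)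
    case 1
    show ?case by (rule oracle_free_closest_pair_program)
  next
    case (2 n m xs p)
    let ?a = "real (d_min xs) / real m" and ?b = "real (d_second xs) / real m"
    have inst: "closest_pair_instance n m xs p" and b: "?b < 1 / 2" using 2 by auto
    note d2 = d_second_facts[OF inst]
    have "0 < ?b" using d2(1,2) by simp
    then have "H2 ?b \<le> 1 - zyablov_rate ?b" using zyablov_rate_le[of ?b] b by simp
    then have "(H2 ?b - lens_exp ?a ?b) * m \<le> (1 - zyablov_rate ?b - lens_exp ?a ?b) * m"
      by (intro mult_right_mono) auto
    moreover have "window_length m (d_min xs) (d_second xs) * H2 (real (d_min xs) / (2 * real m))
        \<le> (H2 ?b - lens_exp ?a ?b) * m + 55"
      using exponent_bound(1)[OF d2(1,2)] b by simp
    ultimately have "window_length m (d_min xs) (d_second xs) * H2 (real (d_min xs) / (2 * real m))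
        \<le> (1 - zyablov_rate ?b - ?a - (1 - ?a) * H2 ((?b - ?a) / (2 * (1 - ?a)))) * m + 55"
      unfolding minus_lens_exp by linarith
    then show ?case by (rule closest_pair_program_time[OF inst]) simp
  qed
next
  case (2 \<epsilon>)
  have "(\<lambda>m. 1 / real m + \<epsilon> m) \<longlonglongrightarrow> 0 + 0"
    using 2 lim_1_over_n by (intro tendsto_add)
  then have "eventually (\<lambda>m. 1 / real m + \<epsilon> m < 1 / 15) sequentially"
    by (rule order_tendstoD) simp
  then obtain m0 where m0: "\<And>m. m0 \<le> m \<Longrightarrow> 1 / real m + \<epsilon> m < 1 / 15"
    by (auto simp: eventually_sequentially)
  show ?case
  \<comment> \<open>The threshold m0 depends on \<epsilon> alone. For m < m0 the excess 2m in the
    exponent is at most 2 m0 and is absorbed into the constant.\<close>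
  proof (intro exI[of _ closest_pair_program] exI[of _ "436000 * 2 powr (55 + 2 * real m0)"] exI[of _ 6]
      conjI allI impI, unfold Let_def, goal_cases)
    case (1 n m xs p K C D)
    let ?a = "real (d_min xs) / real m" and ?b = "real (d_second xs) / real m"
    have inst: "closest_pair_instance n m xs p" using 1 by auto
    note d2 = d_second_facts[OF inst]
    have "window_length m (d_min xs) (d_second xs) * H2 (real (d_min xs) / (2 * real m))
        \<le> (H2 ?b - lens_exp ?a ?b) * m + (55 + 2 * m0)"
    proof (cases "?b \<le> 2 / 3")
      case True
      then show ?thesis using exponent_bound(1)[OF d2(1,2)] by simp
    next
      case False
      then have "1 / 15 \<le> 1 / real m + \<epsilon> m"
        using 1 d2 by (intro meets_GV_large_distance[of m K "d_second xs" C]) auto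
      then have "m < m0" using m0[of m] by (meson not_le)
      then show ?thesis using exponent_bound(2)[OF d2(1,2)] by simp
    qed
    then have "window_length m (d_min xs) (d_second xs) * H2 (real (d_min xs) / (2 * real m))
        \<le> (H2 ?b - ?a - (1 - ?a) * H2 ((?b - ?a) / (2 * (1 - ?a)))) * m + (55 + 2 * m0)"
      unfolding minus_lens_exp .
    then show ?case by (rule closest_pair_program_time[OF inst]) simp
  qed
qed

end
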